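(* Fix a rectangle $\mu=(p^q)$ (the partition with $q$ rows of length $p$). Let $\mathcal{F}_{p,q}\subseteq\mathcal{SVT}$ be the subset of all triples $(\lambda,N,S)\in\mathcal{SVT}$ such that $\lambda\subseteq\mu\cup\lambda^{\circ}$ for some partition $\lambda^{\circ}$ of rank less than three. Then the Markov chain $\mathcal{MC}_{\mathsf{SVT}}(\lambda,N,S)$ is rapidly mixing for all $(\lambda,N,S)\in\mathcal{F}_{p,q}$, and hence there is a fully polynomial almost uniform sampler (FPAUS) for $\mathcal{F}_{p,q}$.
   Context: Partitions and tableaux. A partition is a finite weakly decreasing sequence of positive integers, identified with its Young diagram $\{(r,c):1\le c\le\lambda_r\}$ (rows from the top, columns from the left); $|\lambda|$ is the number of boxes; containment and unions are of Young diagrams. The rank is the number of boxes $(i,i)$ in the diagram. For $N\ge|\lambda|$, an $N$-standard set-valued tableau of shape $\lambda$ assigns to each box $(r,c)$ a nonempty set $T(r,c)\subseteq\{1,\ldots,N\}$ such that each value in $\{1,\ldots,N\}$ appears exactly once and, whenever one value is selected from each box, the filling increases down columns and weakly increases along rows. $\mathsf{SVT}(\lambda,N)$ is the set of these. Pre-tableaux. For $0\le k\le N$, an $N\langle k\rangle$-standard set-valued pre-tableau of shape $\lambda$ assigns a (possibly empty) subset of $\{k+1,\ldots,N\}$ to each box of $\lambda$ such that: (i) each value in $\{k+1,\ldots,N\}$ appears exactly once; (ii) if $T(r,c)\ne\emptyset$, then $(r+1,c)\in\lambda$ implies $T(r+1,c)\neq\emptyset$ and $(r,c+1)\in\lambda$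 implies $T(r,c+1)\ne\emptyset$; (iii) if $T(r,c)\neq\emptyset$, then $(r+1,c)\in\lambda$ implies $\max T(r,c)<\min T(r+1,c)$ and $(r,c+1)\in\lambda$ implies $\max T(r,c)<\min T(r,c+1)$; (iv) at most $k$ boxes have $T(r,c)=\emptyset$. For such an $S$, $\mathsf{SVT}(\lambda,N,S)$ is the set of $T\in\mathsf{SVT}(\lambda,N)$ with $S(r,c)\subseteq T(r,c)$ for all boxes, and $\lambda\setminus S=\{(r,c)\in\lambda:S(r,c)=\emptyset\}$. $\mathcal{SVT}$ is the set of all triples $(\lambda,N,S)$ with $\lambda$ a partition, $N\ge|\lambda|$, and $S$ an $N\langle k\rangle$-standard set-valued pre-tableau of shape $\lambda$ for some $0\le k\le N$ ($k$ always denotes the integer associated with $S$). Generation algorithm. For $(r,c)\in\lambda$, $h_\lambda(r,c)=\{(p,q)\in\lambda: p=r,\ q>c,\text{ or } q=c,\ p>r\}$. $\mathrm{Hook}(\lambda)$: choose $(r,c)\in\lambda$ uniformly at random; while $h_\lambda(r,c)\ne\emptyset$, replace $(r,c)$ by a uniformly random element of $h_\lambda(r,c)$; return $(r,c)$. For $A\subset\mathbb{N}^2$, $NW(A)=\{(r,c)\in A:\{(r,c)\}=A\cap([r]\times[c])\}$, where $[n]=\{1,\dots,n\}$. $\mathsf{SVGen}(\lambda,N,k,T)$, with $T$ an $N\langle k\rangle$-standard set-valued pre-tableau of shape $\lambda$: if $k=N$, let $(r,c)=\mathrm{Hook}(\lambda)$, set $T(r,c)=\{N\}$ and replace $k$ by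 $N-1$. Then for $M=k,k-1,\ldots,1$: let $\lambda'=\{(r,c)\in\lambda:T(r,c)=\emptyset\}$; with probability $(M-|\lambda'|)/M$ choose $(r,c)$ uniformly at random from $NW(\{(p,q)\in\lambda:T(p,q)\ne\emptyset\})$ and add $M$ to $T(r,c)$; otherwise let $(r,c)=\mathrm{Hook}(\lambda')$ and set $T(r,c)=\{M\}$. Return $T$. All random choices are independent. For $T\in\mathsf{SVT}(\lambda,N,S)$, $\mathbb{P}_{\mathsf{SVG}}(T,k)$ is the probability that $\mathsf{SVGen}(\lambda,N,k,S)$ returns $T$. The chain. $\mathcal{MC}_{\mathsf{SVT}}(\lambda,N,S)$ is the Markov chain on state space $\mathsf{SVT}(\lambda,N,S)$ with transition matrix $P(T,F)=\mathbb{P}_{\mathsf{SVG}}(F,k)\min\{1,\mathbb{P}_{\mathsf{SVG}}(T,k)/\mathbb{P}_{\mathsf{SVG}}(F,k)\}$ for $F\ne T$ and $P(T,T)=1-\sum_{R\neq T}P(T,R)$ (the Metropolis chain with uniform target distribution $U$). Mixing and sampling. $d_{\mathsf{TV}}(\mu,\nu)=\max_{A}|\mu(A)-\nu(A)|$. With $\pi$ the stationary distribution, $d(t)=\max_x d_{\mathsf{TV}}(P^t(x,\cdot),\pi)$ and $t_{\mathsf{mix}}(\epsilon)=\min\{t:d(t)\le\epsilon\}$. Rapidly mixing on a family of triples means that $t_{\mathsf{mix}}(\epsilon)$ is bounded by a polynomial in $\epsilon^{-1}$ and the problem size parameters $|\lambda\setminus S|$ and $k$, uniformly over the family. A FPAUS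 for a subset $\mathcal{F}\subseteq\mathcal{SVT}$ is a randomized algorithm that, given $(\lambda,N,S)\in\mathcal{F}$ and a bias parameter $\delta$, outputs a random $T\in\mathsf{SVT}(\lambda,N,S)$ from a distribution $\Gamma$ with $d_{\mathsf{TV}}(\Gamma,U)\le\delta$, where $U$ is uniform on $\mathsf{SVT}(\lambda,N,S)$, in time polynomial in $k$, $|\lambda\setminus S|$ and $\log\delta^{-1}$. *)

theory Defs
  imports "HOL-Probability.Probability" "HOL-Library.Extended_Nat"
begin

section \<open>Partitions and set-valued tableaux\<close>

definition is_partition :: "nat list \<Rightarrow> bool" where
  "is_partition lam \<longleftrightarrow> sorted_wrt (\<ge>) lam \<and> (\<forall>x\<in>set lam. 0 < x)"

type_synonym box = "nat \<times> nat"

text \<open>Boxes are pairs (row, column), both starting from 1.\<close>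

definition diagram :: "nat list \<Rightarrow> box set" where
  "diagram lam = {(r, c). 1 \<le> r \<and> r \<le> length lam \<and> 1 \<le> c \<and> c \<le> lam ! (r - 1)}"

definition diag_rank :: "nat list \<Rightarrow> nat" where
  "diag_rank lam = card {i. (i, i) \<in> diagram lam}"

text \<open>A filling is a function on all of \<open>\<nat>\<^sup>2\<close> which is empty outside the diagram, so that
  equality of fillings is equality of functions.\<close>

type_synonym tableau = "box \<Rightarrow> nat set"

definition SVT :: "nat list \<Rightarrow> nat \<Rightarrow> tableau set" where
  "SVT lam N = {T.
     (\<forall>b. b \<notin> diagram lam \<longrightarrow> T b = {}) \<and>
     (\<forall>b\<in>diagram lam. T b \<noteq> {} \<and> T b \<subseteq> {1..N}) \<and>
     (\<forall>v\<in>{1..N}. \<exists>!b. b \<in> diagram lam \<and> v \<in> T b) \<and>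
     (\<forall>f :: box \<Rightarrow> nat. (\<forall>b\<in>diagram lam. f b \<in> T b) \<longrightarrow>
        (\<forall>r r' c. (r, c) \<in> diagram lam \<and> (r', c) \<in> diagram lam \<and> r < r' \<longrightarrow> f (r, c) < f (r', c)) \<and>
        (\<forall>r c c'. (r, c) \<in> diagram lam \<and> (r, c') \<in> diagram lam \<and> c < c' \<longrightarrow> f (r, c) \<le> f (r, c')))}"

definition pretableau :: "nat list \<Rightarrow> nat \<Rightarrow> nat \<Rightarrow> tableau \<Rightarrow> bool" where
  "pretableau lam N k T \<longleftrightarrow>
     k \<le> N \<and>
     (\<forall>b. b \<notin> diagram lam \<longrightarrow> T b = {}) \<and>
     (\<forall>b\<in>diagram lam. T b \<subseteq> {k+1..N}) \<and>
     (\<forall>v\<in>{k+1..N}. \<exists>!b. b \<in> diagram lam \<and> v \<in> T b) \<and>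
     (\<forall>r c. (r, c) \<in> diagram lam \<and> T (r, c) \<noteq> {} \<longrightarrow>
        ((r + 1, c) \<in> diagram lam \<longrightarrow> T (r + 1, c) \<noteq> {}) \<and>
        ((r, c + 1) \<in> diagram lam \<longrightarrow> T (r, c + 1) \<noteq> {})) \<and>
     (\<forall>r c. (r, c) \<in> diagram lam \<and> T (r, c) \<noteq> {} \<longrightarrow>
        ((r + 1, c) \<in> diagram lam \<longrightarrow> Max (T (r, c)) < Min (T (r + 1, c))) \<and>
        ((r, c + 1) \<in> diagram lam \<longrightarrow> Max (T (r, c)) < Min (T (r, c + 1)))) \<and>
     card {b \<in> diagram lam. T b = {}} \<le> k"

definition SVT_ext :: "nat list \<Rightarrow> nat \<Rightarrow> tableau \<Rightarrow> tableau set" where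
  "SVT_ext lam N S = {T \<in> SVT lam N. \<forall>b\<in>diagram lam. S b \<subseteq> T b}"

definition empty_boxes :: "nat list \<Rightarrow> tableau \<Rightarrow> box set" where
  "empty_boxes lam S = {b \<in> diagram lam. S b = {}}"

definition SVT_triples :: "(nat list \<times> nat \<times> tableau) set" where
  "SVT_triples = {(lam, N, S).
     is_partition lam \<and> card (diagram lam) \<le> N \<and> (\<exists>k\<le>N. pretableau lam N k S)}"

definition rect_family :: "nat \<Rightarrow> nat \<Rightarrow> (nat list \<times> nat \<times> tableau) set" where
  "rect_family p q = {(lam, N, S) \<in> SVT_triples.
     \<exists>lam0. is_partition lam0 \<and> diag_rank lam0 < 3 \<and>
       diagram lam \<subseteq> diagram (replicate q p) \<union> diagram lam0}"


section \<open>The generation algorithm\<close>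

definition hook :: "box set \<Rightarrow> box \<Rightarrow> box set" where
  "hook A b = {(p, q) \<in> A. (p = fst b \<and> q > snd b) \<or> (q = snd b \<and> p > fst b)}"

text \<open>The finiteness guard only makes the recursion total; all diagrams are finite.\<close>

function hook_walk :: "box set \<Rightarrow> box \<Rightarrow> box pmf" where
  "hook_walk A b =
     (if finite A \<and> hook A b \<noteq> {}
      then bind_pmf (pmf_of_set (hook A b)) (\<lambda>b'. hook_walk A b')
      else return_pmf b)"
  by pat_completeness auto
termination
proof (relation "Wellfounded.measure (\<lambda>(A, b). card {x \<in> A. fst b \<le> fst x \<and> snd b \<le> snd x \<and> x \<noteq> b})", goal_cases)
  case 1
  show ?case
    by (rule wf_measure)
next
  case (2 A b b')
  from 2 have fin: "finite A" and ne: "hook A b \<noteq> {}"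
    by blast+
  from fin have "finite (hook A b)"
    by (rule rev_finite_subset) (auto simp: hook_def)
  with 2 ne have b': "b' \<in> hook A b"
    by (metis set_pmf_of_set)
  have "{x \<in> A. fst b' \<le> fst x \<and> snd b' \<le> snd x \<and> x \<noteq> b'}
      \<subset> {x \<in> A. fst b \<le> fst x \<and> snd b \<le> snd x \<and> x \<noteq> b}"
  proof (rule psubsetI)
    show "{x \<in> A. fst b' \<le> fst x \<and> snd b' \<le> snd x \<and> x \<noteq> b'}
      \<subseteq> {x \<in> A. fst b \<le> fst x \<and> snd b \<le> snd x \<and> x \<noteq> b}"
      using b' by (auto simp: hook_def)
    have "b' \<in> {x \<in> A. fst b \<le> fst x \<and> snd b \<le> snd x \<and> x \<noteq> b}"
      using b' by (cases b) (auto simp: hook_def)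
    then show "{x \<in> A. fst b' \<le> fst x \<and> snd b' \<le> snd x \<and> x \<noteq> b'}
      \<noteq> {x \<in> A. fst b \<le> fst x \<and> snd b \<le> snd x \<and> x \<noteq> b}"
      by blast
  qed
  with fin show ?case
    by (simp add: psubset_card_mono)
qed

declare hook_walk.simps [simp del]

definition Hook :: "box set \<Rightarrow> box pmf" where
  "Hook A = bind_pmf (pmf_of_set A) (hook_walk A)"

definition NW :: "box set \<Rightarrow> box set" where
  "NW A = {(r, c) \<in> A. {(r, c)} = A \<inter> ({1..r} \<times> {1..c})}"

definition svgen_step :: "nat list \<Rightarrow> nat \<Rightarrow> tableau \<Rightarrow> tableau pmf" where
  "svgen_step lam M T =
     (let E = empty_boxes lam T in
      bind_pmf (bernoulli_pmf ((real M - real (card E)) / real M))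
        (\<lambda>coin. if coin
           then map_pmf (\<lambda>b. T(b := insert M (T b))) (pmf_of_set (NW {b \<in> diagram lam. T b \<noteq> {}}))
           else map_pmf (\<lambda>b. T(b := {M})) (Hook E)))"

primrec svgen_loop :: "nat list \<Rightarrow> nat \<Rightarrow> tableau \<Rightarrow> tableau pmf" where
  "svgen_loop lam 0 T = return_pmf T"
| "svgen_loop lam (Suc M) T = bind_pmf (svgen_step lam (Suc M) T) (svgen_loop lam M)"

definition SVGen :: "nat list \<Rightarrow> nat \<Rightarrow> nat \<Rightarrow> tableau \<Rightarrow> tableau pmf" where
  "SVGen lam N k T =
     (if k = N
      then bind_pmf (Hook (diagram lam)) (\<lambda>b. svgen_loop lam (N - 1) (T(b := {N})))
      else svgen_loop lam k T)"

definition P_SVG :: "nat list \<Rightarrow> nat \<Rightarrow> nat \<Rightarrow> tableau \<Rightarrow> tableau \<Rightarrow> real" where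
  "P_SVG lam N k S T = pmf (SVGen lam N k S) T"


section \<open>Finite Markov chains\<close>

definition tv_dist :: "'a set \<Rightarrow> ('a \<Rightarrow> real) \<Rightarrow> ('a \<Rightarrow> real) \<Rightarrow> real" where
  "tv_dist X mu nu = Max ((\<lambda>A. \<bar>sum mu A - sum nu A\<bar>) ` Pow X)"

primrec mat_pow :: "'a set \<Rightarrow> ('a \<Rightarrow> 'a \<Rightarrow> real) \<Rightarrow> nat \<Rightarrow> 'a \<Rightarrow> 'a \<Rightarrow> real" where
  "mat_pow X P 0 x y = (if x = y then 1 else 0)"
| "mat_pow X P (Suc t) x y = (\<Sum>z\<in>X. mat_pow X P t x z * P z y)"

definition is_stationary :: "'a set \<Rightarrow> ('a \<Rightarrow> 'a \<Rightarrow> real) \<Rightarrow> 'a pmf \<Rightarrow> bool" where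
  "is_stationary X P ppi \<longleftrightarrow>
     set_pmf ppi \<subseteq> X \<and> (\<forall>y\<in>X. pmf ppi y = (\<Sum>x\<in>X. pmf ppi x * P x y))"

definition stationary :: "'a set \<Rightarrow> ('a \<Rightarrow> 'a \<Rightarrow> real) \<Rightarrow> 'a pmf" where
  "stationary X P = (THE ppi. is_stationary X P ppi)"

definition chain_dist :: "'a set \<Rightarrow> ('a \<Rightarrow> 'a \<Rightarrow> real) \<Rightarrow> nat \<Rightarrow> real" where
  "chain_dist X P t =
     Max ((\<lambda>x. tv_dist X (mat_pow X P t x) (pmf (stationary X P))) ` X)"

text \<open>The infimum is \<open>\<infinity>\<close> if the distance never drops to \<open>eps\<close>.\<close>

definition t_mix :: "'a set \<Rightarrow> ('a \<Rightarrow> 'a \<Rightarrow> real) \<Rightarrow> real \<Rightarrow> enat" where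
  "t_mix X P eps = Inf {enat t | t. chain_dist X P t \<le> eps}"

definition metropolis_off :: "nat list \<Rightarrow> nat \<Rightarrow> nat \<Rightarrow> tableau \<Rightarrow> tableau \<Rightarrow> tableau \<Rightarrow> real" where
  "metropolis_off lam N k S T F =
     P_SVG lam N k S F * min 1 (P_SVG lam N k S T / P_SVG lam N k S F)"

definition metropolis :: "nat list \<Rightarrow> nat \<Rightarrow> nat \<Rightarrow> tableau \<Rightarrow> tableau \<Rightarrow> tableau \<Rightarrow> real" where
  "metropolis lam N k S T F =
     (if F = T then 1 - (\<Sum>R\<in>SVT_ext lam N S - {T}. metropolis_off lam N k S T R)
      else metropolis_off lam N k S T F)"

text \<open>The real polynomial in three variables with coefficients \<open>a i j l\<close>, all exponents
  being at most \<open>D\<close>.\<close>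

definition poly3 :: "nat \<Rightarrow> (nat \<Rightarrow> nat \<Rightarrow> nat \<Rightarrow> real) \<Rightarrow> real \<Rightarrow> real \<Rightarrow> real \<Rightarrow> real" where
  "poly3 D a x y z = (\<Sum>i\<le>D. \<Sum>j\<le>D. \<Sum>l\<le>D. a i j l * x ^ i * y ^ j * z ^ l)"

text \<open>The integer \<open>k\<close> is determined by the triple (\<open>N - k\<close> is the number of values in \<open>S\<close>), so
  quantifying over it only names it. The state space is empty exactly when the partition is
  empty and \<open>N > 0\<close>; there is neither a chain nor a uniform distribution then, and such triples
  are skipped here and in the definition of samplers below.\<close>

definition rapidly_mixing :: "(nat list \<times> nat \<times> tableau) set \<Rightarrow> bool" where
  "rapidly_mixing Fam \<longleftrightarrow>
     (\<exists>D a. \<forall>(lam, N, S)\<in>Fam. \<forall>k. pretableau lam N k S \<longrightarrow> SVT_ext lam N S \<noteq> {} \<longrightarrow>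
        (\<forall>eps>0. \<exists>t. t_mix (SVT_ext lam N S) (metropolis lam N k S) eps = enat t \<and>
           real t \<le> poly3 D a (1 / eps) (real (card (empty_boxes lam S))) (real k)))"


section \<open>Randomized algorithms\<close>

text \<open>Randomized algorithms are while programs on a random access machine. A memory cell is
  addressed by an array name and a list of indices, and holds a natural number. Every executed
  assignment, uniform random choice or test costs one step. Arithmetic is limited to addition and
  truncated subtraction, so that in \<open>t\<close> steps the bit lengths of the numbers grow by at most
  \<open>O(t)\<close> and the unit cost of a step is reasonable. A program is a fixed syntactic object that
  does not depend on the input.\<close>

type_synonym mem = "nat \<times> nat list \<Rightarrow> nat"

datatype aexp = Num nat | Cell nat "aexp list" | Add aexp aexp | Sub aexp aexp

primrec aval :: "mem \<Rightarrow> aexp \<Rightarrow> nat" where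
  "aval m (Num n) = n"
| "aval m (Cell x es) = m (x, map (aval m) es)"
| "aval m (Add e1 e2) = aval m e1 + aval m e2"
| "aval m (Sub e1 e2) = aval m e1 - aval m e2"

text \<open>\<open>Cond\<close> and \<open>While\<close> test whether the expression is nonzero; \<open>Choose x es e\<close> stores in the
  cell \<open>x[es]\<close> a uniformly random element of \<open>{0..<n}\<close>, where \<open>n\<close> is the value of \<open>e\<close>
  (and 0 if \<open>n = 0\<close>), independently of all earlier choices.\<close>

datatype com =
    Skip
  | Assign nat "aexp list" aexp
  | Choose nat "aexp list" aexp
  | Seq com com
  | Cond aexp com com
  | While aexp com

primrec step :: "com \<Rightarrow> mem \<Rightarrow> (com \<times> mem) pmf" where
  "step Skip m = return_pmf (Skip, m)"
| "step (Assign x es e) m = return_pmf (Skip, m((x, map (aval m) es) := aval m e))"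
| "step (Choose x es e) m =
     map_pmf (\<lambda>v. (Skip, m((x, map (aval m) es) := v))) (pmf_of_set {..<max 1 (aval m e)})"
| "step (Seq c1 c2) m =
     (if c1 = Skip then return_pmf (c2, m)
      else map_pmf (\<lambda>(c, m'). (Seq c c2, m')) (step c1 m))"
| "step (Cond e c1 c2) m = return_pmf (if aval m e \<noteq> 0 then c1 else c2, m)"
| "step (While e c) m = return_pmf (if aval m e \<noteq> 0 then Seq c (While e c) else Skip, m)"

primrec run :: "nat \<Rightarrow> com \<times> mem \<Rightarrow> (com \<times> mem) pmf" where
  "run 0 s = return_pmf s"
| "run (Suc n) s = bind_pmf (step (fst s) (snd s)) (run n)"

text \<open>Layout of the input: \<open>0[0], \<dots>, 0[3]\<close> contain \<open>N\<close>, \<open>k\<close> and the numerator and denominator of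
  the bias parameter, \<open>1[r]\<close> the length of row \<open>r\<close>, \<open>2[r,c]\<close> the number of elements of \<open>S(r,c)\<close>,
  and \<open>3[r,c,i]\<close> the elements of \<open>S(r,c)\<close> in increasing order, for \<open>i = 0, 1, \<dots>\<close>. All other
  cells contain 0. The running time has to be bounded in terms of parameters which may be much
  smaller than the whole input, which is why the input can be accessed at random positions and the
  output replaces \<open>S\<close> in place.\<close>

definition input_mem :: "nat list \<Rightarrow> nat \<Rightarrow> nat \<Rightarrow> tableau \<Rightarrow> nat \<Rightarrow> nat \<Rightarrow> mem" where
  "input_mem lam N k S num den = (\<lambda>(x, ix).
     if x = 0 \<and> ix = [0] then N
     else if x = 0 \<and> ix = [1] then k
     else if x = 0 \<and> ix = [2] then num
     else if x = 0 \<and> ix = [3] then den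
     else if x = 1 \<and> length ix = 1 \<and> 1 \<le> ix ! 0 \<and> ix ! 0 \<le> length lam then lam ! (ix ! 0 - 1)
     else if x = 2 \<and> length ix = 2 then card (S (ix ! 0, ix ! 1))
     else if x = 3 \<and> length ix = 3 \<and> ix ! 2 < card (S (ix ! 0, ix ! 1))
       then sorted_list_of_set (S (ix ! 0, ix ! 1)) ! (ix ! 2)
     else 0)"

definition output_tableau :: "mem \<Rightarrow> tableau" where
  "output_tableau m = (\<lambda>(r, c). (\<lambda>i. m (3, [r, c, i])) ` {..<m (2, [r, c])})"

text \<open>The bias parameter is the rational \<open>num / den \<le> 1\<close>. The program has to halt within the time
  bound on every random outcome.\<close>

definition is_FPAUS :: "com \<Rightarrow> (nat list \<times> nat \<times> tableau) set \<Rightarrow> bool" where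
  "is_FPAUS prog Fam \<longleftrightarrow>
     (\<exists>D a. \<forall>(lam, N, S)\<in>Fam. \<forall>k. pretableau lam N k S \<longrightarrow> SVT_ext lam N S \<noteq> {} \<longrightarrow>
        (\<forall>num den. 0 < num \<and> num \<le> den \<longrightarrow>
           (\<exists>n. real n \<le> poly3 D a (real k) (real (card (empty_boxes lam S)))
                             (ln (1 / (real num / real den))) \<and>
              (let out = run n (prog, input_mem lam N k S num den);
                   Gam = map_pmf (output_tableau \<circ> snd) out
               in (\<forall>s\<in>set_pmf out. fst s = Skip) \<and>
                  set_pmf Gam \<subseteq> SVT_ext lam N S \<and>
                  tv_dist (SVT_ext lam N S) (pmf Gam) (pmf (pmf_of_set (SVT_ext lam N S)))
                    \<le> real num / real den))))"

end

theory Submission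
  imports Defs
begin

text \<open>
  The Metropolis chain is an independence sampler with \<open>P(T, F) = min (p T) (p F)\<close>, so it mixes in
  time \<open>O(1 / (|X| min p))\<close> by Doeblin's argument. The law of \<open>SVGen\<close> is explicit: a run with \<open>n\<close>
  empty boxes opens a uniformly random set of \<open>n\<close> of the \<open>k\<close> values in new boxes, the boxes form a
  uniformly random linear extension by the theorem of Greene, Nijenhuis and Wilf on the hook walk,
  and each other value costs a factor \<open>1 / w\<close>, where \<open>w\<close> is the number of minimal nonempty boxes.
  Hence \<open>1 / p \<le> (k choose n) e(\<lambda> \<setminus> S) W ^ (k - n)\<close> for the maximal width \<open>W\<close>. Conversely, shapes
  consist, up to a bounded number of boxes, of two long rows and two long columns. Shifting these arms
  by one or two boxes keeps them apart and keeps the width equal to \<open>W\<close> while they shrink, so that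
  tableaux which spend the additional values during that phase already account for a polynomial
  fraction of this weight.

  For the sampler no Markov chain is needed. There are polynomially many ideals, each given by
  boundedly many row and column lengths, so a dynamic program counts the completions exactly; one
  uniformly random number below this count is then unranked deterministically.
\<close>

section \<open>Tableaux as sequences of insertions\<close>

text \<open>The obstacle is the factor \<open>W ^ (k - n)\<close>: the number \<open>k - n\<close>
  of additional values is not bounded in terms of \<open>n\<close>, so a family of ideals with even
  one addable box fewer than \<open>W\<close> would lose a factor exponential in
  \<open>k - n\<close>. The maximum has to be attained exactly, along a whole shrinking family. An
  ideal \<open>Z\<close> that attains it may be unrelated to this family on the arms, but addable
  boxes form an antichain, so each arm carries at most one of them. It is therefore enough to copy
  \<open>Z\<close> near the origin and to guarantee one addable box on every arm. Moving row
  \<open>r\<close> to the left by \<open>r\<close> boxes does this: a box freed at the end of the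
  arm is available, and as row 2 moves further than row 1, row 1 stays strictly longer and does not
  block it; columns are treated alike. The cut \<open>L\<close> between the copied part and the arms
  is placed by the pigeonhole principle so that no arm ends just behind it. The boundedly many boxes
  outside the moved arms cost only polynomial factors.\<close>

declare split_paired_All [simp del] split_paired_Ex [simp del]

text \<open>\<open>\<le>\<close> on boxes is the componentwise order. Coordinates are natural
  numbers, so the axes have to be excluded explicitly by
  \<open>{1..} \<times> {1..}\<close>.\<close>

definition young :: "box set \<Rightarrow> bool" where
  "young E \<longleftrightarrow> finite E \<and> E \<subseteq> {1..} \<times> {1..} \<and> (\<forall>b\<in>E. \<forall>b'\<in>{1..} \<times> {1..}. b' \<le> b \<longrightarrow> b' \<in> E)"

text \<open>For an ideal \<open>E\<close> of \<open>D\<close>, \<open>maxs E\<close> consists of the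
  corners of \<open>E\<close>, and \<open>mins (D - E)\<close> of the boxes that can be added to
  it.\<close>

definition maxs :: "box set \<Rightarrow> box set" where
  "maxs A = {b \<in> A. \<forall>b'\<in>A. b \<le> b' \<longrightarrow> b' = b}"

definition mins :: "box set \<Rightarrow> box set" where
  "mins A = {b \<in> A. \<forall>b'\<in>A. b' \<le> b \<longrightarrow> b' = b}"

lemma youngD:
  assumes "young E"
  shows "finite E" and "(r, c) \<in> E \<Longrightarrow> 1 \<le> r \<and> 1 \<le> c"
    and "(r, c) \<in> E \<Longrightarrow> 1 \<le> r' \<Longrightarrow> r' \<le> r \<Longrightarrow> 1 \<le> c' \<Longrightarrow> c' \<le> c \<Longrightarrow> (r', c') \<in> E"
  using assms unfolding young_def by fastforce+

lemma young_empty [simp]: "young {}"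
  by (simp add: young_def)

lemma NW_eq_mins: "A \<subseteq> {1..} \<times> {1..} \<Longrightarrow> NW A = mins A"
  unfolding NW_def mins_def by fastforce

lemma maxs_subset: "maxs A \<subseteq> A" and mins_subset: "mins A \<subseteq> A"
  by (auto simp: maxs_def mins_def)

lemma young_remove_max:
  assumes "young E" "b \<in> maxs E"
  shows "young (E - {b})"
  using assms unfolding young_def maxs_def by (auto 0 3)

lemma young_diagram:
  assumes "is_partition lam"
  shows "young (diagram lam)"
proof -
  have "diagram lam \<subseteq> {..length lam} \<times> {..sum_list lam}"
    by (auto simp: diagram_def intro!: order_trans[OF _ member_le_sum_list])
  then have "finite (diagram lam)"
    by (rule finite_subset) simp
  moreover have "lam ! (r - 1) \<le> lam ! (r' - 1)" if "1 \<le> r'" "r' \<le> r" "r \<le> length lam" for r r'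
    using assms that sorted_wrt_nth_less[of "(\<ge>)" lam "r' - 1" "r - 1"]
    by (cases "r' = r") (auto simp: is_partition_def)
  ultimately show ?thesis
    unfolding young_def diagram_def by auto (meson order_trans)
qed

text \<open>The conditions of \<open>pretableau\<close> on adjacent boxes become conditions on all
  comparable boxes, and the threshold \<open>M\<close> is separated from the bound on the number of
  empty boxes. With \<open>M = 0\<close> and no empty box this describes full tableaux.\<close>

definition ptab :: "box set \<Rightarrow> nat \<Rightarrow> nat \<Rightarrow> tableau \<Rightarrow> bool" where
  "ptab D N M T \<longleftrightarrow>
     (\<forall>b. b \<notin> D \<longrightarrow> T b = {}) \<and> (\<forall>b. T b \<subseteq> {M<..N}) \<and> (\<forall>v\<in>{M<..N}. \<exists>!b. v \<in> T b) \<and>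
     (\<forall>b\<in>D. \<forall>b'\<in>D. b < b' \<longrightarrow> T b \<noteq> {} \<longrightarrow> T b' \<noteq> {} \<and> (\<forall>x\<in>T b. \<forall>y\<in>T b'. x < y))"

lemma ptabD:
  assumes "ptab D N M T"
  shows "b \<notin> D \<Longrightarrow> T b = {}" and "T b \<subseteq> {M<..N}" and "M < v \<Longrightarrow> v \<le> N \<Longrightarrow> \<exists>!b. v \<in> T b"
    and "b \<in> D \<Longrightarrow> b' \<in> D \<Longrightarrow> b < b' \<Longrightarrow> T b \<noteq> {} \<Longrightarrow> T b' \<noteq> {}"
    and "b \<in> D \<Longrightarrow> b' \<in> D \<Longrightarrow> b < b' \<Longrightarrow> x \<in> T b \<Longrightarrow> y \<in> T b' \<Longrightarrow> x < y"
  using assms unfolding ptab_def by (blast, blast, simp, blast, blast)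

definition empt :: "box set \<Rightarrow> tableau \<Rightarrow> box set" where
  "empt D T = {b \<in> D. T b = {}}"

definition completions :: "box set \<Rightarrow> nat \<Rightarrow> nat \<Rightarrow> tableau \<Rightarrow> tableau set" where
  "completions D N M T = {T'. ptab D N 0 T' \<and> empt D T' = {} \<and> (\<forall>b. T' b \<inter> {M<..} = T b)}"

definition add_value :: "nat \<Rightarrow> box \<Rightarrow> tableau \<Rightarrow> tableau" where
  "add_value v b T = T(b := insert v (T b))"

text \<open>The two kinds of insertion: opening a corner of the empty region \<open>E\<close>, or
  enlarging a minimal nonempty box.\<close>

definition opts :: "box set \<Rightarrow> box set \<Rightarrow> box set" where
  "opts D E = maxs E \<union> mins (D - E)"

text \<open>\<open>SVT\<close> compares selections only within one column or one row, and in a row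
  only weakly. Uniqueness of the values makes the row comparison strict, and two comparable boxes
  are linked through the box in the column of the first and the row of the second.\<close>

lemma SVT_order:
  assumes "young (diagram lam)" "T \<in> SVT lam N" "b \<in> diagram lam" "b' \<in> diagram lam" "b < b'"
    and "x \<in> T b" "y \<in> T b'"
  shows "x < y"
proof -
  let ?D = "diagram lam"
  have ne: "\<forall>b\<in>?D. T b \<noteq> {} \<and> T b \<subseteq> {1..N}"
    and uq: "\<forall>v\<in>{1..N}. \<exists>!b. b \<in> ?D \<and> v \<in> T b"
    and F: "\<forall>f :: box \<Rightarrow> nat. (\<forall>b\<in>?D. f b \<in> T b) \<longrightarrow>
        (\<forall>r r' c. (r, c) \<in> ?D \<and> (r', c) \<in> ?D \<and> r < r' \<longrightarrow> f (r, c) < f (r', c)) \<and>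
        (\<forall>r c c'. (r, c) \<in> ?D \<and> (r, c') \<in> ?D \<and> c < c' \<longrightarrow> f (r, c) \<le> f (r, c'))"
    using assms(2) unfolding SVT_def mem_Collect_eq by - (elim conjE, assumption)+
  define f where "f b1 x b2 y b = (if b = b1 then x else if b = b2 then y else SOME z. z \<in> T b)"
    for b1 b2 :: box and x y and b
  have f: "\<forall>b\<in>?D. f b1 x b2 y b \<in> T b" if "x \<in> T b1" "y \<in> T b2" for b1 b2 x y
    using that ne by (auto simp: f_def some_in_eq)
  have col: "x < y" if "(r, c) \<in> ?D" "(r', c) \<in> ?D" "r < r'" "x \<in> T (r, c)" "y \<in> T (r', c)" for r r' c x y
    using F[THEN spec, THEN mp, OF f[OF that(4,5)]] that by (auto simp: f_def split: if_splits)
  have row: "x < y" if "(r, c) \<in> ?D" "(r, c') \<in> ?D" "c < c'" "x \<in> T (r, c)" "y \<in> T (r, c')" for r c c' x y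
  proof -
    have "x \<le> y"
      using F[THEN spec, THEN mp, OF f[OF that(4,5)]] that by (auto simp: f_def split: if_splits)
    moreover have "x \<noteq> y"
    proof
      assume "x = y"
      then have "(r, c) = (r, c')"
        using uq ne that by (metis subsetD)
      then show False
        using that by simp
    qed
    ultimately show ?thesis by simp
  qed
  obtain r c r' c' where b: "b = (r, c)" "b' = (r', c')"
    by (cases b, cases b') auto
  have le: "r \<le> r'" "c \<le> c'" "r < r' \<or> c < c'"
    using assms(5) unfolding b less_le by auto
  have m: "(r', c) \<in> ?D"
    using youngD(2,3)[OF assms(1)] assms(3,4) le unfolding b by blast
  obtain z where z: "z \<in> T (r', c)"
    using ne m by blast
  show ?thesis
  proof (cases "r < r'")
    case True
    then have "x < z"
      using col assms m z unfolding b by blast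
    show ?thesis
    proof (cases "c < c'")
      case True
      then have "z < y"
        using row assms m z unfolding b by blast
      with \<open>x < z\<close> show ?thesis by simp
    next
      case False
      with le have "c' = c" by simp
      show ?thesis
        by (rule col[of r c r']) (use True assms(3,4,6,7) \<open>c' = c\<close> b in blast)+
    qed
  next
    case False
    with le have "r' = r" "c < c'" by simp_all
    show ?thesis
      by (rule row[of r c c']) (use \<open>r' = r\<close> \<open>c < c'\<close> assms(3,4,6,7) b in blast)+
  qed
qed

lemma SVT_eq:
  assumes "young (diagram lam)"
  shows "SVT lam N = {T. ptab (diagram lam) N 0 T \<and> empt (diagram lam) T = {}}"
proof (rule set_eqI, rule iffI)
  fix T
  assume T: "T \<in> SVT lam N"
  have "b < b' \<Longrightarrow> b \<in> diagram lam \<Longrightarrow> b' \<in> diagram lam \<Longrightarrow> x \<in> T b \<Longrightarrow> y \<in> T b' \<Longrightarrow> x < y" for b b' x y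
    using SVT_order[OF assms T] by blast
  moreover have "{0<..N} = {1..N}"
    by auto
  moreover have "(\<forall>b. b \<notin> diagram lam \<longrightarrow> T b = {}) \<and>
     (\<forall>b\<in>diagram lam. T b \<noteq> {} \<and> T b \<subseteq> {1..N}) \<and>
     (\<forall>v\<in>{1..N}. \<exists>!b. b \<in> diagram lam \<and> v \<in> T b)"
    using T unfolding SVT_def mem_Collect_eq by (elim conjE) (intro conjI)
  ultimately show "T \<in> {T. ptab (diagram lam) N 0 T \<and> empt (diagram lam) T = {}}"
    unfolding ptab_def empt_def by (simp, metis empty_iff empty_subsetI)
next
  fix T
  assume "T \<in> {T. ptab (diagram lam) N 0 T \<and> empt (diagram lam) T = {}}"
  then have *: "\<forall>b. b \<notin> diagram lam \<longrightarrow> T b = {}" "\<forall>b. T b \<subseteq> {1..N}" "\<forall>v\<in>{1..N}. \<exists>!b. v \<in> T b"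
    "\<And>b b' x y. b \<in> diagram lam \<Longrightarrow> b' \<in> diagram lam \<Longrightarrow> b < b' \<Longrightarrow> x \<in> T b \<Longrightarrow> y \<in> T b' \<Longrightarrow> x < y"
    "\<forall>b\<in>diagram lam. T b \<noteq> {}"
    unfolding ptab_def empt_def by (auto simp: Suc_le_eq subset_eq greaterThanAtMost_def)
  show "T \<in> SVT lam N"
    unfolding SVT_def
  proof (intro CollectI conjI allI impI)
    show "\<forall>v\<in>{1..N}. \<exists>!b. b \<in> diagram lam \<and> v \<in> T b"
      using * by (metis empty_iff)
  next
    fix f :: "box \<Rightarrow> nat" and r r' c
    assume "\<forall>b\<in>diagram lam. f b \<in> T b" "(r, c) \<in> diagram lam \<and> (r', c) \<in> diagram lam \<and> r < r'"
    then show "f (r, c) < f (r', c)"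
      by (intro *(4)[of "(r, c)" "(r', c)"]) (auto simp: less_le)
  next
    fix f :: "box \<Rightarrow> nat" and r c c'
    assume "\<forall>b\<in>diagram lam. f b \<in> T b" "(r, c) \<in> diagram lam \<and> (r, c') \<in> diagram lam \<and> c < c'"
    then show "f (r, c) \<le> f (r, c')"
      by (intro less_imp_le *(4)[of "(r, c)" "(r, c')"]) (auto simp: less_le)
  next
    show "\<forall>b\<in>diagram lam. T b \<noteq> {} \<and> T b \<subseteq> {1..N}"
      using *(2,5) by blast
  qed (use *(1) in blast)
qed

text \<open>If a value above \<open>M'\<close> stays in a box, all values of the larger boxes exceed
  it and stay as well, so the nonempty boxes remain closed upwards.\<close>

lemma ptab_restrict:
  assumes "ptab D N M T" "M \<le> M'"
  shows "ptab D N M' (\<lambda>b. T b \<inter> {M'<..})"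
proof -
  have "\<exists>!b. v \<in> T b \<inter> {M'<..}" if "v \<in> {M'<..N}" for v
    using assms that unfolding ptab_def by auto
  moreover have "T b' \<inter> {M'<..} \<noteq> {} \<and> (\<forall>x\<in>T b \<inter> {M'<..}. \<forall>y\<in>T b' \<inter> {M'<..}. x < y)"
    if "b \<in> D" "b' \<in> D" "b < b'" "T b \<inter> {M'<..} \<noteq> {}" for b b'
  proof -
    from that(4) obtain x where x: "x \<in> T b" "x > M'" by auto
    have **: "T b' \<noteq> {}" "\<forall>x\<in>T b. \<forall>y\<in>T b'. x < y"
      using assms(1) that x unfolding ptab_def by blast+
    then obtain y where "y \<in> T b'" by blast
    with ** x have "y \<in> T b' \<inter> {M'<..}" by fastforce
    then show ?thesis using ** by blast
  qed
  moreover have "T b \<inter> {M'<..} \<subseteq> {M'<..N}" for b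
  proof -
    have "T b \<subseteq> {M<..N}"
      using ptabD(2)[OF assms(1)] .
    then show ?thesis by auto
  qed
  moreover have "T b \<inter> {M'<..} = {}" if "b \<notin> D" for b
    using ptabD(1)[OF assms(1) that] by simp
  ultimately show ?thesis
    unfolding ptab_def by (intro conjI allI ballI impI) simp_all
qed

lemma empt_add_value: "empt D (add_value v b T) = empt D T - {b}"
  by (auto simp: empt_def add_value_def)

lemma young_empt:
  assumes "young D" "ptab D N M T"
  shows "young (empt D T)"
  unfolding young_def
proof (intro conjI ballI impI)
  fix b b' :: box
  assume b: "b \<in> empt D T" "b' \<in> {1..} \<times> {1..}" "b' \<le> b"
  then have D: "b' \<in> D" "b \<in> D"
    using assms(1) by (auto simp: empt_def young_def)
  show "b' \<in> empt D T"
  proof (rule ccontr)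
    assume "b' \<notin> empt D T"
    then have "T b' \<noteq> {}" "b' < b" using b D by (auto simp: empt_def less_le)
    then have "T b \<noteq> {}"
      using assms(2) D unfolding ptab_def by blast
    then show False using b by (simp add: empt_def)
  qed
qed (use assms in \<open>auto simp: young_def empt_def\<close>)

text \<open>\<open>Suc M\<close> is below every value present. It may therefore enter
  \<open>b\<close> exactly if no smaller box is occupied and every larger box is. For an empty
  \<open>b\<close> this says that it is a corner of the empty region, for a nonempty one that it is
  minimal.\<close>

lemma ptab_add_value_iff:
  assumes T: "ptab D N (Suc M) T" and "b \<in> D" "Suc M \<le> N"
  shows "ptab D N M (add_value (Suc M) b T) \<longleftrightarrow> b \<in> opts D (empt D T)"
proof
  let ?T = "add_value (Suc M) b T"
  have gt: "x > Suc M" if "x \<in> T b'" for x b'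
    using T that unfolding ptab_def by fastforce
  {
    assume L: "ptab D N M ?T"
    have ord: "?T b1 \<noteq> {} \<Longrightarrow> b1 < b2 \<Longrightarrow> b1 \<in> D \<Longrightarrow> b2 \<in> D \<Longrightarrow> ?T b2 \<noteq> {} \<and> (\<forall>x\<in>?T b1. \<forall>y\<in>?T b2. x < y)" for b1 b2
      using L unfolding ptab_def by blast
    show "b \<in> opts D (empt D T)"
    proof (cases "T b = {}")
      case True
      have "b' = b" if "b' \<in> empt D T" "b \<le> b'" for b'
        using ord[of b b'] that assms(2) by (auto simp: add_value_def empt_def less_le split: if_splits)
      then show ?thesis
        using True assms(2) by (auto simp: opts_def maxs_def empt_def)
    next
      case False
      have "b' = b" if b': "b' \<in> D" "T b' \<noteq> {}" "b' \<le> b" for b'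
      proof (rule ccontr)
        assume ne: "b' \<noteq> b"
        then have "b' < b" using b' by auto
        then have "\<forall>x\<in>?T b'. \<forall>y\<in>?T b. x < y"
          using ord[of b' b] b' ne assms(2) by (simp add: add_value_def)
        then obtain x where "x \<in> T b'" "x < Suc M"
          using b'(2) ne by (auto simp: add_value_def)
        then show False using gt by fastforce
      qed
      then show ?thesis
        using False assms(2) by (auto simp: opts_def mins_def empt_def)
    qed
  }
  assume R: "b \<in> opts D (empt D T)"
  have ord: "b1 \<in> D \<Longrightarrow> b2 \<in> D \<Longrightarrow> b1 < b2 \<Longrightarrow> T b1 \<noteq> {} \<Longrightarrow> T b2 \<noteq> {} \<and> (\<forall>x\<in>T b1. \<forall>y\<in>T b2. x < y)" for b1 b2
    using T unfolding ptab_def by blast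
  have "?T b2 \<noteq> {} \<and> (\<forall>x\<in>?T b1. \<forall>y\<in>?T b2. x < y)" if D: "b1 \<in> D" "b2 \<in> D" "b1 < b2" "?T b1 \<noteq> {}" for b1 b2
  proof -
    consider "b1 = b" "b2 \<noteq> b" | "b1 \<noteq> b" "b2 = b" | "b1 \<noteq> b" "b2 \<noteq> b"
      using D by auto
    then show ?thesis
    proof cases
      case 1
      have "T b2 \<noteq> {}"
      proof (cases "T b = {}")
        case True
        then have "b \<in> maxs (empt D T)"
          using R by (auto simp: opts_def mins_def empt_def)
        then show ?thesis
          using 1 D by (auto simp: maxs_def empt_def less_le)
      next
        case False
        then show ?thesis using ord[of b b2] 1 D by blast
      qed
      moreover have "x < y" if "x \<in> ?T b" "y \<in> T b2" for x y
      proof (cases "x = Suc M")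
        case True
        then show ?thesis using gt[OF that(2)] by simp
      next
        case False
        then have "x \<in> T b" using that(1) by (simp add: add_value_def)
        then show ?thesis using ptabD(5)[OF T _ _ _ _ that(2)] 1 D by blast
      qed
      ultimately show ?thesis
        using 1 by (simp add: add_value_def)
    next
      case 2
      have "T b1 \<noteq> {}" using 2 D by (simp add: add_value_def)
      then have "T b \<noteq> {}" using ord 2 D by blast
      then have "b \<in> mins (D - empt D T)"
        using R by (auto simp: opts_def maxs_def empt_def)
      moreover have "b1 \<in> D - empt D T" using \<open>T b1 \<noteq> {}\<close> D by (simp add: empt_def)
      ultimately have False using 2 D by (auto simp: mins_def less_le)
      then show ?thesis ..
    next
      case 3
      then have "?T b1 = T b1" "?T b2 = T b2" by (simp_all add: add_value_def)
      then show ?thesis using ord[OF D(1-3)] D(4) by simp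
    qed
  qed
  moreover have "\<exists>!b'. v \<in> ?T b'" if "v \<in> {M<..N}" for v
  proof (cases "v = Suc M")
    case True
    then have "v \<in> ?T b' \<longleftrightarrow> b' = b" for b'
      using gt[of v b'] by (auto simp: add_value_def)
    then show ?thesis by simp
  next
    case False
    then have "\<exists>!b'. v \<in> T b'" using T that unfolding ptab_def by auto
    moreover have "v \<in> ?T b' \<longleftrightarrow> v \<in> T b'" for b'
      using False by (auto simp: add_value_def)
    ultimately show ?thesis by simp
  qed
  moreover have "?T b' \<subseteq> {M<..N}" for b'
    using ptabD(2)[OF T, of b'] assms(3) by (auto simp: add_value_def)
  moreover have "?T b' = {}" if "b' \<notin> D" for b'
    using ptabD(1)[OF T that] assms(2) that by (auto simp: add_value_def)
  ultimately show "ptab D N M ?T"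
    unfolding ptab_def by (intro conjI allI ballI impI) (assumption | blast)+
qed

text \<open>A completion determines the next insertion: \<open>b\<close> is the box that contains
  \<open>Suc M\<close>.\<close>

lemma completions_Suc:
  assumes T: "ptab D N (Suc M) T" "Suc M \<le> N"
  shows "completions D N (Suc M) T = (\<Union>b\<in>opts D (empt D T). completions D N M (add_value (Suc M) b T))"
proof (rule set_eqI, rule iffI)
  fix T'
  assume "T' \<in> completions D N (Suc M) T"
  then have T': "ptab D N 0 T'" "empt D T' = {}" and eq': "\<And>b. T' b \<inter> {Suc M<..} = T b"
    unfolding completions_def by blast+

  from T'(1) assms(2) obtain b where b: "Suc M \<in> T' b" "\<forall>b'. Suc M \<in> T' b' \<longrightarrow> b' = b"
    unfolding ptab_def by (metis greaterThanAtMost_iff zero_less_Suc)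
  have bD: "b \<in> D"
    using T'(1) b unfolding ptab_def by blast
  have eq: "(\<lambda>b. T' b \<inter> {M<..}) = add_value (Suc M) b T"
  proof
    fix b'
    show "T' b' \<inter> {M<..} = add_value (Suc M) b T b'"
    proof (cases "b' = b")
      case True
      have "T' b \<inter> {M<..} = insert (Suc M) (T' b \<inter> {Suc M<..})"
        using b(1) by auto
      then show ?thesis
        by (simp add: True add_value_def eq')
    next
      case False
      then have "x \<noteq> Suc M" if "x \<in> T' b'" for x
        using b(2) that by blast
      then have "T' b' \<inter> {M<..} = T' b' \<inter> {Suc M<..}"
        by (auto intro: Suc_lessI)
      then show ?thesis
        by (simp add: False add_value_def eq')
    qed
  qed
  have "ptab D N M (add_value (Suc M) b T)"
    using ptab_restrict[OF T'(1), of M] by (simp add: eq)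
  then have "b \<in> opts D (empt D T)"
    using ptab_add_value_iff[OF T(1) bD T(2)] by blast
  moreover have "T' \<in> completions D N M (add_value (Suc M) b T)"
    using T' fun_cong[OF eq] by (simp add: completions_def)
  ultimately show "T' \<in> (\<Union>b\<in>opts D (empt D T). completions D N M (add_value (Suc M) b T))"
    by blast
next
  fix T'
  assume "T' \<in> (\<Union>b\<in>opts D (empt D T). completions D N M (add_value (Suc M) b T))"
  then obtain b where "ptab D N 0 T'" "empt D T' = {}" and eq: "\<And>b'. T' b' \<inter> {M<..} = add_value (Suc M) b T b'"
    unfolding completions_def by blast
  moreover have "T' b' \<inter> {Suc M<..} = T b'" for b'
  proof -
    have "T' b' \<inter> {Suc M<..} = (T' b' \<inter> {M<..}) \<inter> {Suc M<..}"
      by auto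
    also have "\<dots> = add_value (Suc M) b T b' \<inter> {Suc M<..}"
      by (simp only: eq)
    also have "\<dots> = T b' \<inter> {Suc M<..}"
      by (auto simp: add_value_def)
    also have "\<dots> = T b'"
      using ptabD(2)[OF T(1), of b'] by auto
    finally show ?thesis .
  qed
  ultimately show "T' \<in> completions D N (Suc M) T"
    by (simp add: completions_def)
qed

lemma completions_0:
  assumes "ptab D N 0 T"
  shows "completions D N 0 T = (if empt D T = {} then {T} else {})"
proof -
  have "T' \<in> completions D N 0 T \<Longrightarrow> T' = T" for T'
  proof
    fix b
    assume "T' \<in> completions D N 0 T"
    then have "T' b \<inter> {0<..} = T b" "ptab D N 0 T'"
      unfolding completions_def by blast+
    then show "T' b = T b"
      using ptabD(2)[of D N 0 T' b] by (metis Int_absorb2 greaterThanAtMost_def le_inf_iff)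
  qed
  moreover have "empt D T = {} \<Longrightarrow> T \<in> completions D N 0 T"
  proof -
    have "T b \<inter> {0<..} = T b" for b
      using ptabD(2)[OF assms, of b] by (metis Int_absorb2 greaterThanAtMost_def le_inf_iff)
    then show "empt D T = {} \<Longrightarrow> T \<in> completions D N 0 T"
      using assms unfolding completions_def by blast
  qed
  moreover have "empt D T \<noteq> {} \<Longrightarrow> T \<notin> completions D N 0 T"
    unfolding completions_def by blast
  ultimately show ?thesis
    by auto
qed

text \<open>If \<open>b\<close> lies in \<open>mins (D - E)\<close>, then \<open>E - {b}\<close> is
  \<open>E\<close>, so one summand covers both kinds of insertion.\<close>

primrec cnt :: "box set \<Rightarrow> nat \<Rightarrow> box set \<Rightarrow> nat" where
  "cnt D 0 E = (if E = {} then 1 else 0)"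
| "cnt D (Suc M) E = (\<Sum>b\<in>opts D E. cnt D M (E - {b}))"

lemma opts_subset: "E \<subseteq> D \<Longrightarrow> opts D E \<subseteq> D"
  using maxs_subset mins_subset unfolding opts_def by fast

lemma completions_disjoint:
  assumes "T' \<in> completions D N M (add_value (Suc M) b T)" "T' \<in> completions D N M (add_value (Suc M) b' T)"
    and "\<And>b. Suc M \<notin> T b"
  shows "b = b'"
proof (rule ccontr)
  assume "b \<noteq> b'"
  moreover have "T' b \<inter> {M<..} = add_value (Suc M) b T b" "T' b \<inter> {M<..} = add_value (Suc M) b' T b"
    using assms unfolding completions_def by auto
  ultimately show False
    using assms(3)[of b] by (auto simp: add_value_def)
qed

lemma empt_subset: "empt D T \<subseteq> D"
  by (auto simp: empt_def)

text \<open>The possible insertions depend on a tableau only through its empty region, hence so does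
  the number of completions.\<close>

lemma card_completions:
  assumes "finite D" "ptab D N M T" "M \<le> N"
  shows "finite (completions D N M T) \<and> card (completions D N M T) = cnt D M (empt D T)"
  using assms(2,3)
proof (induction M arbitrary: T)
  case 0
  then show ?case by (simp add: completions_0)
next
  case (Suc M)
  let ?O = "opts D (empt D T)"
  have fin: "finite ?O"
    using opts_subset[OF empt_subset] assms(1) finite_subset by blast
  have *: "finite (completions D N M (add_value (Suc M) b T)) \<and>
      card (completions D N M (add_value (Suc M) b T)) = cnt D M (empt D T - {b})" if "b \<in> ?O" for b
  proof -
    have "ptab D N M (add_value (Suc M) b T)"
      using ptab_add_value_iff[OF Suc.prems(1)] Suc.prems(2) that opts_subset[OF empt_subset] by blast
    then show ?thesis
      using Suc.IH Suc.prems(2) by (simp add: empt_add_value)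
  qed
  have "Suc M \<notin> T b" for b
    using ptabD(2)[OF Suc.prems(1), of b] by auto
  then have "card (completions D N (Suc M) T) = (\<Sum>b\<in>?O. card (completions D N M (add_value (Suc M) b T)))"
    unfolding completions_Suc[OF Suc.prems] using * fin completions_disjoint
    by (intro card_UN_disjoint) blast+
  also have "\<dots> = cnt D (Suc M) (empt D T)"
    using * by simp
  finally show ?case
    using * fin by (simp add: completions_Suc[OF Suc.prems])
qed

text \<open>\<open>S\<close> already places all values above \<open>k\<close>, and no value occurs
  twice, so \<open>S b \<subseteq> T b\<close> for all boxes forces the part of \<open>T\<close>
  above \<open>k\<close> to be exactly \<open>S\<close>.\<close>

lemma SVT_ext_eq:
  assumes "young (diagram lam)" "pretableau lam N k S"
  shows "SVT_ext lam N S = completions (diagram lam) N k S"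
proof (rule set_eqI, rule iffI)
  fix T
  let ?D = "diagram lam"
  have S: "\<forall>b. b \<notin> ?D \<longrightarrow> S b = {}" "\<forall>b\<in>?D. S b \<subseteq> {k+1..N}" "\<forall>v\<in>{k+1..N}. \<exists>!b. b \<in> ?D \<and> v \<in> S b"
    using assms(2) unfolding pretableau_def by - (elim conjE, assumption)+
  {
    assume "T \<in> SVT_ext lam N S"
    then have T: "ptab ?D N 0 T" "empt ?D T = {}" "\<forall>b\<in>?D. S b \<subseteq> T b"
      by (auto simp: SVT_ext_def SVT_eq[OF assms(1)])
    have "T b \<inter> {k<..} = S b" for b
    proof
      show "S b \<subseteq> T b \<inter> {k<..}" 
        using S T by (cases "b \<in> ?D") (auto simp: subset_eq Suc_le_eq)
      show "T b \<inter> {k<..} \<subseteq> S b"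
      proof
        fix v
        assume v: "v \<in> T b \<inter> {k<..}"
        then have "v \<in> {k+1..N}" "v \<in> {0<..N}"
          using T unfolding ptab_def by fastforce+
        then obtain b' where "b' \<in> ?D" "v \<in> S b'"
          using S by blast
        then have "v \<in> T b'" using T by blast
        then have "b' = b"
          using v T(1) \<open>v \<in> {0<..N}\<close> unfolding ptab_def by blast
        with \<open>v \<in> S b'\<close> show "v \<in> S b" by simp
      qed
    qed
    then show "T \<in> completions ?D N k S"
      using T by (simp add: completions_def)
  }
  assume "T \<in> completions ?D N k S"
  then show "T \<in> SVT_ext lam N S"
    by (auto simp: SVT_ext_def SVT_eq[OF assms(1)] completions_def)
qed

text \<open>A nonempty state space yields the order conditions for \<open>S\<close> on all
  comparable boxes, by restricting any of its members.\<close>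

lemma ptab_of_completions: "T' \<in> completions D N k S \<Longrightarrow> ptab D N k S"
  using ptab_restrict[of D N 0 T' k] by (simp add: completions_def)

lemma empty_boxes_eq: "empty_boxes lam S = empt (diagram lam) S"
  by (simp add: empty_boxes_def empt_def)

lemma cnt_eq_0:
  assumes "finite E" "M < card E"
  shows "cnt D M E = 0"
  using assms
proof (induction M arbitrary: E)
  case (Suc M)
  have "cnt D M (E - {b}) = 0" for b
    using Suc.prems card_Diff_singleton_if[of E b]
    by (intro Suc.IH) (auto split: if_splits)
  then show ?case by simp
qed auto

lemma card_empt_le:
  assumes "finite D" "T' \<in> completions D N M T" "M \<le> N"
  shows "card (empt D T) \<le> M"
proof (rule ccontr)
  assume "\<not> ?thesis"
  then have "cnt D M (empt D T) = 0"
    using assms(1) by (intro cnt_eq_0) (auto simp: empt_def)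
  then have "completions D N M T = {}"
    using card_completions[OF assms(1) ptab_of_completions[OF assms(2)] assms(3)] by auto
  then show False using assms(2) by simp
qed

section \<open>Counting linear extensions\<close>

text \<open>The first argument counts removal steps and makes the recursion primitive. For
  \<open>n = card P\<close> the removal orders are the linear extensions of
  \<open>P\<close>.\<close>

primrec linext :: "nat \<Rightarrow> box set \<Rightarrow> nat" where
  "linext 0 P = 1"
| "linext (Suc n) P = (\<Sum>b\<in>maxs P. linext n (P - {b}))"

abbreviation linexts :: "box set \<Rightarrow> nat" where
  "linexts P \<equiv> linext (card P) P"

lemma finite_maxs: "finite P \<Longrightarrow> finite (maxs P)"
  using maxs_subset finite_subset by blast

lemma linexts_rec:
  assumes "finite P" "P \<noteq> {}"
  shows "linexts P = (\<Sum>b\<in>maxs P. linexts (P - {b}))"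
proof -
  obtain n where n: "card P = Suc n"
    using assms by (metis card_eq_0_iff not0_implies_Suc)
  moreover have "card (P - {b}) = n" if "b \<in> maxs P" for b
    using that n assms maxs_subset by (simp add: card_Diff_singleton subset_iff)
  ultimately show ?thesis
    by simp
qed

lemma maxs_nonempty:
  assumes "finite P" "P \<noteq> {}"
  shows "maxs P \<noteq> {}"
  using finite_has_maximal[OF assms] unfolding maxs_def by fast

lemma linexts_pos:
  assumes "finite P"
  shows "linexts P > 0"
  using assms
proof (induction "card P" arbitrary: P)
  case (Suc n)
  then have "P \<noteq> {}" by auto
  then obtain b where b: "b \<in> maxs P" using maxs_nonempty Suc by blast
  then have "linexts (P - {b}) > 0"
    using Suc b maxs_subset[of P] by (intro Suc(1)) (auto simp: card_Diff_singleton subset_iff)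
  then have "0 < (\<Sum>b\<in>maxs P. linexts (P - {b}))"
    using b finite_maxs[OF Suc(3)] by (intro sum_pos2[of _ b]) auto
  then show ?case
    using linexts_rec[OF Suc(3) \<open>P \<noteq> {}\<close>] by simp
qed simp

lemma maxs_remove: "y \<in> maxs P \<Longrightarrow> y \<noteq> x \<Longrightarrow> y \<in> maxs (P - {x})"
  by (auto simp: maxs_def)

text \<open>Deleting one element: a linear extension is determined by its restriction and the position of
  the deleted element.\<close>

lemma linexts_remove_le:
  assumes "finite P" "x \<in> P"
  shows "linexts P \<le> card P * linexts (P - {x})"
  using assms
proof (induction "card P" arbitrary: P)
  case (Suc n)
  let ?Y = "maxs P - {x}"
  have ne: "P \<noteq> {}" and fin: "finite (maxs P)" and n: "card (P - {x}) = n"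
    using Suc finite_maxs by (auto simp: card_Diff_singleton)
  have "linexts (P - {y}) \<le> n * linexts (P - {x} - {y})" if "y \<in> ?Y" for y
  proof -
    have "y \<in> P" using that maxs_subset by blast
    then have "card (P - {y}) = n"
      using Suc by (simp add: card_Diff_singleton)
    then have "linexts (P - {y}) \<le> card (P - {y}) * linexts (P - {y} - {x})"
      using Suc(1)[of "P - {y}"] Suc(3,4) that by auto
    then show ?thesis
      using \<open>card (P - {y}) = n\<close> by (simp add: Diff_insert2[symmetric] insert_commute)
  qed
  then have "(\<Sum>y\<in>?Y. linexts (P - {y})) \<le> (\<Sum>y\<in>?Y. n * linexts (P - {x} - {y}))"
    by (rule sum_mono)
  also have "\<dots> \<le> (\<Sum>y\<in>maxs (P - {x}). n * linexts (P - {x} - {y}))"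
    using Suc(3) maxs_remove[of _ P x] by (intro sum_mono2 finite_maxs) blast+
  also have "\<dots> \<le> n * linexts (P - {x})"
  proof (cases "P - {x} = {}")
    case False
    then show ?thesis
      using linexts_rec[of "P - {x}"] Suc(3) by (simp add: sum_distrib_left)
  next
    case True
    then have "maxs (P - {x}) = {}"
      using maxs_subset by blast
    then show ?thesis by simp
  qed
  finally have "(\<Sum>y\<in>?Y. linexts (P - {y})) \<le> n * linexts (P - {x})" .
  moreover have "linexts P = (\<Sum>y\<in>maxs P. linexts (P - {y}))"
    by (rule linexts_rec) (use Suc ne in auto)
  moreover have "\<dots> \<le> linexts (P - {x}) + (\<Sum>y\<in>?Y. linexts (P - {y}))"
    using fin by (cases "x \<in> maxs P") (simp_all add: sum.remove)
  ultimately show ?case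
    unfolding Suc(2)[symmetric] by simp
qed auto

text \<open>Iterated removal of one element. If boundedly many elements are deleted, the loss is
  polynomial in \<open>card P\<close>.\<close>

lemma linexts_subset_le:
  assumes "finite P" "Q \<subseteq> P"
  shows "linexts P \<le> card P ^ (card P - card Q) * linexts Q"
  using assms
proof (induction "card P - card Q" arbitrary: P)
  case 0
  then have "P = Q"
    using card_seteq[of P Q] by simp
  then show ?case by simp
next
  case (Suc d)
  then obtain x where x: "x \<in> P" "x \<notin> Q"
    by (metis Diff_eq_empty_iff card_mono diff_is_0_eq' nat.simps(3) finite_subset subsetI)
  have c: "card (P - {x}) = card P - 1" "card P > 0"
    using x Suc by (auto simp: card_Diff_singleton card_gt_0_iff)
  have "linexts P \<le> card P * linexts (P - {x})"
    using linexts_remove_le x Suc by blast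
  also have "linexts (P - {x}) \<le> card (P - {x}) ^ (card (P - {x}) - card Q) * linexts Q"
    using Suc x c by (intro Suc(1)) auto
  also have "card (P - {x}) ^ (card (P - {x}) - card Q) \<le> card P ^ d"
  proof -
    have "card (P - {x}) - card Q = d" using Suc(2) c by simp
    then show ?thesis using c by (simp add: power_mono)
  qed
  finally show ?case
    unfolding Suc(2)[symmetric] by (simp add: mult.assoc)
qed

section \<open>The hook walk\<close>

definition arm :: "box set \<Rightarrow> nat \<Rightarrow> nat \<Rightarrow> nat" where
  "arm E i j = card {q. (i, q) \<in> E \<and> j < q}"

definition leg :: "box set \<Rightarrow> nat \<Rightarrow> nat \<Rightarrow> nat" where
  "leg E i j = card {p. (p, j) \<in> E \<and> i < p}"

lemma hook_eq: "hook E (i, j) = Pair i ` {q. (i, q) \<in> E \<and> j < q} \<union> (\<lambda>p. (p, j)) ` {p. (p, j) \<in> E \<and> i < p}"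
  by (auto simp: hook_def)

lemma finite_row: "finite E \<Longrightarrow> finite {q. (i, q) \<in> E \<and> Q q}"
  by (rule finite_subset[of _ "snd ` E"]) force+

lemma finite_col: "finite E \<Longrightarrow> finite {p. (p, j) \<in> E \<and> Q p}"
  by (rule finite_subset[of _ "fst ` E"]) force+

lemma sum_hook:
  assumes "finite E"
  shows "sum g (hook E (i, j)) = (\<Sum>q | (i, q) \<in> E \<and> j < q. g (i, q)) + (\<Sum>p | (p, j) \<in> E \<and> i < p. g (p, j))"
proof -
  have "sum g (hook E (i, j)) =
      sum g (Pair i ` {q. (i, q) \<in> E \<and> j < q}) + sum g ((\<lambda>p. (p, j)) ` {p. (p, j) \<in> E \<and> i < p})"
    unfolding hook_eq using assms by (intro sum.union_disjoint) (auto simp: finite_row finite_col)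
  then show ?thesis
    by (simp add: sum.reindex inj_on_def)
qed

lemma card_hook: "finite E \<Longrightarrow> card (hook E (i, j)) = arm E i j + leg E i j"
  using sum_hook[of E "\<lambda>_. 1::nat" i j] by (simp add: arm_def leg_def)

lemma arm_split:
  assumes "young E" "(i, b) \<in> E" "0 < j" "j \<le> b"
  shows "arm E i j = (b - j) + arm E i b"
proof -
  have "{q. (i, q) \<in> E \<and> j < q} = {j<..b} \<union> {q. (i, q) \<in> E \<and> b < q}"
    using assms youngD(2)[OF assms(1,2)] by (auto intro: youngD(3)[OF assms(1,2)])
  then show ?thesis
    unfolding arm_def using assms(1,4) by (simp add: young_def finite_row card_Un_disjoint disjoint_iff)
qed

lemma leg_split:
  assumes "young E" "(a, j) \<in> E" "0 < i" "i \<le> a"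
  shows "leg E i j = (a - i) + leg E a j"
proof -
  have "{p. (p, j) \<in> E \<and> i < p} = {i<..a} \<union> {p. (p, j) \<in> E \<and> a < p}"
    using assms youngD(2)[OF assms(1,2)] by (auto intro: youngD(3)[OF assms(1,2)])
  then show ?thesis
    unfolding leg_def using assms(1,4) by (simp add: young_def finite_col card_Un_disjoint disjoint_iff)
qed

lemma hook_corner: "(a, b) \<in> maxs E \<Longrightarrow> hook E (a, b) = {}"
  unfolding maxs_def hook_def by fastforce

text \<open>The arm of \<open>(i, j)\<close> splits at column \<open>b\<close> and its leg at row
  \<open>a\<close>. The pieces \<open>b - j\<close> and \<open>a - i\<close> are the arm of
  \<open>(a, j)\<close> and the leg of \<open>(i, b)\<close>, because the corner has neither arm nor
  leg.\<close>

lemma card_hook_corner: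
  assumes "young E" "(a, b) \<in> maxs E" "0 < i" "i \<le> a" "0 < j" "j \<le> b"
  shows "card (hook E (i, j)) = card (hook E (i, b)) + card (hook E (a, j))"
proof -
  have ab: "(a, b) \<in> E" using assms(2) maxs_subset by blast
  have fin: "finite E" using assms(1) by (simp add: young_def)
  have "arm E a b = 0" "leg E a b = 0"
    using hook_corner[OF assms(2)] card_hook[OF fin, of a b] by simp_all
  moreover have "(i, b) \<in> E" "(a, j) \<in> E"
    using youngD(3)[OF assms(1) ab] assms(3-) by auto
  ultimately show ?thesis
    using assms arm_split[of E i b j] leg_split[of E a j i] arm_split[of E a b j] leg_split[of E a b i]
      ab by (simp add: card_hook[OF fin])
qed

text \<open>The closed form of the solution of \<open>f i * w i = (\<Sum>p\<in>{i<..a}. w p)\<close>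
  for \<open>i < a\<close>, normalised by \<open>w a = 1\<close>.\<close>

definition gnw_weight :: "(nat \<Rightarrow> real) \<Rightarrow> nat \<Rightarrow> nat \<Rightarrow> real" where
  "gnw_weight f a i = (if i = a then 1 else (\<Prod>l\<in>{i<..<a}. 1 + 1 / f l) / f i)"

text \<open>Passing from \<open>Suc n\<close> to \<open>n\<close> adds the term at
  \<open>Suc n\<close>, which is the old sum divided by \<open>f (Suc n)\<close>.\<close>

lemma gnw_weight_sum:
  assumes "i < a"
  shows "(\<Sum>p\<in>{i<..a}. gnw_weight f a p) = (\<Prod>l\<in>{i<..<a}. 1 + 1 / f l)"
proof -
  have "i \<le> a - 1" using assms by simp
  then show ?thesis
  proof (induction rule: inc_induct)
    case base
    have "{a - 1<..a} = {a}" "{a - 1<..<a} = {}"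
      using assms by auto
    then show ?case by (simp add: gnw_weight_def)
  next
    case (step n)
    have "{n<..a} = insert (Suc n) {Suc n<..a}" "{n<..<a} = insert (Suc n) {Suc n<..<a}"
      using step by auto
    then show ?case
      using step by (simp add: gnw_weight_def field_simps)
  qed
qed

lemma gnw_weight_harmonic:
  assumes "i \<le> a" "f a = 0" "i < a \<Longrightarrow> f i \<noteq> 0"
  shows "f i * gnw_weight f a i = (\<Sum>p\<in>{i<..a}. gnw_weight f a p)"
  using assms gnw_weight_sum[of i a f] by (cases "i = a") (auto simp: gnw_weight_def)

text \<open>Greene, Nijenhuis and Wilf: the probability that the walk ends in the corner \<open>(a, b)\<close> is a
  product of a function of the starting row and a function of the starting column. Both factors are
  harmonic up to the hook lengths in column \<open>b\<close> and row \<open>a\<close>, and these hook lengths add up.\<close>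

lemma pmf_hook_walk:
  assumes E: "young E" "(a, b) \<in> maxs E" and "(i, j) \<in> E"
  shows "pmf (hook_walk E (i, j)) (a, b) =
    (if i \<le> a \<and> j \<le> b
     then gnw_weight (\<lambda>i. card (hook E (i, b))) a i * gnw_weight (\<lambda>j. card (hook E (a, j))) b j else 0)"
proof -
  define R where "R = gnw_weight (\<lambda>i. card (hook E (i, b))) a"
  define C where "C = gnw_weight (\<lambda>j. card (hook E (a, j))) b"
  define g where "g = (\<lambda>(i, j). if i \<le> a \<and> j \<le> b then R i * C j else 0)"
  have fin: "finite E" using E by (simp add: young_def)
  have ab: "(a, b) \<in> E" using E(2) maxs_subset by blast
  have fin_hook: "finite (hook E x)" for x
    by (rule finite_subset[OF _ fin]) (auto simp: hook_def)
  have "x \<in> E \<Longrightarrow> pmf (hook_walk E x) (a, b) = g x" for x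
    using fin
  proof (induction "card {y \<in> E. x \<le> y}" arbitrary: x rule: less_induct)
    case (less x)
    obtain i j where x: "x = (i, j)" by fastforce
    have pos: "0 < i" "0 < j" using youngD(2)[OF E(1)] less.prems(1) x by fastforce+
    have IH: "pmf (hook_walk E y) (a, b) = g y" if "y \<in> hook E x" for y
    proof (rule less.hyps)
      have "x \<notin> {z \<in> E. y \<le> z}" "x \<in> {z \<in> E. x \<le> z}" "{z \<in> E. y \<le> z} \<subseteq> {z \<in> E. x \<le> z}"
        using that less.prems(1) by (auto simp: hook_def less_eq_prod_def)
      then show "card {z \<in> E. y \<le> z} < card {z \<in> E. x \<le> z}"
        using fin by (intro psubset_card_mono) auto
    qed (use that fin in \<open>auto simp: hook_def\<close>)
    show ?case
    proof (cases "hook E x = {}")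
      case True
      then have *: "pmf (hook_walk E x) (a, b) = (if x = (a, b) then 1 else 0)"
        by (subst hook_walk.simps) simp
      have "x = (a, b)" if "i \<le> a" "j \<le> b"
      proof (rule ccontr)
        assume "x \<noteq> (a, b)"
        then have "(i, b) \<in> hook E x \<or> (a, j) \<in> hook E x"
          using that pos youngD(3)[OF E(1) ab] youngD(2)[OF E(1) ab] by (auto simp: x hook_def)
        then show False using True by simp
      qed
      then show ?thesis
        unfolding * by (auto simp: g_def x R_def C_def gnw_weight_def)
    next
      case False
      have "pmf (hook_walk E x) (a, b) = (\<Sum>y\<in>hook E x. pmf (hook_walk E y) (a, b)) / card (hook E x)"
        by (subst hook_walk.simps) (simp add: False fin fin_hook pmf_bind_pmf_of_set)
      also have "(\<Sum>y\<in>hook E x. pmf (hook_walk E y) (a, b)) = sum g (hook E x)"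
        using IH by simp
      also have "sum g (hook E x) = card (hook E x) * g x"
      proof (cases "i \<le> a \<and> j \<le> b")
        case True
        have row: "{j<..b} \<subseteq> {q. (i, q) \<in> E \<and> j < q}" and col: "{i<..a} \<subseteq> {p. (p, j) \<in> E \<and> i < p}"
          using True pos youngD(3)[OF E(1) ab] by auto
        have "(\<Sum>q | (i, q) \<in> E \<and> j < q. g (i, q)) = (\<Sum>q\<in>{j<..b}. R i * C q)"
          using row True by (intro sum.mono_neutral_cong_right finite_row fin) (auto simp: g_def)
        also have "\<dots> = R i * (card (hook E (a, j)) * C j)"
          unfolding sum_distrib_left[symmetric] C_def
        proof (subst gnw_weight_harmonic)
          show "j < b \<Longrightarrow> real (card (hook E (a, j))) \<noteq> 0"
            using ab fin_hook[of "(a, j)"] by (auto simp: card_eq_0_iff hook_def)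
        qed (use True hook_corner[OF E(2)] in auto)
        finally have 1: "(\<Sum>q | (i, q) \<in> E \<and> j < q. g (i, q)) = R i * (card (hook E (a, j)) * C j)" .
        have "(\<Sum>p | (p, j) \<in> E \<and> i < p. g (p, j)) = (\<Sum>p\<in>{i<..a}. R p * C j)"
          using col True by (intro sum.mono_neutral_cong_right finite_col fin) (auto simp: g_def)
        also have "\<dots> = (card (hook E (i, b)) * R i) * C j"
          unfolding sum_distrib_right[symmetric] R_def
        proof (subst gnw_weight_harmonic)
          show "i < a \<Longrightarrow> real (card (hook E (i, b))) \<noteq> 0"
            using ab fin_hook[of "(i, b)"] by (auto simp: card_eq_0_iff hook_def)
        qed (use True hook_corner[OF E(2)] in auto)
        finally have 2: "(\<Sum>p | (p, j) \<in> E \<and> i < p. g (p, j)) = (card (hook E (i, b)) * R i) * C j" .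
        have "real (card (hook E x)) = card (hook E (i, b)) + card (hook E (a, j))"
          unfolding x using card_hook_corner[OF E pos(1) _ pos(2)] True by simp
        then show ?thesis
          unfolding x sum_hook[OF fin] 1 2 using True by (simp add: g_def algebra_simps)
      next
        case False
        then have "g y = 0" if "y \<in> hook E x" for y
          using that by (auto simp: g_def hook_def x)
        then show ?thesis
          using False by (auto simp: g_def x)
      qed
      finally show ?thesis
        using False fin_hook by simp
    qed
  qed
  from this[OF assms(3)] show ?thesis
    by (simp add: g_def R_def C_def)
qed

text \<open>Only starting boxes in the rectangle northwest of the corner contribute. There the
  probabilities are products of a row factor and a column factor, and \<open>gnw_weight_sum\<close>
  evaluates the sum of each factor.\<close>

lemma pmf_Hook:
  assumes E: "young E" "(a, b) \<in> maxs E"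
  shows "pmf (Hook E) (a, b) =
    (\<Prod>i\<in>{0<..<a}. 1 + 1 / card (hook E (i, b))) * (\<Prod>j\<in>{0<..<b}. 1 + 1 / card (hook E (a, j))) / card E"
proof -
  define R where "R = gnw_weight (\<lambda>i. card (hook E (i, b))) a"
  define C where "C = gnw_weight (\<lambda>j. card (hook E (a, j))) b"
  have fin: "finite E" using E by (simp add: young_def)
  have ab: "(a, b) \<in> E" using E(2) maxs_subset by blast
  then have pos: "0 < a" "0 < b" using youngD(2)[OF E(1)] by fastforce+
  have "pmf (Hook E) (a, b) = (\<Sum>x\<in>E. pmf (hook_walk E x) (a, b)) / card E"
    unfolding Hook_def using ab fin by (intro pmf_bind_pmf_of_set) auto
  also have "(\<Sum>x\<in>E. pmf (hook_walk E x) (a, b)) = (\<Sum>(i, j)\<in>{0<..a} \<times> {0<..b}. R i * C j)"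
  proof (rule sum.mono_neutral_cong_right[OF fin])
    show "{0<..a} \<times> {0<..b} \<subseteq> E"
      using youngD(3)[OF E(1) ab] by auto
    show "\<forall>x\<in>E - {0<..a} \<times> {0<..b}. pmf (hook_walk E x) (a, b) = 0"
    proof
      fix x assume x: "x \<in> E - {0<..a} \<times> {0<..b}"
      then have "\<not> (fst x \<le> a \<and> snd x \<le> b)"
        using youngD(2)[OF E(1), of "fst x" "snd x"] by (cases x) auto
      then show "pmf (hook_walk E x) (a, b) = 0"
        using pmf_hook_walk[OF E, of "fst x" "snd x"] x by auto
    qed
    fix x assume "x \<in> {0<..a} \<times> {0<..b}"
    then show "pmf (hook_walk E x) (a, b) = (case x of (i, j) \<Rightarrow> R i * C j)"
      using pmf_hook_walk[OF E, of "fst x" "snd x"] youngD(3)[OF E(1) ab, of "fst x" "snd x"]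
      by (auto simp: R_def C_def)
  qed
  also have "\<dots> = sum R {0<..a} * sum C {0<..b}"
    by (simp add: sum.cartesian_product[symmetric] sum_product)
  finally show ?thesis
    unfolding R_def C_def gnw_weight_sum[OF pos(1)] gnw_weight_sum[OF pos(2)] .
qed

section \<open>The hook length formula, derived from the corner probabilities\<close>

definition hook_formula :: "box set \<Rightarrow> real" where
  "hook_formula E = fact (card E) / (\<Prod>x\<in>E. 1 + card (hook E x))"

text \<open>Removing the corner shortens by one exactly the hooks of the boxes above it in its
  column and to the left of it in its row. The quotient of the two formulas is thus a product of
  factors \<open>1 + 1 / h\<close>, divided by \<open>card E\<close>, and this is the corner
  probability.\<close>

lemma hook_formula_remove:
  assumes E: "young E" "(a, b) \<in> maxs E"
  shows "pmf (Hook E) (a, b) * hook_formula E = hook_formula (E - {(a, b)})"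
proof -
  have fin: "finite E" using E by (simp add: young_def)
  have ab: "(a, b) \<in> E" using E(2) maxs_subset by blast
  have fin_hook: "finite (hook A x)" if "finite A" for x A
    by (rule finite_subset[OF _ that]) (auto simp: hook_def)
  let ?A = "\<lambda>i. 1 + 1 / real (card (hook E (i, b)))" and ?B = "\<lambda>j. 1 + 1 / real (card (hook E (a, j)))"
  \<comment> \<open>\<open>fac x\<close> is the ratio of the hook lengths of \<open>x\<close> before
    and after the removal.\<close>
  define fac where "fac = (\<lambda>(i, j). if j = b \<and> i < a then ?A i else if i = a \<and> j < b then ?B j else 1)"
  have fac: "1 + real (card (hook E x)) = (1 + real (card (hook (E - {(a, b)}) x))) * fac x"
    if x: "x \<in> E - {(a, b)}" for x
  proof -
    obtain i j where ij: "x = (i, j)" by fastforce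
    have "hook (E - {(a, b)}) x = hook E x - {(a, b)}"
      by (auto simp: hook_def)
    then have c: "card (hook (E - {(a, b)}) x) = card (hook E x) - (if (a, b) \<in> hook E x then 1 else 0)"
      using fin_hook[OF fin] by (simp add: card_Diff_singleton_if)
    show ?thesis
    proof (cases "(a, b) \<in> hook E x")
      case True
      then have "card (hook E x) > 0"
        using fin_hook[OF fin] by (auto simp: card_gt_0_iff)
      moreover have "fac x = 1 + 1 / card (hook E x)"
        using True by (auto simp: fac_def ij hook_def)
      ultimately show ?thesis
        unfolding c using True by (simp add: field_simps of_nat_diff)
    next
      case False
      then have "fac x = 1"
        using ab x by (auto simp: fac_def ij hook_def)
      then show ?thesis
        unfolding c using False by simp
    qed
  qed
  have "(\<Prod>x\<in>E - {(a, b)}. fac x) = (\<Prod>i\<in>{0<..<a}. ?A i) * (\<Prod>j\<in>{0<..<b}. ?B j)"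
  proof -
    let ?S = "(\<lambda>i. (i, b)) ` {0<..<a}" and ?T = "Pair a ` {0<..<b}"
    have "(\<Prod>x\<in>E - {(a, b)}. fac x) = (\<Prod>x\<in>?S \<union> ?T. fac x)"
    proof (rule prod.mono_neutral_right)
      show "?S \<union> ?T \<subseteq> E - {(a, b)}"
        using youngD(2,3)[OF E(1) ab] by auto
      show "\<forall>x\<in>E - {(a, b)} - (?S \<union> ?T). fac x = 1"
        using youngD(2)[OF E(1)] by (fastforce simp: fac_def image_iff)
    qed (use fin in auto)
    also have "\<dots> = prod fac ?S * prod fac ?T"
      by (rule prod.union_disjoint) auto
    also have "prod fac ?S = (\<Prod>i\<in>{0<..<a}. ?A i)"
      by (subst prod.reindex) (auto simp: inj_on_def fac_def)
    also have "prod fac ?T = (\<Prod>j\<in>{0<..<b}. ?B j)"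
      by (subst prod.reindex) (auto simp: inj_on_def fac_def)
    finally show ?thesis .
  qed
  then have pm: "pmf (Hook E) (a, b) = (\<Prod>x\<in>E - {(a, b)}. fac x) / card E"
    using pmf_Hook[OF E] by simp
  define H where "H = (\<Prod>x\<in>E - {(a, b)}. 1 + real (card (hook (E - {(a, b)}) x)))"
  define G where "G = (\<Prod>x\<in>E - {(a, b)}. fac x)"
  have "(\<Prod>x\<in>E. 1 + real (card (hook E x))) = (\<Prod>x\<in>E - {(a, b)}. 1 + real (card (hook E x)))"
    using prod.remove[OF fin ab, of "\<lambda>x. 1 + real (card (hook E x))"] hook_corner[OF E(2)] by simp
  also have "\<dots> = H * G"
    unfolding H_def G_def by (simp add: fac prod.distrib)
  finally have HG: "(\<Prod>x\<in>E. 1 + real (card (hook E x))) = H * G" .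
  have "(\<Prod>x\<in>E. 1 + real (card (hook E x))) > 0"
    by (intro prod_pos) simp
  then have "G \<noteq> 0" unfolding HG by auto
  have cE: "card E = Suc (card (E - {(a, b)}))"
    using card_Suc_Diff1[OF fin ab] by simp
  have "fact (card E) = real (card E) * fact (card (E - {(a, b)}))"
    unfolding cE by simp
  then have eq: "fact (card (E - {(a, b)})) = fact (card E) / real (card E)"
    using cE by simp
  show ?thesis
    using \<open>G \<noteq> 0\<close> unfolding pm hook_formula_def of_nat_prod
    unfolding of_nat_add of_nat_1 HG H_def[symmetric] G_def[symmetric]
    unfolding eq by (simp add: field_simps)
qed

text \<open>Outside the corners the walk can always continue. Consequently the corner probabilities
  sum to one.\<close>

lemma set_Hook:
  assumes "young E" "E \<noteq> {}"
  shows "set_pmf (Hook E) \<subseteq> maxs E"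
proof -
  have fin: "finite E" using assms by (simp add: young_def)
  have fin_hook: "finite (hook E x)" for x
    by (rule finite_subset[OF _ fin]) (auto simp: hook_def)
  have "x \<in> E \<Longrightarrow> set_pmf (hook_walk E x) \<subseteq> maxs E" for x
  proof (induction "card {y \<in> E. x \<le> y}" arbitrary: x rule: less_induct)
    case (less x)
    have IH: "set_pmf (hook_walk E y) \<subseteq> maxs E" if "y \<in> hook E x" for y
    proof (rule less.hyps)
      have "x \<notin> {z \<in> E. y \<le> z}" "x \<in> {z \<in> E. x \<le> z}" "{z \<in> E. y \<le> z} \<subseteq> {z \<in> E. x \<le> z}"
        using that less.prems(1) by (auto simp: hook_def less_eq_prod_def)
      then show "card {z \<in> E. y \<le> z} < card {z \<in> E. x \<le> z}"
        using fin by (intro psubset_card_mono) auto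
    qed (use that fin in \<open>auto simp: hook_def\<close>)
    show ?case
    proof (cases "hook E x = {}")
      case True
      obtain i j where x: "x = (i, j)" by fastforce
      have "y = x" if y: "y \<in> E" "x \<le> y" for y
      proof (rule ccontr)
        assume "y \<noteq> x"
        obtain p q where pq: "y = (p, q)" by fastforce
        have le: "i \<le> p" "j \<le> q" using y(2) by (simp_all add: x pq)
        have pos: "1 \<le> i" "1 \<le> j" using youngD(2)[OF assms(1)] less.prems x by blast+
        have "(i, q) \<in> E" "(p, j) \<in> E"
          using youngD(3)[OF assms(1), of p q] y(1) le pos unfolding pq by simp_all
        moreover have "i < p \<or> j < q"
          using \<open>y \<noteq> x\<close> le unfolding x pq by auto
        ultimately have "hook E x \<noteq> {}" by (auto simp: hook_def x)
        then show False using True by simp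
      qed
      then have "x \<in> maxs E" using less.prems by (auto simp: maxs_def)
      then show ?thesis
        using True by (subst hook_walk.simps) simp
    next
      case False
      then show ?thesis
        using IH fin fin_hook by (subst hook_walk.simps) (auto simp: set_pmf_of_set)
    qed
  qed
  then show ?thesis
    unfolding Hook_def using assms fin by (auto simp: set_pmf_of_set)
qed

text \<open>Since the corner probabilities sum to one, \<open>hook_formula\<close> satisfies the
  recursion of \<open>linexts\<close>.\<close>

lemma hook_formula_eq:
  assumes "young E"
  shows "hook_formula E = linexts E"
  using assms
proof (induction "card E" arbitrary: E)
  case 0
  then have "E = {}" by (simp add: young_def)
  then show ?case by (simp add: hook_formula_def)
next
  case (Suc n)
  have ne: "E \<noteq> {}" and fin: "finite E" using Suc by (auto simp: young_def)
  have "hook_formula E = (\<Sum>x\<in>maxs E. pmf (Hook E) x) * hook_formula E"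
    using sum_pmf_eq_1[OF finite_maxs[OF fin] set_Hook[OF Suc(3) ne]] by simp
  also have "\<dots> = (\<Sum>x\<in>maxs E. hook_formula (E - {x}))"
    unfolding sum_distrib_right
  proof (rule sum.cong)
    fix x assume "x \<in> maxs E"
    then show "pmf (Hook E) x * hook_formula E = hook_formula (E - {x})"
      using hook_formula_remove[OF Suc(3), of "fst x" "snd x"] by simp
  qed simp
  also have "\<dots> = (\<Sum>x\<in>maxs E. real (linexts (E - {x})))"
  proof (rule sum.cong)
    fix x assume x: "x \<in> maxs E"
    then have "n = card (E - {x})"
      using Suc(2) fin maxs_subset[of E] by (auto simp: card_Diff_singleton subset_iff)
    then show "hook_formula (E - {x}) = real (linexts (E - {x}))"
      using Suc(1)[of "E - {x}"] young_remove_max[OF Suc(3) x] by simp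
  qed simp
  also have "\<dots> = linexts E"
    using linexts_rec[OF fin ne] by simp
  finally show ?case .
qed

text \<open>The hook walk chooses the corner that carries the last element of a uniformly random
  linear extension.\<close>

lemma pmf_Hook_linexts:
  assumes "young E" "x \<in> maxs E"
  shows "pmf (Hook E) x = linexts (E - {x}) / linexts E"
proof -
  have "pmf (Hook E) x * real (linexts E) = real (linexts (E - {x}))"
    using hook_formula_remove[OF assms(1), of "fst x" "snd x"] assms
      hook_formula_eq[OF assms(1)] hook_formula_eq[OF young_remove_max[OF assms]] by simp
  then show ?thesis
    using linexts_pos[of E] assms by (simp add: young_def field_simps)
qed

section \<open>Output probabilities of the generation algorithm\<close>

text \<open>Output probabilities are bounded from below by the probability of one insertion
  sequence, for which this inequality and the next one suffice.\<close>

lemma pmf_bind_ge: "pmf p x * pmf (f x) y \<le> pmf (bind_pmf p f) y"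
proof -
  have "pmf p x * pmf (f x) y = (\<integral>z. pmf (f x) y * indicator {x} z \<partial>measure_pmf p)"
    by (simp add: measure_pmf_single)
  also have "\<dots> \<le> (\<integral>z. pmf (f z) y \<partial>measure_pmf p)"
    by (intro integral_mono measure_pmf.integrable_const_bound[where B = 1])
       (auto simp: pmf_le_1 indicator_def)
  finally show ?thesis by (simp add: pmf_bind)
qed

lemma pmf_map_ge: "pmf p x \<le> pmf (map_pmf f p) (f x)"
proof -
  have "pmf p x = measure (measure_pmf p) {x}"
    by (simp add: measure_pmf_single)
  also have "\<dots> \<le> measure (measure_pmf p) (f -` {f x})"
    by (intro measure_pmf.finite_measure_mono) auto
  finally show ?thesis by (simp add: pmf_map)
qed

text \<open>The empty region of a run that starts with \<open>E\<close> shrinks, so all ideals that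
  it meets are subsets of \<open>E\<close>. \<open>W\<close> then bounds the number of boxes among
  which an additional value is distributed.\<close>

definition width_bound :: "box set \<Rightarrow> box set \<Rightarrow> nat \<Rightarrow> bool" where
  "width_bound D E W \<longleftrightarrow> (\<forall>I\<subseteq>E. young I \<longrightarrow> card (mins (D - I)) \<le> W)"

lemma pmf_svgen_step_max:
  assumes "young (diagram lam)" "ptab (diagram lam) N (Suc M) T" "b \<in> maxs (empt (diagram lam) T)"
    and "card (empt (diagram lam) T) \<le> Suc M"
  defines "E \<equiv> empt (diagram lam) T"
  shows "real (card E) / real (Suc M) * (linexts (E - {b}) / linexts E)
    \<le> pmf (svgen_step lam (Suc M) T) (add_value (Suc M) b T)"
proof -
  let ?p = "(real (Suc M) - real (card E)) / real (Suc M)"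
  have E: "young E" unfolding E_def using young_empt assms by blast
  have "T b = {}" using assms(3) by (auto simp: maxs_def empt_def)
  then have eq: "add_value (Suc M) b T = (\<lambda>b. T(b := {Suc M})) b"
    by (simp add: add_value_def)
  have "linexts (E - {b}) / linexts E = pmf (Hook E) b"
    using pmf_Hook_linexts[OF E, of b] assms(3) by (simp add: E_def)
  also have "\<dots> \<le> pmf (map_pmf (\<lambda>b. T(b := {Suc M})) (Hook E)) (add_value (Suc M) b T)"
    unfolding eq by (rule pmf_map_ge)
  finally have "real (card E) / real (Suc M) * (linexts (E - {b}) / linexts E) \<le>
      pmf (bernoulli_pmf ?p) False * pmf (map_pmf (\<lambda>b. T(b := {Suc M})) (Hook E)) (add_value (Suc M) b T)"
    using assms(4) by (intro mult_mono) (auto simp: E_def field_simps)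
  also have "\<dots> \<le> pmf (svgen_step lam (Suc M) T) (add_value (Suc M) b T)"
    unfolding svgen_step_def Let_def empty_boxes_eq E_def[symmetric]
    by (rule order_trans[OF _ pmf_bind_ge[of _ False]]) simp
  finally show ?thesis .
qed

lemma pmf_svgen_step_min:
  assumes "young (diagram lam)" "b \<in> mins (diagram lam - empt (diagram lam) T)"
    and "card (empt (diagram lam) T) \<le> Suc M"
  defines "E \<equiv> empt (diagram lam) T"
  shows "(real (Suc M) - real (card E)) / real (Suc M) / card (mins (diagram lam - E))
    \<le> pmf (svgen_step lam (Suc M) T) (add_value (Suc M) b T)"
proof -
  let ?p = "(real (Suc M) - real (card E)) / real (Suc M)"
  have eq: "add_value (Suc M) b T = (\<lambda>b. T(b := insert (Suc M) (T b))) b"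
    by (simp add: add_value_def)
  have "{b \<in> diagram lam. T b \<noteq> {}} = diagram lam - E"
    by (auto simp: E_def empt_def)
  moreover have "diagram lam - E \<subseteq> {1..} \<times> {1..}"
    using assms(1) by (auto simp: young_def)
  ultimately have NW: "NW {b \<in> diagram lam. T b \<noteq> {}} = mins (diagram lam - E)"
    by (simp add: NW_eq_mins)
  have "finite (mins (diagram lam - E))"
    using assms(1) by (auto simp: young_def mins_def)
  then have "1 / card (mins (diagram lam - E)) = pmf (pmf_of_set (mins (diagram lam - E))) b"
    using assms(2) by (subst pmf_of_set) (auto simp: E_def)
  also have "\<dots> \<le> pmf (map_pmf (\<lambda>b. T(b := insert (Suc M) (T b))) (pmf_of_set (mins (diagram lam - E)))) (add_value (Suc M) b T)"
    unfolding eq by (rule pmf_map_ge)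
  finally have "?p * (1 / card (mins (diagram lam - E))) \<le>
      pmf (bernoulli_pmf ?p) True * pmf (map_pmf (\<lambda>b. T(b := insert (Suc M) (T b))) (pmf_of_set (mins (diagram lam - E)))) (add_value (Suc M) b T)"
    using assms(3) by (intro mult_mono) (auto simp: E_def field_simps)
  also have "\<dots> \<le> pmf (svgen_step lam (Suc M) T) (add_value (Suc M) b T)"
    unfolding svgen_step_def Let_def empty_boxes_eq E_def[symmetric] NW
    by (rule order_trans[OF _ pmf_bind_ge[of _ True]]) simp
  finally show ?thesis by simp
qed

section \<open>Lower bounds for the output probabilities by telescoping weights\<close>

definition gen_weight :: "nat \<Rightarrow> nat \<Rightarrow> box set \<Rightarrow> real" where
  "gen_weight W M E = real (M choose card E) * linexts E * W ^ (M - card E)"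

text \<open>With \<open>n\<close> empty boxes and \<open>m\<close> values left,
  \<open>n / m * (m choose n) = (m - 1 choose n - 1)\<close> absorbs the coin, and the hook walk
  exchanges the two numbers of linear extensions. The exponent of \<open>W\<close> does not
  change.\<close>

lemma gen_weight_max:
  assumes "finite E" "b \<in> E"
  shows "real (card E) / real (Suc M) * (linexts (E - {b}) / linexts E) * gen_weight W (Suc M) E
    = gen_weight W M (E - {b})"
proof -
  obtain n where n: "card E = Suc n" "card (E - {b}) = n"
    using assms by (metis card_Suc_Diff1)
  have "real (Suc n) * real (Suc M choose Suc n) = real (Suc M) * real (M choose n)"
    unfolding of_nat_mult[symmetric] Suc_times_binomial ..
  moreover have "x / m * (e' / e) * (c * e * w) = x * c / m * e' * w" if "e \<noteq> 0" for x m e' e c w :: real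
    using that by simp
  moreover have "real (linexts E) \<noteq> 0" using linexts_pos[OF assms(1)] by simp
  ultimately have "real (card E) / real (Suc M) * (linexts (E - {b}) / linexts E)
      * (real (Suc M choose card E) * linexts E * real W ^ (Suc M - card E))
    = real (Suc M) * real (M choose n) / real (Suc M) * linexts (E - {b}) * real W ^ (Suc M - card E)"
    using n(1) by metis
  then show ?thesis
    unfolding gen_weight_def n by (simp del: of_nat_Suc binomial_Suc_Suc linext.simps)
qed

text \<open>Here the coin gives \<open>(m - n) / m * (m choose n) = (m - 1 choose n)\<close>, and
  the remaining quotient \<open>W / w\<close> is at least 1.\<close>

lemma gen_weight_min:
  assumes "card E \<le> M" "0 < w" "w \<le> W"
  shows "gen_weight W M E \<le> (real (Suc M) - real (card E)) / real (Suc M) / w * gen_weight W (Suc M) E"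
proof -
  have "(Suc M - card E) * (Suc M choose card E) = Suc M * (M choose card E)"
    using binomial_absorb_comp[of "Suc M" "card E"] by simp
  then have *: "(real (Suc M) - real (card E)) * real (Suc M choose card E) = real (Suc M) * real (M choose card E)"
    using assms(1) unfolding of_nat_mult[symmetric] by (simp add: of_nat_diff[symmetric] del: of_nat_diff of_nat_Suc flip: of_nat_mult)
  have "(real (Suc M) - real (card E)) / real (Suc M) / w * gen_weight W (Suc M) E
      = ((real (Suc M) - real (card E)) * real (Suc M choose card E)) / real (Suc M) * (W / w) * linexts E * W ^ (M - card E)"
    using assms(1) by (simp add: gen_weight_def Suc_diff_le)
  also have "\<dots> = (W / w) * gen_weight W M E"
    unfolding * by (simp add: gen_weight_def del: of_nat_Suc)
  also have "\<dots> \<ge> 1 * gen_weight W M E"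
    using assms by (intro mult_right_mono) (auto simp: gen_weight_def)
  finally show ?thesis by simp
qed

lemma gen_weight_nonneg: "gen_weight W M E \<ge> 0"
  by (simp add: gen_weight_def)

text \<open>Each step has probability at least the quotient of the weights after and before it. The
  quotients telescope, and the weight at the end is 1.\<close>

lemma svgen_loop_ge:
  assumes D: "young (diagram lam)" and "ptab (diagram lam) N M T" "M \<le> N"
    and "T' \<in> completions (diagram lam) N M T"
    and "width_bound (diagram lam) (empt (diagram lam) T) W"
  shows "1 \<le> pmf (svgen_loop lam M T) T' * gen_weight W M (empt (diagram lam) T)"
  using assms(2-)
proof (induction M arbitrary: T)
  case 0
  then show ?case
    by (auto simp: completions_0 gen_weight_def split: if_splits)
next
  case (Suc M)
  define E where "E = empt (diagram lam) T"
  have finD: "finite (diagram lam)" using D by (simp add: young_def)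
  have E: "finite E" "young E"
    using young_empt[OF D Suc.prems(1)] by (auto simp: E_def young_def)
  obtain b where b: "b \<in> opts (diagram lam) E"
    "T' \<in> completions (diagram lam) N M (add_value (Suc M) b T)"
    using Suc.prems(3) completions_Suc[OF Suc.prems(1,2)] unfolding E_def by blast
  have bD: "b \<in> diagram lam"
    using b(1) opts_subset[OF empt_subset] unfolding E_def by blast
  let ?T = "add_value (Suc M) b T"
  have empt: "empt (diagram lam) ?T = E - {b}"
    by (simp add: empt_add_value E_def)
  have cE: "card E \<le> Suc M"
    using card_empt_le[OF finD Suc.prems(3,2)] by (simp add: E_def)
  have cE1: "card (E - {b}) \<le> M"
    using card_empt_le[OF finD b(2)] Suc.prems(2) by (simp add: empt)
  have W: "width_bound (diagram lam) (E - {b}) W"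
    using Suc.prems(4) unfolding width_bound_def E_def by (meson Diff_subset order_trans)
  have "1 \<le> pmf (svgen_loop lam M ?T) T' * gen_weight W M (E - {b})"
    using Suc.IH[of ?T] Suc.prems(2) b(2) W ptab_of_completions[OF b(2)] by (simp add: empt)
  also have "gen_weight W M (E - {b}) \<le> pmf (svgen_step lam (Suc M) T) ?T * gen_weight W (Suc M) E"
  proof (cases "b \<in> E")
    case True
    then have "b \<in> maxs E" using b(1) by (auto simp: opts_def mins_def)
    from pmf_svgen_step_max[OF D Suc.prems(1) this[unfolded E_def] cE[unfolded E_def]]
    have "real (card E) / real (Suc M) * (linexts (E - {b}) / linexts E) * gen_weight W (Suc M) E
        \<le> pmf (svgen_step lam (Suc M) T) ?T * gen_weight W (Suc M) E"
      unfolding E_def[symmetric] by (intro mult_right_mono gen_weight_nonneg)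
    then show ?thesis
      unfolding gen_weight_max[OF E(1) True] .
  next
    case False
    then have mb: "b \<in> mins (diagram lam - E)" using b(1) by (auto simp: opts_def maxs_def)
    have "card (mins (diagram lam - E)) \<le> W"
      using Suc.prems(4) E unfolding width_bound_def E_def by blast
    moreover have "card (mins (diagram lam - E)) > 0"
      using mb finD finite_subset[OF mins_subset] by (auto simp: card_gt_0_iff)
    moreover have "card E \<le> M" using cE1 False by simp
    ultimately have "gen_weight W M E \<le> (real (Suc M) - real (card E)) / real (Suc M)
        / card (mins (diagram lam - E)) * gen_weight W (Suc M) E"
      by (intro gen_weight_min)
    also have "\<dots> \<le> pmf (svgen_step lam (Suc M) T) ?T * gen_weight W (Suc M) E"
      using pmf_svgen_step_min[OF D mb[unfolded E_def] cE[unfolded E_def]]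
      unfolding E_def[symmetric] by (intro mult_right_mono gen_weight_nonneg)
    finally show ?thesis using False by simp
  qed
  also have "pmf (svgen_loop lam M ?T) T' * (pmf (svgen_step lam (Suc M) T) ?T * gen_weight W (Suc M) E)
      = (pmf (svgen_step lam (Suc M) T) ?T * pmf (svgen_loop lam M ?T) T') * gen_weight W (Suc M) E"
    by simp
  also have "\<dots> \<le> pmf (svgen_loop lam (Suc M) T) T' * gen_weight W (Suc M) E"
    by (intro mult_right_mono gen_weight_nonneg) (simp add: pmf_bind_ge)
  finally show ?case
    by (simp add: E_def mult_left_mono)
qed

lemma P_SVG_ge:
  assumes D: "young (diagram lam)" and T': "T' \<in> completions (diagram lam) N k S" and "k \<le> N" "0 < N"
    and W: "width_bound (diagram lam) (empt (diagram lam) S) W"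
  shows "1 \<le> P_SVG lam N k S T' * gen_weight W k (empt (diagram lam) S)"
proof (cases "k = N")
  case False
  then show ?thesis
    using svgen_loop_ge[OF D ptab_of_completions[OF T'] assms(3) T' W] by (simp add: P_SVG_def SVGen_def)
next
  case True
  then obtain M where M: "k = Suc M" "N = Suc M" using assms(4) by (cases N) auto
  define E where "E = diagram lam"
  have pt: "ptab E N (Suc M) S" using ptab_of_completions[OF T'] M by (simp add: E_def)
  have finD: "finite E" using D by (simp add: young_def E_def)
  have "S b = {}" for b
    using ptabD(2)[OF pt, of b] M by simp
  then have empt: "empt E S = E" and add: "add_value N b S = S(b := {N})" for b
    by (auto simp: empt_def add_value_def)
  obtain b where b0: "b \<in> opts E E" "T' \<in> completions E N M (add_value N b S)"
    using T' completions_Suc[OF pt] M unfolding E_def[symmetric] empt by auto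
  note b = b0[unfolded add]
  have mb: "b \<in> maxs E" using b(1) by (auto simp: opts_def mins_def)
  have bE: "b \<in> E" using mb by (auto simp: maxs_def)
  have empt': "empt E (S(b := {N})) = E - {b}"
    using empt_add_value[of E N b S] by (simp add: add empt)
  have "width_bound E (E - {b}) W"
    using W unfolding E_def[symmetric] empt unfolding width_bound_def by (meson Diff_subset order_trans)
  then have "1 \<le> pmf (svgen_loop lam M (S(b := {N}))) T' * gen_weight W M (E - {b})"
    using svgen_loop_ge[OF D _ _ b(2)[unfolded E_def], folded E_def, unfolded empt'] 
      ptab_of_completions[OF b(2)] M(2) by simp
  also have "gen_weight W M (E - {b}) \<le> pmf (Hook E) b * gen_weight W (Suc M) E"
  proof -
    \<comment> \<open>The first insertion is made without a coin, which can only increase its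
      probability compared with the coin weight \<open>card E / Suc M\<close>.\<close>
    have "card E \<le> Suc M"
      using card_empt_le[OF finD T'[folded E_def]] M by (simp add: empt)
    then have "real (card E) / real (Suc M) \<le> 1" by simp
    then have "real (card E) / real (Suc M) * (linexts (E - {b}) / linexts E) * gen_weight W (Suc M) E
        \<le> 1 * (linexts (E - {b}) / linexts E) * gen_weight W (Suc M) E"
      by (intro mult_right_mono gen_weight_nonneg) auto
    then show ?thesis
      using pmf_Hook_linexts[OF D[folded E_def] mb] gen_weight_max[OF finD bE] by simp
  qed
  also have "pmf (svgen_loop lam M (S(b := {N}))) T' * (pmf (Hook E) b * gen_weight W (Suc M) E)
      = (pmf (Hook E) b * pmf (svgen_loop lam M (S(b := {N}))) T') * gen_weight W (Suc M) E"
    by simp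
  also have "\<dots> \<le> P_SVG lam N k S T' * gen_weight W (Suc M) E"
    unfolding P_SVG_def SVGen_def using True M pmf_bind_ge[of "Hook E" b]
    by (intro mult_right_mono gen_weight_nonneg) (simp add: E_def)
  finally show ?thesis
    using M empt by (simp add: E_def mult_left_mono)
qed

section \<open>Independence Metropolis chains\<close>

context
  fixes X :: "'a set" and P :: "'a \<Rightarrow> 'a \<Rightarrow> real" and \<delta> :: real
  assumes X: "finite X" "X \<noteq> {}"
    and sym: "\<And>x y. x \<in> X \<Longrightarrow> y \<in> X \<Longrightarrow> P x y = P y x"
    and rows: "\<And>x. x \<in> X \<Longrightarrow> (\<Sum>y\<in>X. P x y) = 1"
    and lower: "\<And>x y. x \<in> X \<Longrightarrow> y \<in> X \<Longrightarrow> \<delta> / card X \<le> P x y"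
    and \<delta>: "0 < \<delta>" "\<delta> \<le> 1"
begin

text \<open>A vector of sum zero does not see constants, so \<open>\<delta> / card X\<close> may be
  subtracted from every entry of \<open>P\<close>. The rest is nonnegative with row sums
  \<open>1 - \<delta>\<close>.\<close>

lemma doeblin_contraction:
  assumes "sum f X = 0"
  shows "(\<Sum>y\<in>X. \<bar>\<Sum>x\<in>X. f x * P x y\<bar>) \<le> (1 - \<delta>) * (\<Sum>x\<in>X. \<bar>f x\<bar>)"
proof -
  have "\<bar>\<Sum>x\<in>X. f x * P x y\<bar> \<le> (\<Sum>x\<in>X. \<bar>f x\<bar> * (P x y - \<delta> / card X))" if "y \<in> X" for y
  proof -
    have "(\<Sum>x\<in>X. f x * P x y) = (\<Sum>x\<in>X. f x * (P x y - \<delta> / card X))"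
      using assms by (simp add: right_diff_distrib sum_subtractf flip: sum_divide_distrib sum_distrib_right)
    also have "\<bar>\<dots>\<bar> \<le> (\<Sum>x\<in>X. \<bar>f x * (P x y - \<delta> / card X)\<bar>)"
      by (rule sum_abs)
    also have "\<dots> = (\<Sum>x\<in>X. \<bar>f x\<bar> * (P x y - \<delta> / card X))"
      using lower that by (intro sum.cong) (auto simp: abs_mult)
    finally show ?thesis .
  qed
  then have "(\<Sum>y\<in>X. \<bar>\<Sum>x\<in>X. f x * P x y\<bar>) \<le> (\<Sum>y\<in>X. \<Sum>x\<in>X. \<bar>f x\<bar> * (P x y - \<delta> / card X))"
    by (rule sum_mono)
  also have "\<dots> = (\<Sum>x\<in>X. \<bar>f x\<bar> * (\<Sum>y\<in>X. P x y - \<delta> / card X))"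
    by (subst sum.swap) (simp add: sum_distrib_left)
  also have "\<dots> = (\<Sum>x\<in>X. \<bar>f x\<bar> * (1 - \<delta>))"
    using X rows by (intro sum.cong) (auto simp: sum_subtractf)
  finally show ?thesis
    by (simp add: sum_distrib_right[symmetric] mult.commute)
qed

lemma uniform_invariant:
  assumes "y \<in> X"
  shows "(\<Sum>x\<in>X. 1 / card X * P x y) = 1 / card X"
proof -
  have "(\<Sum>x\<in>X. 1 / card X * P x y) = 1 / card X * (\<Sum>x\<in>X. P y x)"
    unfolding sum_distrib_left using sym assms by (intro sum.cong) auto
  then show ?thesis using rows assms by simp
qed

text \<open>The difference of a stationary distribution and the uniform one is a fixed vector of sum
  zero, and the contraction makes it vanish.\<close>

lemma stationary_eq: "stationary X P = pmf_of_set X"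
  unfolding stationary_def
proof (rule the_equality)
  show "is_stationary X P (pmf_of_set X)"
    unfolding is_stationary_def using X uniform_invariant by (simp add: set_pmf_of_set)
next
  fix q assume q: "is_stationary X P q"
  let ?f = "\<lambda>x. pmf q x - 1 / card X"
  have "sum (pmf q) X = 1"
    using q X by (intro sum_pmf_eq_1) (auto simp: is_stationary_def)
  then have 0: "sum ?f X = 0"
    using X by (simp add: sum_subtractf)
  have "(\<Sum>x\<in>X. ?f x * P x y) = ?f y" if "y \<in> X" for y
    using q uniform_invariant[OF that] that
    by (simp add: is_stationary_def left_diff_distrib sum_subtractf)
  then have "(\<Sum>y\<in>X. \<bar>?f y\<bar>) \<le> (1 - \<delta>) * (\<Sum>x\<in>X. \<bar>?f x\<bar>)"
    using doeblin_contraction[OF 0] by simp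
  then have "\<delta> * (\<Sum>x\<in>X. \<bar>?f x\<bar>) \<le> 0"
    by (simp add: algebra_simps)
  then have "(\<Sum>x\<in>X. \<bar>?f x\<bar>) \<le> 0"
    using \<delta> by (simp add: mult_le_0_iff)
  then have "(\<Sum>x\<in>X. \<bar>?f x\<bar>) = 0"
    by (intro antisym sum_nonneg) auto
  then have "pmf q x = 1 / card X" if "x \<in> X" for x
    using that X(1) by (simp add: sum_nonneg_eq_0_iff)
  moreover have "pmf q x = 0" if "x \<notin> X" for x
    using q that by (auto simp: is_stationary_def pmf_eq_0_set_pmf)
  ultimately show "q = pmf_of_set X"
    using X by (intro pmf_eqI) (auto simp: indicator_def)
qed

text \<open>The factor 2 bounds the distance of a point mass from the uniform distribution in the l1
  norm.\<close>

lemma mat_pow_l1: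
  assumes "x \<in> X"
  shows "(\<Sum>y\<in>X. mat_pow X P t x y) = 1 \<and> (\<Sum>y\<in>X. \<bar>mat_pow X P t x y - 1 / card X\<bar>) \<le> 2 * (1 - \<delta>) ^ t"
proof (induction t)
  case 0
  have "(\<Sum>y\<in>X. \<bar>mat_pow X P 0 x y - 1 / card X\<bar>) \<le> (\<Sum>y\<in>X. (if x = y then 1 else 0) + 1 / card X)"
    by (rule sum_mono) (auto simp: abs_if)
  also have "\<dots> = 2"
    using X assms by (simp add: sum.distrib)
  finally show ?case
    using X assms by simp
next
  case (Suc t)
  let ?f = "\<lambda>z. mat_pow X P t x z - 1 / card X"
  have 0: "sum ?f X = 0"
    using Suc X by (simp add: sum_subtractf)
  have "(\<Sum>y\<in>X. mat_pow X P (Suc t) x y) = (\<Sum>z\<in>X. mat_pow X P t x z * (\<Sum>y\<in>X. P z y))"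
    by (simp add: sum_distrib_left) (rule sum.swap)
  then have 1: "(\<Sum>y\<in>X. mat_pow X P (Suc t) x y) = 1"
    using Suc rows by simp
  have "mat_pow X P (Suc t) x y - 1 / card X = (\<Sum>z\<in>X. ?f z * P z y)" if "y \<in> X" for y
    using uniform_invariant[OF that] by (simp add: left_diff_distrib sum_subtractf)
  then have "(\<Sum>y\<in>X. \<bar>mat_pow X P (Suc t) x y - 1 / card X\<bar>) = (\<Sum>y\<in>X. \<bar>\<Sum>z\<in>X. ?f z * P z y\<bar>)"
    by (intro sum.cong) auto
  also have "\<dots> \<le> (1 - \<delta>) * (\<Sum>z\<in>X. \<bar>?f z\<bar>)"
    by (rule doeblin_contraction[OF 0])
  also have "\<dots> \<le> (1 - \<delta>) * (2 * (1 - \<delta>) ^ t)"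
    using Suc \<delta> by (intro mult_left_mono) auto
  finally show ?case
    using 1 by (simp add: mult_ac)
qed

lemma chain_dist_le: "chain_dist X P t \<le> 2 * (1 - \<delta>) ^ t"
proof -
  have "tv_dist X (mat_pow X P t x) (pmf (stationary X P)) \<le> 2 * (1 - \<delta>) ^ t" if "x \<in> X" for x
    unfolding tv_dist_def
  proof (rule Max.boundedI)
    fix d assume "d \<in> (\<lambda>A. \<bar>sum (mat_pow X P t x) A - sum (pmf (stationary X P)) A\<bar>) ` Pow X"
    then obtain A where A: "A \<subseteq> X" "d = \<bar>sum (mat_pow X P t x) A - sum (pmf (stationary X P)) A\<bar>"
      by auto
    have "sum (pmf (stationary X P)) A = (\<Sum>y\<in>A. 1 / card X)"
      unfolding stationary_eq using X A(1) by (intro sum.cong) (auto simp: indicator_def)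
    then have "d = \<bar>\<Sum>y\<in>A. mat_pow X P t x y - 1 / card X\<bar>"
      unfolding A(2) by (simp add: sum_subtractf)
    also have "\<dots> \<le> (\<Sum>y\<in>A. \<bar>mat_pow X P t x y - 1 / card X\<bar>)"
      by (rule sum_abs)
    also have "\<dots> \<le> (\<Sum>y\<in>X. \<bar>mat_pow X P t x y - 1 / card X\<bar>)"
      using X A(1) by (intro sum_mono2) auto
    finally show "d \<le> 2 * (1 - \<delta>) ^ t"
      using mat_pow_l1[OF that, of t] by simp
  qed (use X in auto)
  then show ?thesis
    unfolding chain_dist_def using X by (intro Max.boundedI) auto
qed

text \<open>By \<open>(1 - \<delta>) * (1 + \<delta>) \<le> 1\<close> and Bernoulli's inequality,
  \<open>(1 - \<delta>) ^ s \<le> 1 / (1 + s * \<delta>)\<close>. This crude decay suffices because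
  a polynomial in \<open>1 / eps\<close> is allowed.\<close>

lemma t_mix_le:
  assumes "0 < eps"
  shows "\<exists>t. t_mix X P eps = enat t \<and> real t \<le> 2 / (\<delta> * eps) + 1"
proof -
  define s where "s = nat \<lceil>2 / (\<delta> * eps)\<rceil>"
  have pos: "0 < 2 / (\<delta> * eps)" using \<delta> assms by simp
  have s: "2 / (\<delta> * eps) \<le> real s" "real s \<le> 2 / (\<delta> * eps) + 1"
    unfolding s_def using pos by linarith+
  have "(1 - \<delta>) ^ s * (1 + s * \<delta>) \<le> (1 - \<delta>) ^ s * (1 + \<delta>) ^ s"
    using \<delta> Bernoulli_inequality[of \<delta> s] by (intro mult_left_mono) auto
  also have "\<dots> = ((1 - \<delta>) * (1 + \<delta>)) ^ s"
    by (simp add: power_mult_distrib)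
  also have "\<dots> \<le> 1"
    using \<delta> by (intro power_le_one) (auto simp: algebra_simps mult_le_one)
  finally have "(1 - \<delta>) ^ s * (1 + s * \<delta>) \<le> 1" .
  moreover have "2 / eps \<le> 1 + s * \<delta>"
    using s(1) \<delta> assms by (simp add: field_simps)
  moreover have "(1 - \<delta>) ^ s \<ge> 0" using \<delta> by simp
  ultimately have "(1 - \<delta>) ^ s * (2 / eps) \<le> 1"
    by (meson mult_left_mono order_trans)
  then have "chain_dist X P s \<le> eps"
    using chain_dist_le[of s] assms by (simp add: field_simps)
  then have "t_mix X P eps \<le> enat s"
    unfolding t_mix_def by (intro Inf_lower) auto
  then obtain t where "t_mix X P eps = enat t" "t \<le> s"
    using enat_ile by fastforce
  then show ?thesis using s(2) by (intro exI[of _ t]) auto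
qed

end

section \<open>Application to the Metropolis chain on tableaux\<close>

lemma metropolis_off_eq: "metropolis_off lam N k S T F = min (P_SVG lam N k S T) (P_SVG lam N k S F)"
proof -
  have "P_SVG lam N k S T \<ge> 0" "P_SVG lam N k S F \<ge> 0" by (simp_all add: P_SVG_def)
  \<comment> \<open>If \<open>F\<close> has probability 0, the quotient is 0 by convention and both
    sides vanish.\<close>
  then show ?thesis
    by (cases "P_SVG lam N k S F = 0") (auto simp: metropolis_off_def min_def field_simps)
qed

text \<open>Off the diagonal the entry is the smaller of two probabilities. On the diagonal the
  moves to other states use at most the total probability of these states, which leaves at least
  \<open>P_SVG lam N k S T\<close>. For a single state the entry is 1 whatever the algorithm
  returns.\<close>

lemma metropolis_t_mix:
  fixes lam N k S
  defines "X \<equiv> SVT_ext lam N S"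
  assumes X: "finite X" "X \<noteq> {}" and \<delta>: "0 < \<delta>" "\<delta> \<le> 1" and "0 < eps"
    and p: "card X = 1 \<or> (\<forall>T\<in>X. \<delta> / card X \<le> P_SVG lam N k S T)"
  shows "\<exists>t. t_mix X (metropolis lam N k S) eps = enat t \<and> real t \<le> 2 / (\<delta> * eps) + 1"
proof (rule t_mix_le[OF X _ _ _ \<delta> \<open>0 < eps\<close>])
  let ?p = "P_SVG lam N k S"
  have p0: "?p T \<ge> 0" for T by (simp add: P_SVG_def)
  show "metropolis lam N k S T F = metropolis lam N k S F T" for T F
    by (auto simp: metropolis_def metropolis_off_eq min.commute)
  show "(\<Sum>F\<in>X. metropolis lam N k S T F) = 1" if "T \<in> X" for T
  proof -
    have "(\<Sum>F\<in>X. metropolis lam N k S T F)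
        = metropolis lam N k S T T + (\<Sum>F\<in>X - {T}. metropolis lam N k S T F)"
      using X that by (simp add: sum.remove)
    also have "(\<Sum>F\<in>X - {T}. metropolis lam N k S T F) = (\<Sum>F\<in>X - {T}. metropolis_off lam N k S T F)"
      by (intro sum.cong) (auto simp: metropolis_def)
    finally show ?thesis by (simp add: metropolis_def X_def)
  qed
  show "\<delta> / card X \<le> metropolis lam N k S T F" if T: "T \<in> X" "F \<in> X" for T F
  proof (cases "card X = 1")
    case True
    then obtain T0 where "X = {T0}" by (auto simp: card_1_singleton_iff)
    then show ?thesis
      using T \<delta> by (simp add: metropolis_def X_def[symmetric])
  next
    case False
    then have low: "\<delta> / card X \<le> ?p T" if "T \<in> X" for T using p that by blast
    show ?thesis
    proof (cases "F = T")
      case True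
      have "(\<Sum>R\<in>X - {T}. metropolis_off lam N k S T R) \<le> (\<Sum>R\<in>X - {T}. ?p R)"
        by (intro sum_mono) (simp add: metropolis_off_eq)
      moreover have "?p T + (\<Sum>R\<in>X - {T}. ?p R) = sum ?p X"
        using X T by (simp add: sum.remove)
      moreover have "sum ?p X \<le> 1"
      proof -
        have "sum ?p X = measure (measure_pmf (SVGen lam N k S)) X"
          unfolding P_SVG_def using X by (simp add: measure_measure_pmf_finite)
        then show ?thesis by (simp add: measure_pmf.prob_le_1)
      qed
      ultimately have "?p T \<le> metropolis lam N k S T F"
        using True by (simp add: metropolis_def X_def[symmetric])
      then show ?thesis using low[OF T(1)] by linarith
    next
      case False
      then show ?thesis
        using low T by (simp add: metropolis_def metropolis_off_eq)
    qed
  qed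
qed

section \<open>A lower bound for the number of tableaux\<close>

lemma cnt_mono_opt: "finite D \<Longrightarrow> E \<subseteq> D \<Longrightarrow> b \<in> opts D E \<Longrightarrow> cnt D M (E - {b}) \<le> cnt D (Suc M) E"
  using finite_subset[OF opts_subset] by (auto intro: member_le_sum)

text \<open>The first values can be spent on opening the boxes of \<open>E - J\<close>, in an order
  that keeps the empty region an ideal, and every completion from \<open>J\<close> can
  follow.\<close>

lemma cnt_remove_ge:
  assumes "finite D" "young E" "young J" "J \<subseteq> E" "E \<subseteq> D"
  shows "cnt D M J \<le> cnt D (M + (card E - card J)) E"
  using assms(2-5)
proof (induction "card E - card J" arbitrary: E)
  case 0
  then have "J = E"
    using card_seteq[of E J] by (simp add: young_def)
  then show ?case by simp
next
  case (Suc d)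
  have fin: "finite E" using Suc.prems by (simp add: young_def)
  have "E \<noteq> J" using Suc(2) by auto
  then have "E - J \<noteq> {}" using Suc.prems by blast
  then obtain b where b: "b \<in> maxs (E - J)"
    using maxs_nonempty[of "E - J"] fin by auto
  have "b \<in> maxs E"
    unfolding maxs_def
  proof (intro CollectI conjI ballI impI)
    show bE: "b \<in> E" using b by (auto simp: maxs_def)
    fix b' assume b': "b' \<in> E" "b \<le> b'"
    have "b' \<notin> J"
      using b b' bE Suc.prems unfolding young_def maxs_def by blast
    then show "b' = b" using b b' by (auto simp: maxs_def)
  qed
  note bm = this
  have bE: "b \<in> E" "b \<notin> J" using b by (auto simp: maxs_def)
  have c: "card (E - {b}) - card J = d" "card E - card J = Suc d"
    using Suc(2) bE fin by (simp_all add: card_Diff_singleton)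
  have "J \<subseteq> E - {b}" "E - {b} \<subseteq> D" using Suc.prems bE by blast+
  then have "cnt D M J \<le> cnt D (M + d) (E - {b})"
    using Suc(1)[of "E - {b}"] Suc.prems young_remove_max[OF Suc.prems(1) bm] bE c by auto
  also have "\<dots> \<le> cnt D (Suc (M + d)) E"
    using bm Suc.prems assms(1) by (intro cnt_mono_opt) (auto simp: opts_def)
  finally show ?case using c by simp
qed

text \<open>Ideals relative to \<open>Q\<close>. In the application \<open>Q\<close> consists of the
  far parts of the arms and is no ideal of the quadrant unless it is empty.\<close>

definition downset :: "box set \<Rightarrow> box set \<Rightarrow> bool" where
  "downset Q I \<longleftrightarrow> I \<subseteq> Q \<and> (\<forall>b\<in>I. \<forall>b'\<in>Q. b' \<le> b \<longrightarrow> b' \<in> I)"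

lemma downset_remove: "downset Q I \<Longrightarrow> y \<in> maxs I \<Longrightarrow> downset Q (I - {y})"
  unfolding downset_def maxs_def by blast

lemma downset_finite: "finite Q \<Longrightarrow> downset Q I \<Longrightarrow> finite I"
  using finite_subset by (auto simp: downset_def)

lemma maxs_of_young_remove:
  assumes "young (J - {b})" "b \<in> J"  "young J"
  shows "b \<in> maxs J"
proof -
  have "b' = b" if "b' \<in> J" "b \<le> b'" for b'
    using that assms unfolding young_def by blast
  then show ?thesis using assms(2) by (auto simp: maxs_def)
qed

text \<open>While \<open>I\<close> shrinks through downsets of \<open>Q\<close>, a value either
  opens the image of a maximal element of \<open>I\<close> or is one of at least \<open>W\<close>
  additional insertions; Pascal's rule combines the two cases. Once \<open>I\<close> is exhausted,
  the last \<open>card G\<close> values open \<open>G\<close>.\<close>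

lemma cnt_ge:
  assumes D: "finite D" and Q: "finite Q"
    and inj: "inj_on f Q" "f ` Q \<inter> G = {}"
    and good: "\<And>I. downset Q I \<Longrightarrow> young (G \<union> f ` I) \<and> G \<union> f ` I \<subseteq> D \<and> W \<le> card (mins (D - (G \<union> f ` I)))"
    and "downset Q I" "card G + card I \<le> M"
  shows "(M - card G choose card I) * linexts I * W ^ (M - card G - card I) \<le> cnt D M (G \<union> f ` I)"
  using assms(6-)
proof (induction M arbitrary: I)
  case 0
  have "young (G \<union> f ` {})" using good[of "{}"] by (simp add: downset_def)
  then have "finite G" by (simp add: young_def)
  then show ?case using 0 downset_finite[OF Q 0(1)] by simp
next
  case (Suc M)
  let ?J = "G \<union> f ` I" and ?g = "card G"
  have finI: "finite I" using downset_finite[OF Q Suc.prems(1)] .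
  have J: "young ?J" "?J \<subseteq> D" "W \<le> card (mins (D - ?J))"
    using good[OF Suc.prems(1)] by auto
  have IQ: "I \<subseteq> Q" using Suc.prems(1) by (simp add: downset_def)
  have rem: "?J - {f y} = G \<union> f ` (I - {y})" if "y \<in> I" for y
  proof -
    have "f y \<notin> G" using inj(2) that IQ by blast
    moreover have "f ` (I - {y}) = f ` I - {f y}"
      using inj_on_image_set_diff[OF inj(1), of I "{y}"] that IQ by auto
    ultimately show ?thesis by blast
  qed
  have max: "f ` maxs I \<subseteq> maxs ?J"
  proof
    fix b assume "b \<in> f ` maxs I"
    then obtain y where y: "y \<in> maxs I" "b = f y" by blast
    have "y \<in> I" using y maxs_subset by blast
    then show "b \<in> maxs ?J"
      using good[OF downset_remove[OF Suc.prems(1) y(1)]] rem J y by (intro maxs_of_young_remove) auto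
  qed
  have fin: "finite (maxs ?J)" "finite (mins (D - ?J))"
    using J D by (auto simp: young_def finite_maxs intro: finite_subset[OF mins_subset])
  have disj: "maxs ?J \<inter> mins (D - ?J) = {}"
    by (auto simp: maxs_def mins_def)
  have "cnt D (Suc M) ?J = (\<Sum>b\<in>maxs ?J. cnt D M (?J - {b})) + (\<Sum>b\<in>mins (D - ?J). cnt D M (?J - {b}))"
    unfolding cnt.simps opts_def using fin disj by (intro sum.union_disjoint)
  also have "(\<Sum>b\<in>mins (D - ?J). cnt D M (?J - {b})) = card (mins (D - ?J)) * cnt D M ?J"
    using mins_subset by (subst sum.cong[OF refl, of _ _ "\<lambda>_. cnt D M ?J"]) (auto simp: mins_def)
  finally have *: "cnt D (Suc M) ?J = (\<Sum>b\<in>maxs ?J. cnt D M (?J - {b})) + card (mins (D - ?J)) * cnt D M ?J" .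
  have first: "(\<Sum>y\<in>maxs I. cnt D M (G \<union> f ` (I - {y}))) \<le> (\<Sum>b\<in>maxs ?J. cnt D M (?J - {b}))"
  proof -
    have "(\<Sum>y\<in>maxs I. cnt D M (G \<union> f ` (I - {y}))) = (\<Sum>y\<in>maxs I. cnt D M (?J - {f y}))"
    proof (rule sum.cong)
      fix y assume "y \<in> maxs I"
      then have "y \<in> I" using maxs_subset by blast
      then show "cnt D M (G \<union> f ` (I - {y})) = cnt D M (?J - {f y})" by (simp only: rem)
    qed simp
    also have "\<dots> = (\<Sum>b\<in>f ` maxs I. cnt D M (?J - {b}))"
      using inj_on_subset[OF inj(1), of "maxs I"] IQ maxs_subset[of I]
      by (subst sum.reindex) auto
    also have "\<dots> \<le> (\<Sum>b\<in>maxs ?J. cnt D M (?J - {b}))"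
      using max fin by (intro sum_mono2) auto
    finally show ?thesis .
  qed
  have second: "W * cnt D M ?J \<le> card (mins (D - ?J)) * cnt D M ?J"
    using J(3) by simp
  have low: "(Suc M - ?g - 1 choose card I) * linexts I * W ^ (Suc M - ?g - card I) \<le> W * cnt D M ?J"
    if "?g + card I \<le> M"
  proof -
    have "Suc M - ?g - card I = Suc (M - ?g - card I)" using that by simp
    then have "(Suc M - ?g - 1 choose card I) * linexts I * W ^ (Suc M - ?g - card I)
        = W * ((M - ?g choose card I) * linexts I * W ^ (M - ?g - card I))" by simp
    also have "\<dots> \<le> W * cnt D M ?J"
      using Suc.IH[OF Suc.prems(1) that] by (rule mult_left_mono) simp
    finally show ?thesis .
  qed
  show ?case
  proof (cases "I = {}")
    case True
    show ?thesis
    proof (cases "?g \<le> M")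
      case T: True
      then have "(Suc M - ?g choose card I) * linexts I * W ^ (Suc M - ?g - card I) \<le> W * cnt D M ?J"
        using low True by simp
      also note second
      also have "card (mins (D - ?J)) * cnt D M ?J \<le> cnt D (Suc M) ?J"
        unfolding * by simp
      finally show ?thesis .
    next
      case False
      then have g: "Suc M = ?g" using Suc.prems True by simp
      have "young G" "G \<subseteq> D" using J True by auto
      then have "cnt D 0 {} \<le> cnt D ?g G"
        using cnt_remove_ge[OF D, of G "{}" 0] by simp
      then show ?thesis using True g by (simp del: cnt.simps(2))
    qed
  next
    case False
    then obtain i where i: "card I = Suc i" using finI by (metis card_0_eq not0_implies_Suc)
    obtain a where a: "Suc M - ?g = Suc a" "M - ?g = a" "i \<le> a" "?g \<le> M" using Suc.prems(2) i
      by (metis Suc_diff_le add_Suc_right add_leD1 diff_le_mono2 diff_add_inverse diff_le_mono not_less_eq_eq)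
    have "(a choose i) * linexts I * W ^ (a - i) = (\<Sum>y\<in>maxs I. (a choose i) * linexts (I - {y}) * W ^ (a - i))"
      using linexts_rec[OF finI False] by (simp add: sum_distrib_left sum_distrib_right)
    also have "\<dots> \<le> (\<Sum>y\<in>maxs I. cnt D M (G \<union> f ` (I - {y})))"
    proof (rule sum_mono)
      fix y assume y: "y \<in> maxs I"
      then have "card (I - {y}) = i" using i finI maxs_subset[of I] by (auto simp: card_Diff_singleton)
      then show "(a choose i) * linexts (I - {y}) * W ^ (a - i) \<le> cnt D M (G \<union> f ` (I - {y}))"
        using Suc.IH[OF downset_remove[OF Suc.prems(1) y]] Suc.prems(2) i a by simp
    qed
    finally have 1: "(a choose i) * linexts I * W ^ (a - i) \<le> (\<Sum>b\<in>maxs ?J. cnt D M (?J - {b}))"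
      using first by simp
    have 2: "(a choose Suc i) * linexts I * W ^ (a - i) \<le> card (mins (D - ?J)) * cnt D M ?J"
    proof (cases "?g + card I \<le> M")
      case True
      show ?thesis using order_trans[OF low[OF True] second] a i by simp
    next
      case False
      then have "a = i" using a i Suc.prems(2) by linarith
      then show ?thesis by (simp add: binomial_eq_0)
    qed
    have "(Suc M - ?g choose card I) * linexts I * W ^ (Suc M - ?g - card I)
      = (a choose i) * linexts I * W ^ (a - i) + (a choose Suc i) * linexts I * W ^ (a - i)"
      unfolding a i by (simp add: algebra_simps)
    also have "\<dots> \<le> cnt D (Suc M) ?J"
      unfolding * using 1 2 by (rule add_mono)
    finally show ?thesis .
  qed
qed

text \<open>\<open>(k choose n) = k / n * (k - 1 choose n - 1)\<close>, applied \<open>c\<close>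
  times, with each factor bounded by \<open>k\<close>.\<close>

lemma binomial_le_pow_mult: "c \<le> n \<Longrightarrow> n \<le> k \<Longrightarrow> (k choose n) \<le> k ^ c * (k - c choose (n - c))"
proof (induction c)
  case (Suc c)
  then obtain n' k' where n: "n - c = Suc n'" "k - c = Suc k'" "n - Suc c = n'" "k - Suc c = k'"
    by (metis Suc_diff_Suc Suc_le_lessD order_trans)
  have "(Suc k' choose Suc n') \<le> Suc n' * (Suc k' choose Suc n')" by simp
  also have "\<dots> = Suc k' * (k' choose n')" by (rule Suc_times_binomial)
  also have "\<dots> \<le> k * (k' choose n')" using n by (intro mult_right_mono) auto
  finally have "k ^ c * (k - c choose (n - c)) \<le> k ^ c * (k * (k' choose n'))"
    unfolding n by (intro mult_left_mono) auto
  moreover have "(k choose n) \<le> k ^ c * (k - c choose (n - c))"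
    using Suc by simp
  ultimately have "(k choose n) \<le> k ^ c * (k * (k' choose n'))"
    by (rule order_trans[rotated])
  then show ?case unfolding n(3,4) by (simp add: mult_ac)
qed simp

text \<open>If ideals of the form \<open>G \<union> f ` I\<close> all have the maximal number of addable boxes, then the
  set-valued tableaux whose shapes run through these ideals, and whose additional values are inserted
  while they do so, account for a polynomial fraction of the total weight.\<close>

lemma gen_weight_le_cnt:
  assumes D: "finite D" and E: "young E" "E \<subseteq> D" and Q: "Q \<subseteq> E"
    and inj: "inj_on f Q" "f ` Q \<inter> G = {}"
    and good: "\<And>I. downset Q I \<Longrightarrow> young (G \<union> f ` I) \<and> G \<union> f ` I \<subseteq> E \<and> W \<le> card (mins (D - (G \<union> f ` I)))"
    and k: "card E \<le> k" and c: "card (E - Q) \<le> c"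
  shows "gen_weight W k E \<le> real (Suc k) ^ (2 * c) * cnt D k E"
proof -
  let ?n = "card E" and ?q = "card Q" and ?g = "card G" and ?J = "G \<union> f ` Q"
  have fin: "finite E" "finite Q" using E Q finite_subset by (auto simp: young_def)
  have Qd: "downset Q Q" by (simp add: downset_def)
  have J: "young ?J" "?J \<subseteq> E" using good[OF Qd] by auto
  have "finite G" using J by (simp add: young_def)
  then have cJ: "card ?J = ?g + ?q"
    using inj fin by (subst card_Un_disjoint) (auto simp: card_image)
  have le: "?g + ?q \<le> ?n" using card_mono[OF fin(1) J(2)] cJ by simp
  have d: "?n - ?q \<le> c" using c fin Q by (simp add: card_Diff_subset)
  \<comment> \<open>The values above \<open>M\<close> open the boxes of \<open>E\<close> outside
    \<open>?J\<close>; the remaining \<open>M\<close> ones are spent inside the family of good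
    ideals.\<close>
  define M where "M = k - (?n - card ?J)"
  have M: "M - ?g = k - (?n - ?q)" "?g + ?q \<le> M" "M - ?g - ?q = k - ?n" "M + (?n - card ?J) = k"
    using le k by (simp_all add: M_def cJ)
  have "(k - (?n - ?q) choose ?q) * linexts Q * W ^ (k - ?n) \<le> cnt D M ?J"
    using cnt_ge[OF D fin(2) inj _ Qd M(2), of W] good E(2) M(1,3) by (metis order_trans)
  also have "\<dots> \<le> cnt D k E"
    using cnt_remove_ge[OF D E(1) J E(2), of M] M(4) by simp
  finally have 1: "(k - (?n - ?q) choose ?q) * linexts Q * W ^ (k - ?n) \<le> cnt D k E" .
  have "(k choose ?n) \<le> k ^ (?n - ?q) * (k - (?n - ?q) choose ?q)"
    using binomial_le_pow_mult[of "?n - ?q" ?n k] le k by simp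
  moreover have "linexts E \<le> ?n ^ (?n - ?q) * linexts Q"
    using linexts_subset_le fin Q by blast
  ultimately have "(k choose ?n) * linexts E * W ^ (k - ?n) \<le>
      (k ^ (?n - ?q) * (k - (?n - ?q) choose ?q)) * (?n ^ (?n - ?q) * linexts Q) * W ^ (k - ?n)"
    by (intro mult_mono) auto
  also have "\<dots> = (k ^ (?n - ?q) * ?n ^ (?n - ?q)) * ((k - (?n - ?q) choose ?q) * linexts Q * W ^ (k - ?n))"
    by (simp add: mult_ac)
  also have "\<dots> \<le> (Suc k ^ c * Suc k ^ c) * cnt D k E"
  proof (intro mult_mono 1)
    show "k ^ (?n - ?q) \<le> Suc k ^ c" "?n ^ (?n - ?q) \<le> Suc k ^ c"
      using d k by (auto intro!: order_trans[OF power_mono power_increasing] )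
  qed auto
  also have "\<dots> = Suc k ^ (2 * c) * cnt D k E"
    by (simp add: mult_2 power_add)
  finally have "real ((k choose ?n) * linexts E * W ^ (k - ?n)) \<le> real (Suc k ^ (2 * c) * cnt D k E)"
    by (rule of_nat_mono)
  then show ?thesis
    by (simp add: gen_weight_def del: of_nat_Suc)
qed

section \<open>Ideals with many addable boxes\<close>

text \<open>Pigeonhole: the windows \<open>m + 5 * i + 1, ..., m + 5 * i + 5\<close> for
  \<open>i \<le> card V\<close> are disjoint and outnumber the elements of \<open>V\<close>, so one
  of them is free.\<close>

lemma gap_exists:
  fixes V :: "nat set"
  assumes "finite V"
  shows "\<exists>L. m \<le> L \<and> L \<le> m + 5 * card V \<and> (\<forall>v\<in>V. v \<le> L \<or> L + 5 < v)"
proof (rule ccontr)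
  assume "\<not> ?thesis"
  then have "\<forall>i\<in>{..card V}. \<exists>v\<in>V. m + 5 * i < v \<and> v \<le> m + 5 * i + 5"
    by (auto simp: not_le not_less)
  then obtain g where g: "\<And>i. i \<le> card V \<Longrightarrow> g i \<in> V \<and> m + 5 * i < g i \<and> g i \<le> m + 5 * i + 5"
    by (metis atMost_iff)
  have "inj_on g {..card V}"
  proof (rule inj_onI)
    fix i j assume "i \<in> {..card V}" "j \<in> {..card V}" "g i = g j"
    then have "m + 5 * i < g i" "g i \<le> m + 5 * i + 5" "m + 5 * j < g i" "g i \<le> m + 5 * j + 5"
      using g[of i] g[of j] by simp_all
    then show "i = j" by linarith
  qed
  moreover have "g ` {..card V} \<subseteq> V" using g by auto
  ultimately have "card {..card V} \<le> card V"
    using assms card_inj_on_le by blast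
  then show False by simp
qed

text \<open>The numbers to be avoided are the lengths of the first two rows and columns, which gives
  20 = 5 * 4. An arm that reaches beyond \<open>L\<close> at all then has room for the
  shifts.\<close>

lemma young_row_gap:
  assumes "young E"
  shows "\<exists>L. m \<le> L \<and> L \<le> m + 20 \<and> (\<forall>i\<in>{1, 2}. ((i, L + 1) \<in> E \<longrightarrow> (i, L + 5) \<in> E) \<and> ((L + 1, i) \<in> E \<longrightarrow> (L + 5, i) \<in> E))"
proof -
  define \<rho> where "\<rho> i = Max (insert 0 {q. (i, q) \<in> E})" for i
  define \<kappa> where "\<kappa> j = Max (insert 0 {p. (p, j) \<in> E})" for j
  have fin: "finite {q. (i, q) \<in> E}" "finite {p. (p, j) \<in> E}" for i j
    using finite_row[of E i "\<lambda>_. True"] finite_col[of E j "\<lambda>_. True"] assms by (simp_all add: young_def)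
  have in_row: "x \<le> \<rho> i" if "(i, x) \<in> E" for i x
    unfolding \<rho>_def using fin that by (intro Max_ge) auto
  have in_col: "x \<le> \<kappa> i" if "(x, i) \<in> E" for i x
    unfolding \<kappa>_def using fin that by (intro Max_ge) auto
  have row: "(i, x) \<in> E" if "1 \<le> x" "x \<le> \<rho> i" for i x
  proof -
    have "\<rho> i \<in> insert 0 {q. (i, q) \<in> E}" unfolding \<rho>_def using fin by (intro Max_in) auto
    then have "(i, \<rho> i) \<in> E" using that by auto
    then show ?thesis using youngD(2,3)[OF assms, of i "\<rho> i"] that by blast
  qed
  have col: "(x, i) \<in> E" if "1 \<le> x" "x \<le> \<kappa> i" for i x
  proof -
    have "\<kappa> i \<in> insert 0 {p. (p, i) \<in> E}" unfolding \<kappa>_def using fin by (intro Max_in) auto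
    then have "(\<kappa> i, i) \<in> E" using that by auto
    then show ?thesis using youngD(2,3)[OF assms, of "\<kappa> i" i] that by blast
  qed
  obtain L where L: "m \<le> L" "L \<le> m + 5 * card {\<rho> 1, \<rho> 2, \<kappa> 1, \<kappa> 2}"
    "\<forall>v\<in>{\<rho> 1, \<rho> 2, \<kappa> 1, \<kappa> 2}. v \<le> L \<or> L + 5 < v"
    using gap_exists[of "{\<rho> 1, \<rho> 2, \<kappa> 1, \<kappa> 2}" m] by auto
  have "card {\<rho> 1, \<rho> 2, \<kappa> 1, \<kappa> 2} \<le> 4"
    by (auto simp: card_insert_if)
  then have "L \<le> m + 20" using L by linarith
  moreover have "((i, L + 1) \<in> E \<longrightarrow> (i, L + 5) \<in> E) \<and> ((L + 1, i) \<in> E \<longrightarrow> (L + 5, i) \<in> E)" if "i \<in> {1, 2}" for i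
    using in_row[of i "L + 1"] in_col[of "L + 1" i] row[of "L + 5" i] col[of "L + 5" i] L(3) that by fastforce
  ultimately show ?thesis using L(1) by blast
qed

lemma young_le: "young E \<Longrightarrow> b \<in> E \<Longrightarrow> b' \<le> b \<Longrightarrow> b' \<in> {1..} \<times> {1..} \<Longrightarrow> b' \<in> E"
  unfolding young_def by blast

lemma mins_comparable: "b \<in> mins A \<Longrightarrow> b' \<in> mins A \<Longrightarrow> b \<le> b' \<Longrightarrow> b = b'"
  by (auto simp: mins_def)

text \<open>The map \<open>f\<close> is the identity or the transposition, so that arms and legs are treated at once.\<close>

lemma arm_addable:
  fixes f :: "nat \<Rightarrow> nat \<Rightarrow> box"
  assumes f: "\<And>i j i' j'. f i j \<le> f i' j' \<longleftrightarrow> i \<le> i' \<and> j \<le> j'" "\<And>b. \<exists>i j. b = f i j"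
    "\<And>i j. f i j \<in> {1..} \<times> {1..} \<longleftrightarrow> 1 \<le> i \<and> 1 \<le> j"
    and D: "young D" "E \<subseteq> D" and E: "young E" and J: "young J" and I: "downset Q I" "Q \<subseteq> E"
    and Q: "\<And>i j. f i j \<in> E \<Longrightarrow> i \<le> 2 \<Longrightarrow> L + 3 < j \<Longrightarrow> f i j \<in> Q"
    and mem: "\<And>i j. i \<in> {1, 2} \<Longrightarrow> f i (L + 1) \<in> E \<Longrightarrow> L < j \<Longrightarrow> f i j \<in> J \<longleftrightarrow> j \<le> L + 3 - i \<or> f i (j + i) \<in> I"
    and i: "i \<in> {1, 2}" "f i (L + 1) \<in> E" "f i (L + 5) \<in> E"
  shows "\<exists>j>L. f i j \<in> mins (D - J)"
proof -
  have youngE: "f a b \<in> E" if "f a' b' \<in> E" "a \<le> a'" "b \<le> b'" "1 \<le> a" "1 \<le> b" for a b a' b'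
  proof -
    have "f a b \<le> f a' b'" "f a b \<in> {1..} \<times> {1..}" using that f(1,3) by simp_all
    then show ?thesis using young_le[OF E that(1)] by simp
  qed
  have youngJ: "f a b \<in> J" if "f a' b' \<in> J" "a \<le> a'" "b \<le> b'" "1 \<le> a" "1 \<le> b" for a b a' b'
  proof -
    have "f a b \<le> f a' b'" "f a b \<in> {1..} \<times> {1..}" using that f(1,3) by simp_all
    then show ?thesis using young_le[OF J that(1)] by simp
  qed
  have IE: "f a b \<in> I \<Longrightarrow> f a b \<in> E" for a b
    using I by (auto simp: downset_def)
  have fi: "f i' j' = f i'' j'' \<longleftrightarrow> i' = i'' \<and> j' = j''" for i' j' i'' j''
    using f(1) by (metis order_antisym order_refl)
  have "finite {j. f i j \<in> J}"
  proof (rule finite_imageD)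
    show "finite (f i ` {j. f i j \<in> J})"
      by (rule finite_subset[of _ J]) (use J in \<open>auto simp: young_def\<close>)
  qed (simp add: inj_on_def fi)
  then obtain B where B: "\<forall>j\<in>{j. f i j \<in> J}. j \<le> B"
    unfolding finite_nat_set_iff_bounded_le by blast
  have "L < Suc (max L B)" "f i (Suc (max L B)) \<notin> J"
    using B by fastforce+
  \<comment> \<open>The addable box is the first box of line \<open>i\<close> beyond
    \<open>L\<close> that is missing in \<open>J\<close>.\<close>
  then obtain j where j: "L < j" "f i j \<notin> J" "\<And>j'. L < j' \<Longrightarrow> j' < j \<Longrightarrow> f i j' \<in> J"
    using exists_least_iff[of "\<lambda>j. L < j \<and> f i j \<notin> J"] by blast
  have j1: "\<not> j \<le> L + 3 - i" using mem[OF i(1,2) j(1)] j(2) by simp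
  then have "f i (j - 1) \<in> J" using j(3)[of "j - 1"] i(1) by auto
  then have "j - 1 \<le> L + 3 - i \<or> f i (j - 1 + i) \<in> I"
    using mem[OF i(1,2), of "j - 1"] j1 i(1) by auto
  \<comment> \<open>As \<open>i \<ge> 1\<close>, the unshifted position \<open>j - 1 + i\<close> of
    the preceding box is at least \<open>j\<close>, so the arm of \<open>E\<close> reaches the
    candidate.\<close>
  then have "f i j \<in> E"
  proof
    assume "j - 1 \<le> L + 3 - i"
    then show ?thesis using youngE[OF i(3)] i(1) j(1) by auto
  next
    assume "f i (j - 1 + i) \<in> I"
    then show ?thesis using youngE[OF IE] i(1) j(1) by fastforce
  qed
  moreover have "b' = f i j" if b': "b' \<in> D - J" "b' \<le> f i j" for b'
  proof -
    obtain i' j' where ij: "b' = f i' j'" using f(2) by blast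
    have le: "i' \<le> i" "j' \<le> j" using b'(2) unfolding ij f(1) by auto
    have pos: "1 \<le> i'" "1 \<le> j'" using b'(1) D(1) f(3)[of i' j'] ij by (auto simp: young_def)
    show ?thesis
    proof (cases "i' = i")
      case True
      have "j' = j"
      proof (rule ccontr)
        assume "j' \<noteq> j"
        then have "f i (j - 1) \<in> J" "j' \<le> j - 1" using \<open>f i (j - 1) \<in> J\<close> le by auto
        then have "f i j' \<in> J" using youngJ[of i "j - 1" i j'] pos i(1) by auto
        then show False using b' ij True by simp
      qed
      then show ?thesis using ij True by simp
    next
      case False
      then have i2: "i = 2" "i' = 1" using le i(1) pos by auto
      have i1: "f 1 (L + 1) \<in> E" using youngE[OF i(2)] i2 by simp
      have "f 1 j \<in> J"
      proof (cases "j \<le> L + 2")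
        case True
        then show ?thesis using mem[of 1 j] i1 j by simp
      next
        case jl: False
        then have "L < j - 1" "\<not> j - 1 \<le> L + 3 - i" "j - 1 + i = j + 1" using i2 by linarith+
        then have "f 2 (j + 1) \<in> I"
          using \<open>f i (j - 1) \<in> J\<close> mem[OF i(1,2), of "j - 1"] i2 by metis
        moreover from this have "f 1 (j + 1) \<in> E" using youngE[OF IE] by simp
        moreover have "f 1 (j + 1) \<le> f 2 (j + 1)" by (simp add: f(1))
        ultimately have "f 1 (j + 1) \<in> I"
          using I Q[of 1 "j + 1"] jl unfolding downset_def by auto
        then show ?thesis using mem[of 1 j] i1 j by simp
      qed
      then have "f 1 j' \<in> J" using youngJ[of 1 j 1 j'] le pos by simp
      then show ?thesis using b' ij i2 by simp
    qed
  qed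
  ultimately show ?thesis
    using j(1,2) D(2) by (intro exI[of _ j]) (auto simp: mins_def)
qed

text \<open>\<open>W\<close> is the maximal width over the ideals in \<open>E\<close>, attained by
  \<open>Z\<close>. Inside the square of side \<open>L\<close> the new ideals copy \<open>Z\<close>,
  and on each arm they have an addable box of their own. An arm contains at most one addable box of
  \<open>Z\<close>, so matching gives at least \<open>W\<close> of them. The number
  \<open>m + 23\<close> bounds \<open>L + 3\<close>.\<close>

lemma stable_ideals:
  assumes D: "young D" and shape: "\<And>r c. (r, c) \<in> D \<Longrightarrow> r \<le> 2 \<or> c \<le> 2 \<or> (r \<le> m \<and> c \<le> m)"
    and m: "2 \<le> m" and E: "young E" "E \<subseteq> D"
  obtains W Q f G where "width_bound D E W" "Q \<subseteq> E" "card (E - Q) \<le> (m + 23) ^ 2"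
    "inj_on f Q" "f ` Q \<inter> G = {}"
    "\<And>I. downset Q I \<Longrightarrow> young (G \<union> f ` I) \<and> G \<union> f ` I \<subseteq> E \<and> W \<le> card (mins (D - (G \<union> f ` I)))"
proof -
  have finE: "finite E" and finD: "finite D" using E D by (auto simp: young_def)
  define \<C> where "\<C> = {I. I \<subseteq> E \<and> young I}"
  have fC: "finite \<C>" "\<C> \<noteq> {}"
    using finE by (auto simp: \<C>_def intro: exI[of _ "{}"])
  define W where "W = Max ((\<lambda>I. card (mins (D - I))) ` \<C>)"
  have W: "width_bound D E W"
    unfolding width_bound_def W_def using fC by (auto simp: \<C>_def)
  have "W \<in> (\<lambda>I. card (mins (D - I))) ` \<C>"
    unfolding W_def using fC by (intro Max_in) auto
  then obtain Z where Z: "Z \<subseteq> E" "young Z" "W = card (mins (D - Z))"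
    by (auto simp: \<C>_def)
  obtain L where L: "m \<le> L" "L \<le> m + 20"
    and gap: "\<And>i. i \<in> {1, 2} \<Longrightarrow> ((i, L + 1) \<in> E \<longrightarrow> (i, L + 5) \<in> E) \<and> ((L + 1, i) \<in> E \<longrightarrow> (L + 5, i) \<in> E)"
    using young_row_gap[OF E(1), of m] by blast
  \<comment> \<open>\<open>row\<close> and \<open>col\<close> single out the arms: the lines among
    the first two in which \<open>E\<close> reaches beyond \<open>L\<close>.\<close>
  define row where "row r \<longleftrightarrow> r \<in> {1, 2} \<and> (r, L + 1) \<in> E" for r
  define col where "col c \<longleftrightarrow> c \<in> {1, 2} \<and> (L + 1, c) \<in> E" for c
  define Q where "Q = {(r, c). (r, c) \<in> E \<and> (r \<le> 2 \<and> L + 3 < c \<or> c \<le> 2 \<and> L + 3 < r)}"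
  \<comment> \<open>Row \<open>r\<close> moves left by \<open>r\<close> and column \<open>c\<close>
    moves up by \<open>c\<close>. On \<open>Q\<close> the test \<open>L + 3 < c\<close> tells the
    two kinds of arms apart, since boxes of column arms have \<open>c \<le> 2\<close>.\<close>
  define f where "f = (\<lambda>(r, c). if L + 3 < c then (r, c - r) else (r - c, c :: nat))"
  \<comment> \<open>\<open>G\<close> fills the arms exactly up to the point where the images of the
    boxes beyond \<open>L + 3\<close> begin, and keeps the part of \<open>Z\<close> in the
    square.\<close>
  define G where "G = {(r, c). row r \<and> 1 \<le> c \<and> c \<le> L + 3 - r \<or> col c \<and> 1 \<le> r \<and> r \<le> L + 3 - c
    \<or> (r, c) \<in> Z \<and> r \<le> L \<and> c \<le> L}"
  have posE: "1 \<le> r" "1 \<le> c" if "(r, c) \<in> E" for r c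
    using youngD(2)[OF E(1) that] by auto
  have yE: "(r', c') \<in> E" if "(r, c) \<in> E" "1 \<le> r'" "r' \<le> r" "1 \<le> c'" "c' \<le> c" for r c r' c'
    using youngD(3)[OF E(1)] that by blast
  have rowE: "(r, c) \<in> E" if "row r" "1 \<le> c" "c \<le> L + 5" for r c
    using gap[of r] that yE[of r "L + 5" r c] by (auto simp: row_def)
  have colE: "(r, c) \<in> E" if "col c" "1 \<le> r" "r \<le> L + 5" for r c
    using gap[of c] that yE[of "L + 5" c r c] by (auto simp: col_def)
  have row_down: "row r'" if "row r" "1 \<le> r'" "r' \<le> r" for r r'
    using that yE[of r "L + 1" r' "L + 1"] by (auto simp: row_def)
  have col_down: "col c'" if "col c" "1 \<le> c'" "c' \<le> c" for c c'
    using that yE[of "L + 1" c "L + 1" c'] by (auto simp: col_def)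
  have rowI: "row r" if "(r, c) \<in> E" "r \<le> 2" "L < c" for r c
    using posE[OF that(1)] that yE[of r c r "L + 1"] by (auto simp: row_def)
  have colI: "col c" if "(r, c) \<in> E" "c \<le> 2" "L < r" for r c
    using posE[OF that(1)] that yE[of r c "L + 1" c] by (auto simp: col_def)
  have rc: "(r, c) \<in> E \<Longrightarrow> row r \<or> col c \<or> r \<le> L \<and> c \<le> L" for r c
    using shape[of r c] E(2) rowI[of r c] colI[of r c] L m by fastforce
  have Q1: "(r, c) \<in> Q \<Longrightarrow> (row r \<and> L + 3 < c \<and> f (r, c) = (r, c - r)) \<or> (col c \<and> L + 3 < r \<and> \<not> L + 3 < c \<and> f (r, c) = (r - c, c))" for r c
    using rowI[of r c] colI[of r c] L m by (auto simp: Q_def f_def)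
  have r12: "row r \<Longrightarrow> r = 1 \<or> r = 2" "col c \<Longrightarrow> c = 1 \<or> c = 2" for r c
    by (auto simp: row_def col_def)
  have mem: "(r, c) \<in> G \<union> f ` I \<longleftrightarrow>
      row r \<and> 1 \<le> c \<and> (c \<le> L + 3 - r \<or> (r, c + r) \<in> I) \<or> col c \<and> 1 \<le> r \<and> (r \<le> L + 3 - c \<or> (r + c, c) \<in> I)
      \<or> (r, c) \<in> Z \<and> r \<le> L \<and> c \<le> L" if I: "I \<subseteq> Q" for r c I
  proof -
    have "(r, c) \<in> f ` I \<longleftrightarrow> row r \<and> 1 \<le> c \<and> (r, c + r) \<in> I \<or> col c \<and> 1 \<le> r \<and> (r + c, c) \<in> I"
    proof
      assume "(r, c) \<in> f ` I"
      then obtain r' c' where *: "(r', c') \<in> I" "(r, c) = f (r', c')" by (metis imageE surj_pair)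
      have "(r', c') \<in> Q" using *(1) I by blast
      from Q1[OF this] show "row r \<and> 1 \<le> c \<and> (r, c + r) \<in> I \<or> col c \<and> 1 \<le> r \<and> (r + c, c) \<in> I"
      proof
        assume a: "row r' \<and> L + 3 < c' \<and> f (r', c') = (r', c' - r')"
        then have "r = r'" "c + r' = c'" "1 \<le> c" using *(2) r12(1)[of r'] L m by auto
        then show ?thesis using a *(1) by simp
      next
        assume a: "col c' \<and> L + 3 < r' \<and> \<not> L + 3 < c' \<and> f (r', c') = (r' - c', c')"
        then have "c = c'" "r + c' = r'" "1 \<le> r" using *(2) r12(2)[of c'] L m by auto
        then show ?thesis using a *(1) by simp
      qed
    next
      assume "row r \<and> 1 \<le> c \<and> (r, c + r) \<in> I \<or> col c \<and> 1 \<le> r \<and> (r + c, c) \<in> I"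
      then show "(r, c) \<in> f ` I"
      proof
        assume *: "row r \<and> 1 \<le> c \<and> (r, c + r) \<in> I"
        then have "(r, c + r) \<in> Q" using I by blast
        then have "f (r, c + r) = (r, c)"
          using Q1[of r "c + r"] r12(1)[of r] * L m by auto
        then show ?thesis using * by (metis imageI)
      next
        assume *: "col c \<and> 1 \<le> r \<and> (r + c, c) \<in> I"
        then have "(r + c, c) \<in> Q" using I by blast
        then have "f (r + c, c) = (r, c)"
          using Q1[of "r + c" c] r12(2)[of c] * L m by auto
        then show ?thesis using * by (metis imageI)
      qed
    qed
    then show ?thesis by (auto simp: G_def)
  qed
  have QE: "Q \<subseteq> E" by (auto simp: Q_def)
  have "E - Q \<subseteq> {1..L + 3} \<times> {1..L + 3}"
    using posE shape E(2) L m unfolding Q_def by fastforce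
  then have "card (E - Q) \<le> card ({1..L + 3} \<times> {1..L + 3})"
    by (intro card_mono) auto
  also have "\<dots> = (L + 3) ^ 2" by (simp add: power2_eq_square add.commute)
  also have "\<dots> \<le> (m + 23) ^ 2" using L by (intro power_mono) auto
  finally have cQ: "card (E - Q) \<le> (m + 23) ^ 2" .
  have inj: "inj_on f Q"
  proof (rule inj_onI)
    fix x y assume xy: "x \<in> Q" "y \<in> Q" "f x = f y"
    obtain r c r' c' where x: "x = (r, c)" "y = (r', c')" by (cases x, cases y) auto
    show "x = y"
      using Q1[of r c] Q1[of r' c'] xy r12[of r] r12[of r'] r12(2)[of c] r12(2)[of c'] L m unfolding x by auto
  qed
  have disj: "f ` Q \<inter> G = {}"
  proof -
    have "f (r, c) \<notin> G" if "(r, c) \<in> Q" for r c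
      using Q1[OF that] r12(1)[of r] r12(2)[of c] L m by (auto simp: G_def dest: r12)
    then show ?thesis by auto
  qed
  have good: "young (G \<union> f ` I) \<and> G \<union> f ` I \<subseteq> E \<and> W \<le> card (mins (D - (G \<union> f ` I)))"
    if I: "downset Q I" for I
  proof -
    let ?J = "G \<union> f ` I"
    have IQ: "I \<subseteq> Q" using I by (simp add: downset_def)
    have IE: "(r, c) \<in> E" if "(r, c) \<in> I" for r c using IQ QE that by auto
    have JE: "?J \<subseteq> E"
    proof (rule subsetI)
      fix b assume b: "b \<in> ?J"
      obtain r c where rc': "b = (r, c)" by fastforce
      show "b \<in> E"
        using b Z(1) IE[of r "c + r"] IE[of "r + c" c] rowE[of r c] colE[of c r] yE[of r "c + r" r c] yE[of "r + c" c r c] r12[of r] r12(2)[of c]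
        unfolding rc' mem[OF IQ] by auto
    qed
    have Idown: "(r', c') \<in> I" if "(r, c) \<in> I" "(r', c') \<in> Q" "r' \<le> r" "c' \<le> c" for r c r' c'
      using I that unfolding downset_def by auto
    have J: "young ?J"
      unfolding young_def
    proof (intro conjI ballI impI)
      show "finite ?J" using JE finE finite_subset by blast
      show "?J \<subseteq> {1..} \<times> {1..}" using JE E(1) by (auto simp: young_def)
      fix b b' :: box
      assume b: "b \<in> ?J" "b' \<in> {1..} \<times> {1..}" "b' \<le> b"
      obtain r c r' c' where bb: "b = (r, c)" "b' = (r', c')" by (cases b, cases b') auto
      have le: "1 \<le> r'" "1 \<le> c'" "r' \<le> r" "c' \<le> c" using b(2,3) unfolding bb by auto
      from b(1) consider "row r" "c \<le> L + 3 - r" | "row r" "(r, c + r) \<in> I"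
        | "col c" "r \<le> L + 3 - c" | "col c" "(r + c, c) \<in> I" | "(r, c) \<in> Z" "r \<le> L" "c \<le> L"
        unfolding bb mem[OF IQ] by blast
      then show "b' \<in> ?J"
      proof cases
        case 1
        then have "c' \<le> L + 3 - r'" using le by linarith
        then show ?thesis unfolding bb mem[OF IQ] using row_down[OF 1(1) le(1,3)] le(2) by simp
      next
        case 2
        have "(r', c' + r') \<in> E" using yE[OF IE[OF 2(2)], of r' "c' + r'"] le by simp
        have "r' \<le> 2" using le r12(1)[OF 2(1)] by auto
        have "(r', c' + r') \<in> I" if "L + 3 < c' + r'"
          using Idown[OF 2(2), of r' "c' + r'"] le that \<open>(r', c' + r') \<in> E\<close> \<open>r' \<le> 2\<close> by (simp add: Q_def)
        then have "c' \<le> L + 3 - r' \<or> (r', c' + r') \<in> I"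
          by linarith
        then show ?thesis unfolding bb mem[OF IQ] using row_down[OF 2(1) le(1,3)] le(2) by simp
      next
        case 3
        then have "r' \<le> L + 3 - c'" using le by linarith
        then show ?thesis unfolding bb mem[OF IQ] using col_down[OF 3(1) le(2,4)] le(1) by simp
      next
        case 4
        have "(r' + c', c') \<in> E" using yE[OF IE[OF 4(2)], of "r' + c'" c'] le by simp
        have "c' \<le> 2" using le r12(2)[OF 4(1)] by auto
        have "(r' + c', c') \<in> I" if "L + 3 < r' + c'"
          using Idown[OF 4(2), of "r' + c'" c'] le that \<open>(r' + c', c') \<in> E\<close> \<open>c' \<le> 2\<close> by (simp add: Q_def)
        then have "r' \<le> L + 3 - c' \<or> (r' + c', c') \<in> I"
          by linarith
        then show ?thesis unfolding bb mem[OF IQ] using col_down[OF 4(1) le(2,4)] le(1) by simp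
      next
        case 5
        then have "(r', c') \<in> Z" using youngD(3)[OF Z(2)] le by blast
        then show ?thesis unfolding bb mem[OF IQ] using 5 le by simp
      qed
    qed
    have memr: "(r, c) \<in> ?J \<longleftrightarrow> c \<le> L + 3 - r \<or> (r, c + r) \<in> I" if "row r" "L < c" for r c
      unfolding mem[OF IQ] using that L m r12(2)[of c] by auto
    have memc: "(r, c) \<in> ?J \<longleftrightarrow> r \<le> L + 3 - c \<or> (r + c, c) \<in> I" if "col c" "L < r" for r c
      unfolding mem[OF IQ] using that L m r12(1)[of r] by auto
    have "\<exists>c>L. (r, c) \<in> mins (D - ?J)" if "row r" for r
    proof (rule arm_addable[of Pair D E ?J Q I L r, OF _ _ _ D E(2) E(1) J I QE])
      show "(i, j) \<in> Q" if "(i, j) \<in> E" "i \<le> 2" "L + 3 < j" for i j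
        using that by (simp add: Q_def)
      show "(i, j) \<in> ?J \<longleftrightarrow> j \<le> L + 3 - i \<or> (i, j + i) \<in> I" if "i \<in> {1, 2}" "(i, L + 1) \<in> E" "L < j" for i j
        by (rule memr) (use that in \<open>simp_all add: row_def\<close>)
      show "r \<in> {1, 2}" "(r, L + 1) \<in> E" "(r, L + 5) \<in> E"
        using \<open>row r\<close> gap[of r] by (simp_all add: row_def)
    qed auto
    then obtain x where x: "\<And>r. row r \<Longrightarrow> L < x r \<and> (r, x r) \<in> mins (D - ?J)" by metis
    have "\<exists>r>L. (r, c) \<in> mins (D - ?J)" if "col c" for c
    proof (rule arm_addable[of "\<lambda>i j. (j, i)" D E ?J Q I L c, OF _ _ _ D E(2) E(1) J I QE])
      show "(j, i) \<in> Q" if "(j, i) \<in> E" "i \<le> 2" "L + 3 < j" for i j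
        using that by (simp add: Q_def)
      show "(j, i) \<in> ?J \<longleftrightarrow> j \<le> L + 3 - i \<or> (j + i, i) \<in> I" if "i \<in> {1, 2}" "(L + 1, i) \<in> E" "L < j" for i j
        by (rule memc) (use that in \<open>simp_all add: col_def\<close>)
      show "c \<in> {1, 2}" "(L + 1, c) \<in> E" "(L + 5, c) \<in> E"
        using \<open>col c\<close> gap[of c] by (simp_all add: col_def)
    qed auto
    then obtain y where y: "\<And>c. col c \<Longrightarrow> L < y c \<and> (y c, c) \<in> mins (D - ?J)" by metis
    \<comment> \<open>Addable boxes of \<open>Z\<close> in arm lines are matched with the new ones
      on these arms; all others remain addable. Injectivity holds since the boxes of an antichain
      lie in distinct rows and in distinct columns.\<close>
    define g where "g = (\<lambda>(r, c). if row r then (r, x r) else if col c then (y c, c) else (r, c))"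
    have rest: "(r, c) \<in> mins (D - ?J)" if b: "(r, c) \<in> mins (D - Z)" "\<not> row r" "\<not> col c" for r c
    proof -
      have bD: "(r, c) \<in> D" "(r, c) \<notin> Z" using b(1) by (auto simp: mins_def)
      have minZ: "(r', c') \<in> Z" if "(r', c') \<in> D" "r' \<le> r" "c' \<le> c" "(r', c') \<noteq> (r, c)" for r' c'
      proof (rule ccontr)
        assume "(r', c') \<notin> Z"
        then have "(r', c') \<in> D - Z" "(r', c') \<le> (r, c)" using that by auto
        then show False using b(1) that(4) unfolding mins_def by blast
      qed
      have pos: "1 \<le> r" "1 \<le> c" using youngD(2)[OF D bD(1)] by auto
      \<comment> \<open>Otherwise \<open>(r, c - 1)\<close> would be a box of \<open>Z\<close>,
        hence of \<open>E\<close>, beyond column \<open>L\<close>, and \<open>r\<close> would be an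
        arm row.\<close>
      have "c \<le> L + 1"
      proof (rule ccontr)
        assume c: "\<not> c \<le> L + 1"
        then have "(r, c - 1) \<in> D" using youngD(3)[OF D bD(1), of r "c - 1"] pos by auto
        then have "(r, c - 1) \<in> E" using minZ[of r "c - 1"] pos Z(1) by auto
        moreover have "r \<le> 2" using shape[OF bD(1)] c L m by auto
        moreover have "L < c - 1" using c by linarith
        ultimately show False using rowI[of r "c - 1"] b(2) by blast
      qed
      moreover have "r \<le> L + 1"
      proof (rule ccontr)
        assume r: "\<not> r \<le> L + 1"
        then have "(r - 1, c) \<in> D" using youngD(3)[OF D bD(1), of "r - 1" c] pos by auto
        then have "(r - 1, c) \<in> E" using minZ[of "r - 1" c] pos Z(1) by auto
        moreover have "c \<le> 2" using shape[OF bD(1)] r L m by auto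
        moreover have "L < r - 1" using r by linarith
        ultimately show False using colI[of "r - 1" c] b(3) by blast
      qed
      ultimately have le: "r \<le> L + 1" "c \<le> L + 1" by auto
      have "(r, c) \<notin> ?J" unfolding mem[OF IQ] using b bD by auto
      moreover have "(r', c') = (r, c)" if b': "(r', c') \<in> D - ?J" "r' \<le> r" "c' \<le> c" for r' c'
      proof (rule ccontr)
        assume "(r', c') \<noteq> (r, c)"
        then have "(r', c') \<in> Z" using minZ b' by blast
        moreover from this have "(r', c') \<in> E" using Z by blast
        moreover note rc[OF this] posE[OF this]
        ultimately have "(r', c') \<in> ?J"
          unfolding mem[OF IQ] using le b' r12(1)[of r'] r12(2)[of c'] by auto
        then show False using b' by simp
      qed
      ultimately show ?thesis using bD by (auto simp: mins_def)
    qed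
    have "g ` mins (D - Z) \<subseteq> mins (D - ?J)"
    proof
      fix b assume "b \<in> g ` mins (D - Z)"
      then obtain r c where "(r, c) \<in> mins (D - Z)" "b = g (r, c)" by (metis imageE surj_pair)
      then show "b \<in> mins (D - ?J)" using x[of r] y[of c] rest[of r c] by (simp add: g_def)
    qed
    moreover have "inj_on g (mins (D - Z))"
    proof (rule inj_onI)
      fix b b' assume b: "b \<in> mins (D - Z)" "b' \<in> mins (D - Z)" "g b = g b'"
      obtain r c r' c' where bb: "b = (r, c)" "b' = (r', c')" by (cases b, cases b') auto
      have row_eq: "b = b'" if "r = r'"
        using mins_comparable[OF b(1,2)] mins_comparable[OF b(2,1)] that unfolding bb by (cases "c \<le> c'") auto
      have col_eq: "b = b'" if "c = c'"
        using mins_comparable[OF b(1,2)] mins_comparable[OF b(2,1)] that unfolding bb by (cases "r \<le> r'") auto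
      have rx: "r \<le> 2" "2 < x r" if "row r" for r using that r12(1)[OF that] x[OF that] L m by auto
      have cy: "c \<le> 2" "2 < y c" if "col c" for c using that r12(2)[OF that] y[OF that] L m by auto
      have g_eq: "g (r, c) = g (r', c')" using b(3) bb by simp
      consider "row r" | "\<not> row r" "col c" | "\<not> row r" "\<not> col c" by blast
      then show "b = b'"
      proof cases
        case 1
        then have "r = r'"
          using g_eq rx[OF 1] cy[of c'] by (cases "row r'"; cases "col c'") (auto simp: g_def)
        then show ?thesis by (rule row_eq)
      next
        case 2
        then have "c = c'"
          using g_eq cy[OF 2(2)] rx[of r'] by (cases "row r'"; cases "col c'") (auto simp: g_def)
        then show ?thesis by (rule col_eq)
      next
        case 3
        then show ?thesis
          using g_eq bb by (cases "row r'"; cases "col c'") (auto simp: g_def)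
      qed
    qed
    moreover have "finite (mins (D - ?J))"
      using finD finite_subset[OF mins_subset] by blast
    ultimately have "W \<le> card (mins (D - ?J))"
      unfolding Z(3) using card_inj_on_le by blast
    then show ?thesis using J JE by blast
  qed
  show thesis
    by (rule that[OF W QE cQ inj disj good])
qed

section \<open>Rapid mixing\<close>

text \<open>The binomial theorem provides the explicit coefficients that \<open>poly3\<close> asks
  for, so bounds can be proved in product form.\<close>

lemma poly3_binomial:
  "poly3 d (\<lambda>i j l. C * real (d choose i) * real (d choose j) * real (d choose l)) x y z
    = C * (1 + x) ^ d * (1 + y) ^ d * (1 + z) ^ d"
proof -
  have b: "(1 + x) ^ d = (\<Sum>i\<le>d. real (d choose i) * x ^ i)" for x :: real
    using binomial_ring[of x 1 d] by (simp add: add.commute)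
  have "poly3 d (\<lambda>i j l. C * real (d choose i) * real (d choose j) * real (d choose l)) x y z
    = (\<Sum>i\<le>d. (C * (real (d choose i) * x ^ i)) * (\<Sum>j\<le>d. (real (d choose j) * y ^ j) * (\<Sum>l\<le>d. real (d choose l) * z ^ l)))"
    unfolding poly3_def sum_distrib_left by (intro sum.cong refl) (simp add: mult_ac)
  also have "\<dots> = C * (1 + x) ^ d * ((1 + y) ^ d * (1 + z) ^ d)"
    unfolding sum_distrib_right[symmetric] b[symmetric] by (simp add: sum_distrib_left[symmetric] flip: b)
  finally show ?thesis by (simp add: mult.assoc)
qed

text \<open>A partition of rank less than three lacks the box \<open>(3, 3)\<close>, hence every box
  with both coordinates above 2.\<close>

lemma rect_family_shape:
  assumes "(lam, N, S) \<in> rect_family p q"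
  shows "young (diagram lam)"
    and "(r, c) \<in> diagram lam \<Longrightarrow> r \<le> 2 \<or> c \<le> 2 \<or> r \<le> q \<and> c \<le> p"
proof -
  obtain lam0 where lam: "is_partition lam" and lam0: "is_partition lam0" "diag_rank lam0 < 3"
    "diagram lam \<subseteq> diagram (replicate q p) \<union> diagram lam0"
    using assms by (auto simp: rect_family_def SVT_triples_def)
  show "young (diagram lam)" using young_diagram lam .
  have y: "young (diagram lam0)" using young_diagram lam0(1) .
  have "(3, 3) \<notin> diagram lam0"
  proof
    assume 3: "(3, 3) \<in> diagram lam0"
    have "{1, 2, 3} \<subseteq> {i. (i, i) \<in> diagram lam0}"
      using youngD(3)[OF y 3] by auto
    moreover have "finite {i. (i, i) \<in> diagram lam0}"
      by (rule finite_subset[of _ "fst ` diagram lam0"]) (use y in \<open>force simp: young_def\<close>)+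
    ultimately have "card {1, 2, 3 :: nat} \<le> diag_rank lam0"
      unfolding diag_rank_def by (intro card_mono)
    then show False using lam0(2) by simp
  qed
  then have "(r, c) \<in> diagram lam0 \<Longrightarrow> r \<le> 2 \<or> c \<le> 2"
    using youngD(3)[OF y, of r c 3 3] by fastforce
  moreover have "(r, c) \<in> diagram (replicate q p) \<Longrightarrow> r \<le> q \<and> c \<le> p"
    by (auto simp: diagram_def)
  ultimately show "(r, c) \<in> diagram lam \<Longrightarrow> r \<le> 2 \<or> c \<le> 2 \<or> r \<le> q \<and> c \<le> p"
    using lam0(3) by blast
qed

lemma rapidly_mixing_rect_family: "rapidly_mixing (rect_family p q)"
proof -
  define m where "m = max 2 (max p q)"
  \<comment> \<open>The exponent comes from \<open>gen_weight_le_cnt\<close> with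
    \<open>card (E - Q) \<le> (m + 23) ^ 2\<close>. Taking \<open>m \<ge> 2\<close> keeps the
    crossings of the two rows and columns inside the square.\<close>
  define d where "d = 2 * (m + 23) ^ 2"
  show ?thesis
    unfolding rapidly_mixing_def
  proof (intro exI[of _ d] exI[of _ "\<lambda>i j l. 3 * real (d choose i) * real (d choose j) * real (d choose l)"]
      ballI, clarify)
    fix lam N S k and eps :: real
    assume fam: "(lam, N, S) \<in> rect_family p q" and k: "pretableau lam N k S"
      and ne: "SVT_ext lam N S \<noteq> {}" and eps: "0 < eps"
    let ?D = "diagram lam" and ?X = "SVT_ext lam N S"
    define E where "E = empt ?D S"
    have D: "young ?D" using rect_family_shape(1)[OF fam] .
    have finD: "finite ?D" using D by (simp add: young_def)
    have X: "?X = completions ?D N k S" using SVT_ext_eq[OF D k] .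
    have kN: "k \<le> N" using k by (simp add: pretableau_def)
    obtain T0 where T0: "T0 \<in> completions ?D N k S" using ne X by blast
    have pt: "ptab ?D N k S" using ptab_of_completions[OF T0] .
    have cE: "card E \<le> k" using card_empt_le[OF finD T0 kN] by (simp add: E_def)
    have E: "young E" "E \<subseteq> ?D" using young_empt[OF D pt] empt_subset by (auto simp: E_def)
    have cX: "finite ?X" "card ?X = cnt ?D k E"
      using card_completions[OF finD pt kN] by (auto simp: X E_def)
    obtain W Q f G where W: "width_bound ?D E W" and Q: "Q \<subseteq> E" "card (E - Q) \<le> (m + 23) ^ 2"
      "inj_on f Q" "f ` Q \<inter> G = {}"
      "\<And>I. downset Q I \<Longrightarrow> young (G \<union> f ` I) \<and> G \<union> f ` I \<subseteq> E \<and> W \<le> card (mins (?D - (G \<union> f ` I)))"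
    proof (rule stable_ideals[OF D _ _ E])
      show "(r, c) \<in> ?D \<Longrightarrow> r \<le> 2 \<or> c \<le> 2 \<or> r \<le> m \<and> c \<le> m" for r c
        using rect_family_shape(2)[OF fam, of r c] by (auto simp: m_def)
    qed (auto simp: m_def)
    have gw: "gen_weight W k E \<le> real (Suc k) ^ d * card ?X"
      using gen_weight_le_cnt[OF finD E Q(1,3,4,5) cE Q(2)] by (simp add: cX d_def)
    define \<delta> where "\<delta> = 1 / real (Suc k) ^ d"
    have \<delta>: "0 < \<delta>" "\<delta> \<le> 1" by (simp_all add: \<delta>_def one_le_power del: of_nat_Suc)
    have p: "card ?X = 1 \<or> (\<forall>T\<in>?X. \<delta> / card ?X \<le> P_SVG lam N k S T)"
    proof (cases "N = 0")
      \<comment> \<open>With \<open>N = 0\<close> the diagram is empty and \<open>SVGen\<close>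
        would call \<open>Hook\<close> on it; but then there is only one state.\<close>
      case True
      have "T = T0" if "T \<in> ?X" for T
      proof
        fix b
        have "ptab ?D 0 0 T" "ptab ?D 0 0 T0"
          using that T0 True unfolding X completions_def by auto
        then show "T b = T0 b"
          using ptabD(2)[of ?D 0 0 T b] ptabD(2)[of ?D 0 0 T0 b] by simp
      qed
      then have "?X = {T0}" using T0 X by blast
      then show ?thesis by simp
    next
      case False
      have "\<delta> / card ?X \<le> P_SVG lam N k S T" if T: "T \<in> ?X" for T
      proof -
        have "1 \<le> P_SVG lam N k S T * gen_weight W k E"
          using P_SVG_ge[OF D T[unfolded X] kN _ W[unfolded E_def]] False by (simp add: E_def)
        also have "\<dots> \<le> P_SVG lam N k S T * (real (Suc k) ^ d * card ?X)"
          by (intro mult_left_mono gw) (simp add: P_SVG_def)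
        finally have *: "1 \<le> P_SVG lam N k S T * (real (Suc k) ^ d * card ?X)" .
        have "0 < real (Suc k) ^ d" "0 < real (card ?X)"
          using cX(1) ne by (simp_all add: card_gt_0_iff del: of_nat_Suc)
        then show ?thesis using * by (simp add: \<delta>_def field_simps del: of_nat_Suc)
      qed
      then show ?thesis by blast
    qed
    obtain t where t: "t_mix ?X (metropolis lam N k S) eps = enat t" "real t \<le> 2 / (\<delta> * eps) + 1"
      using metropolis_t_mix[OF cX(1) ne \<delta> eps p] by blast
    let ?n = "real (card (empty_boxes lam S))" and ?K = "real (Suc k) ^ d" and ?e = "1 + 1 / eps"
    have d: "d \<ge> 1" by (simp add: d_def)
    have e: "1 \<le> ?e" "1 / eps \<le> ?e" using eps by simp_all
    have K: "1 \<le> ?K" by (simp add: one_le_power del: of_nat_Suc)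
    have "2 / (\<delta> * eps) + 1 = 2 * ?K * (1 / eps) + 1"
      by (simp add: \<delta>_def)
    also have "\<dots> \<le> 2 * ?K * ?e + ?K * ?e"
      using e K eps mult_mono[OF K e(1)] by (intro add_mono mult_left_mono) auto
    also have "\<dots> = 3 * ?e * 1 * ?K" by simp
    also have "\<dots> \<le> 3 * ?e ^ d * (1 + ?n) ^ d * ?K"
      using e(1) K self_le_power[OF e(1), of d] d
      by (intro mult_mono) (auto simp: one_le_power intro!: mult_nonneg_nonneg)
    finally have "real t \<le> 3 * ?e ^ d * (1 + ?n) ^ d * ?K" using t(2) by simp
    then show "\<exists>t. t_mix ?X (metropolis lam N k S) eps = enat t \<and> real t \<le>
        poly3 d (\<lambda>i j l. 3 * real (d choose i) * real (d choose j) * real (d choose l)) (1 / eps) ?n (real k)"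
      using t(1) unfolding poly3_binomial by (intro exI[of _ t]) simp
  qed
qed

section \<open>Timed Hoare logic\<close>

lemma run_Skip [simp]: "run n (Skip, m) = return_pmf (Skip, m)"
  by (induction n) (simp_all add: bind_return_pmf)

lemma run_add: "run (a + b) s = bind_pmf (run a s) (run b)"
proof (induction a arbitrary: s)
  case (Suc a)
  have "run (a + b) = (\<lambda>s. bind_pmf (run a s) (run b))" using Suc by blast
  then show ?case by (simp add: bind_assoc_pmf)
qed (simp add: bind_return_pmf)

definition halted :: "(com \<times> mem) pmf \<Rightarrow> bool" where
  "halted p \<longleftrightarrow> (\<forall>s\<in>set_pmf p. fst s = Skip)"

text \<open>\<open>Skip\<close> is a fixed point of \<open>run\<close>, so running times may be
  overestimated.\<close>

lemma run_halted_mono: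
  assumes "halted (run t s)" "t \<le> t'"
  shows "run t' s = run t s"
proof -
  have "run t' s = bind_pmf (run t s) (run (t' - t))"
    using run_add[of t "t' - t" s] assms(2) by simp
  also have "\<dots> = bind_pmf (run t s) return_pmf"
  proof (rule bind_pmf_cong)
    fix x assume "x \<in> set_pmf (run t s)"
    then have "x = (Skip, snd x)" using assms(1) by (cases x) (auto simp: halted_def)
    then show "run (t' - t) x = return_pmf x" by (metis run_Skip)
  qed simp
  finally show ?thesis by (simp add: bind_return_pmf')
qed

text \<open>The additional step discards the \<open>Skip\<close> left by \<open>c1\<close>. The
  bound \<open>t2\<close> has to serve all outcomes of \<open>c1\<close>, which may be
  random.\<close>

lemma run_Seq:
  assumes "halted (run t (c1, m))" "\<And>m'. (Skip, m') \<in> set_pmf (run t (c1, m)) \<Longrightarrow> halted (run t2 (c2, m'))"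
  shows "run (t + 1 + t2) (Seq c1 c2, m) = bind_pmf (run t (c1, m)) (\<lambda>s. run t2 (c2, snd s))"
  using assms
proof (induction t arbitrary: c1 m)
  case 0
  then have "c1 = Skip" by (simp add: halted_def)
  then show ?case by (simp add: bind_return_pmf)
next
  case (Suc t)
  show ?case
  proof (cases "c1 = Skip")
    case True
    then have "halted (run t2 (c2, m))" using Suc.prems(2)[of m] by (simp add: bind_return_pmf)
    then have "run (t + 1 + t2) (c2, m) = run t2 (c2, m)" by (rule run_halted_mono) simp
    then show ?thesis using True by (simp add: bind_return_pmf)
  next
    case False
    have "run (Suc t + 1 + t2) (Seq c1 c2, m) = bind_pmf (step c1 m) (\<lambda>s. run (t + 1 + t2) (Seq (fst s) c2, snd s))"
      using False by (simp add: bind_map_pmf case_prod_unfold)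
    also have "\<dots> = bind_pmf (step c1 m) (\<lambda>s. bind_pmf (run t s) (\<lambda>s. run t2 (c2, snd s)))"
    proof (rule bind_pmf_cong)
      fix s assume s: "s \<in> set_pmf (step c1 m)"
      have "run (t + 1 + t2) (Seq (fst s) c2, snd s) = bind_pmf (run t (fst s, snd s)) (\<lambda>s. run t2 (c2, snd s))"
        using s Suc.prems by (intro Suc.IH) (auto simp: halted_def)
      then show "run (t + 1 + t2) (Seq (fst s) c2, snd s) = bind_pmf (run t s) (\<lambda>s. run t2 (c2, snd s))"
        by simp
    qed simp
    finally show ?thesis by (simp add: bind_assoc_pmf)
  qed
qed

text \<open>Total correctness of deterministic code: the outcome is a point distribution, and by
  \<open>run_halted_mono\<close> the number \<open>t\<close> is an upper bound for the steps
  used.\<close>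

definition triple :: "(mem \<Rightarrow> bool) \<Rightarrow> com \<Rightarrow> nat \<Rightarrow> (mem \<Rightarrow> bool) \<Rightarrow> bool" where
  "triple P c t Q \<longleftrightarrow> (\<forall>m. P m \<longrightarrow> (\<exists>m'. run t (c, m) = return_pmf (Skip, m') \<and> Q m'))"

lemma tripleI: "(\<And>m. P m \<Longrightarrow> \<exists>m'. run t (c, m) = return_pmf (Skip, m') \<and> Q m') \<Longrightarrow> triple P c t Q"
  by (simp add: triple_def)

lemma tripleE:
  assumes "triple P c t Q" "P m"
  obtains m' where "run t (c, m) = return_pmf (Skip, m')" "Q m'"
  using assms unfolding triple_def by blast

lemma triple_mono:
  assumes "triple P c t Q" "\<And>m. P' m \<Longrightarrow> P m" "\<And>m. Q m \<Longrightarrow> Q' m" "t \<le> t'"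
  shows "triple P' c t' Q'"
proof (rule tripleI)
  fix m assume "P' m"
  then obtain m' where m': "run t (c, m) = return_pmf (Skip, m')" "Q m'"
    using assms(1,2) by (meson tripleE)
  then have "run t' (c, m) = return_pmf (Skip, m')"
    using run_halted_mono[of t "(c, m)" t'] assms(4) by (simp add: halted_def)
  then show "\<exists>m'. run t' (c, m) = return_pmf (Skip, m') \<and> Q' m'" using m' assms(3) by blast
qed

lemma triple_Seq:
  assumes "triple P c1 t1 Q" "triple Q c2 t2 R"
  shows "triple P (Seq c1 c2) (t1 + 1 + t2) R"
proof (rule tripleI)
  fix m assume "P m"
  then obtain m1 where 1: "run t1 (c1, m) = return_pmf (Skip, m1)" "Q m1" using assms(1) by (meson tripleE)
  then obtain m2 where 2: "run t2 (c2, m1) = return_pmf (Skip, m2)" "R m2" using assms(2) by (meson tripleE)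
  have "run (t1 + 1 + t2) (Seq c1 c2, m) = return_pmf (Skip, m2)"
    by (subst run_Seq) (simp_all add: 1 2 halted_def bind_return_pmf)
  then show "\<exists>m'. run (t1 + 1 + t2) (Seq c1 c2, m) = return_pmf (Skip, m') \<and> R m'" using 2 by blast
qed

section \<open>Straight-line code\<close>

primrec loop_free :: "com \<Rightarrow> bool" where
  "loop_free Skip = True"
| "loop_free (Assign x es e) = True"
| "loop_free (Choose x es e) = False"
| "loop_free (Seq c1 c2) = (loop_free c1 \<and> loop_free c2)"
| "loop_free (Cond e c1 c2) = (loop_free c1 \<and> loop_free c2)"
| "loop_free (While e c) = False"

text \<open>The values at \<open>Choose\<close> and \<open>While\<close> are placeholders that keep
  the function total; \<open>loop_free\<close> excludes both.\<close>

primrec exec :: "com \<Rightarrow> mem \<Rightarrow> mem" where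
  "exec Skip m = m"
| "exec (Assign x es e) m = m((x, map (aval m) es) := aval m e)"
| "exec (Choose x es e) m = m"
| "exec (Seq c1 c2) m = exec c2 (exec c1 m)"
| "exec (Cond e c1 c2) m = (if aval m e \<noteq> 0 then exec c1 m else exec c2 m)"
| "exec (While e c) m = m"

primrec cost :: "com \<Rightarrow> nat" where
  "cost Skip = 0"
| "cost (Assign x es e) = 1"
| "cost (Choose x es e) = 1"
| "cost (Seq c1 c2) = cost c1 + 1 + cost c2"
| "cost (Cond e c1 c2) = Suc (max (cost c1) (cost c2))"
| "cost (While e c) = 0"

lemma run_loop_free: "loop_free c \<Longrightarrow> run (cost c) (c, m) = return_pmf (Skip, exec c m)"
proof (induction c arbitrary: m)
  case (Seq c1 c2)
  then show ?case
    by (simp only: cost.simps, subst run_Seq) (simp_all add: halted_def bind_return_pmf)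
next
  case (Cond e c1 c2)
  have "run (max (cost c1) (cost c2)) (c1, m) = return_pmf (Skip, exec c1 m)"
    "run (max (cost c1) (cost c2)) (c2, m) = return_pmf (Skip, exec c2 m)"
    using Cond run_halted_mono[of "cost c1" "(c1, m)" "max (cost c1) (cost c2)"]
      run_halted_mono[of "cost c2" "(c2, m)" "max (cost c1) (cost c2)"] by (auto simp: halted_def)
  then show ?case by (simp add: bind_return_pmf)
qed (simp_all add: bind_return_pmf)

lemma triple_loop_free:
  assumes "loop_free c" "\<And>m. P m \<Longrightarrow> Q (exec c m)"
  shows "triple P c (cost c) Q"
  using assms run_loop_free by (intro tripleI) blast

text \<open>Truncated subtraction makes the guard nonzero exactly while the counter is below
  \<open>e\<close>.\<close>

definition for_loop :: "nat \<Rightarrow> nat list \<Rightarrow> aexp \<Rightarrow> com \<Rightarrow> com" where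
  "for_loop x ix e c = Seq (Assign x (map Num ix) (Num 0))
     (While (Sub e (Cell x (map Num ix))) (Seq c (Assign x (map Num ix) (Add (Cell x (map Num ix)) (Num 1)))))"

lemma aval_map_Num [simp]: "map (aval m \<circ> Num) ix = ix" "map (aval m) (map Num ix) = ix"
  by (simp_all add: map_idI)

text \<open>A round costs 4 steps besides its body: the test, the increment and the unwinding of two
  sequences. The invariant has to ignore the counter cell, which changes between rounds.\<close>

lemma triple_for_loop:
  assumes body: "\<And>j. j < n \<Longrightarrow> triple (\<lambda>m. I j m \<and> m (x, ix) = j) c t (\<lambda>m. I (Suc j) m \<and> m (x, ix) = j)"
    and frame: "\<And>j m v. I j (m((x, ix) := v)) \<longleftrightarrow> I j m"
    and bound: "\<And>j m. I j m \<Longrightarrow> aval m e = n"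
  shows "triple (I 0) (for_loop x ix e c) (n * (t + 4) + 4) (I n)"
proof -
  let ?W = "While (Sub e (Cell x (map Num ix))) (Seq c (Assign x (map Num ix) (Add (Cell x (map Num ix)) (Num 1))))"
  have loop: "triple (\<lambda>m. I j m \<and> m (x, ix) = j) ?W ((n - j) * (t + 4) + 1) (I n)" if "j \<le> n" for j
    using that
  proof (induction rule: inc_induct)
    case base
    show ?case
      by (rule tripleI) (auto simp: bound bind_return_pmf)
  next
    case (step j)
    have inc: "triple (\<lambda>m. I (Suc j) m \<and> m (x, ix) = j) (Assign x (map Num ix) (Add (Cell x (map Num ix)) (Num 1))) 1
        (\<lambda>m. I (Suc j) m \<and> m (x, ix) = Suc j)"
      by (rule tripleI) (auto simp: bind_return_pmf frame)
    have seq: "triple (\<lambda>m. I j m \<and> m (x, ix) = j) (Seq (Seq c (Assign x (map Num ix) (Add (Cell x (map Num ix)) (Num 1)))) ?W)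
        (t + 1 + 1 + 1 + ((n - Suc j) * (t + 4) + 1)) (I n)"
      using triple_Seq[OF triple_Seq[OF body[OF step(2)] inc] step(3)] by simp
    have n: "(n - j) * (t + 4) + 1 = Suc (t + 1 + 1 + 1 + ((n - Suc j) * (t + 4) + 1))"
      using step(2) by (simp add: Suc_diff_Suc[symmetric])
    show ?case
    proof (rule tripleI)
      fix m assume m: "I j m \<and> m (x, ix) = j"
      then have "aval m (Sub e (Cell x (map Num ix))) \<noteq> 0"
        using bound[of j m] step(2) by simp
      then have eq: "run ((n - j) * (t + 4) + 1) (?W, m) = run (t + 1 + 1 + 1 + ((n - Suc j) * (t + 4) + 1))
          (Seq (Seq c (Assign x (map Num ix) (Add (Cell x (map Num ix)) (Num 1)))) ?W, m)"
        unfolding n by (simp add: bind_return_pmf)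
      show "\<exists>m'. run ((n - j) * (t + 4) + 1) (?W, m) = return_pmf (Skip, m') \<and> I n m'"
        unfolding eq by (rule tripleE[OF seq m]) blast
    qed
  qed
  have "triple (I 0) (Assign x (map Num ix) (Num 0)) 1 (\<lambda>m. I 0 m \<and> m (x, ix) = 0)"
    by (rule tripleI) (auto simp: bind_return_pmf frame)
  from triple_Seq[OF this loop[OF le0]] show ?thesis
    unfolding for_loop_def by (rule triple_mono) auto
qed

section \<open>Ranking of completions\<close>

text \<open>The boxes of a \<open>K \<times> K\<close> square in the order in which two nested loops visit them.\<close>

definition box_at :: "nat \<Rightarrow> nat \<Rightarrow> box" where
  "box_at K i = (i div K + 1, i mod K + 1)"

lemma box_at_bij: "bij_betw (box_at K) {..<K * K} ({1..K} \<times> {1..K})"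
proof (rule bij_betwI[where g = "\<lambda>(r, c). (r - 1) * K + (c - 1)"])
  show "box_at K \<in> {..<K * K} \<rightarrow> {1..K} \<times> {1..K}"
  proof
    fix i assume i: "i \<in> {..<K * K}"
    then have "0 < K" by (cases K) auto
    then have *: "i mod K < K" "i div K < K" using i by (simp_all add: less_mult_imp_div_less)
    show "box_at K i \<in> {1..K} \<times> {1..K}" unfolding box_at_def using Suc_leI[OF *(1)] Suc_leI[OF *(2)] by simp
  qed
  show "(\<lambda>(r, c). (r - 1) * K + (c - 1)) \<in> {1..K} \<times> {1..K} \<rightarrow> {..<K * K}"
  proof
    fix x assume "x \<in> {1..K} \<times> {1..K}"
    then obtain r c where x: "x = (r, c)" "1 \<le> r" "r \<le> K" "1 \<le> c" "c \<le> K" by auto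
    then have "(r - 1) * K + (c - 1) < (r - 1) * K + K" by simp
    also have "\<dots> = r * K" using x by (simp add: mult_eq_if)
    also have "\<dots> \<le> K * K" using x by simp
    finally show "(case x of (r, c) \<Rightarrow> (r - 1) * K + (c - 1)) \<in> {..<K * K}" using x by simp
  qed
next
  fix x assume "x \<in> {1..K} \<times> {1..K}"
  then obtain r c where x: "x = (Suc r, Suc c)" "r < K" "c < K"
    by (cases x, cases "fst x", simp, cases "snd x") auto
  then show "box_at K (case x of (r, c) \<Rightarrow> (r - 1) * K + (c - 1)) = x"
    by (simp add: box_at_def)
qed (simp add: box_at_def)

lemma sum_box_at:
  assumes "A \<subseteq> {1..K} \<times> {1..K}"
  shows "(\<Sum>i<K * K. if box_at K i \<in> A then g (box_at K i) else 0) = sum g A"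
proof -
  have "(\<Sum>i<K * K. if box_at K i \<in> A then g (box_at K i) else 0)
      = (\<Sum>b\<in>{1..K} \<times> {1..K}. if b \<in> A then g b else 0)"
    by (rule sum.reindex_bij_betw[OF box_at_bij])
  also have "\<dots> = sum g A"
    using assms by (intro sum.mono_neutral_cong_right) auto
  finally show ?thesis .
qed

text \<open>Either array may certify a box, because each will record only the lines up to a bound
  \<open>R\<close>. A zero coordinate always counts as inside, which lets the test for addable boxes
  treat the first row and column like the others.\<close>

definition in_shape :: "(nat \<Rightarrow> nat) \<Rightarrow> (nat \<Rightarrow> nat) \<Rightarrow> nat \<Rightarrow> nat \<Rightarrow> bool" where
  "in_shape X Y r c \<longleftrightarrow> c \<le> X r \<or> r \<le> Y c"

definition is_opt :: "(nat \<Rightarrow> nat) \<Rightarrow> (nat \<Rightarrow> nat) \<Rightarrow> (nat \<Rightarrow> nat) \<Rightarrow> box \<Rightarrow> bool" where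
  "is_opt len X Y b \<longleftrightarrow> (case b of (r, c) \<Rightarrow>
     (in_shape X Y r c \<and> \<not> in_shape X Y (r + 1) c \<and> \<not> in_shape X Y r (c + 1)) \<or>
     (c \<le> len r \<and> \<not> in_shape X Y r c \<and> in_shape X Y (r - 1) c \<and> in_shape X Y r (c - 1)))"

definition shrink :: "(nat \<Rightarrow> nat) \<Rightarrow> (nat \<Rightarrow> nat) \<Rightarrow> box \<Rightarrow> (nat \<Rightarrow> nat) \<times> (nat \<Rightarrow> nat)" where
  "shrink X Y b = (case b of (r, c) \<Rightarrow> let d = (if in_shape X Y r c then 1 else 0)
     in (X(r := X r - d), Y(c := Y c - d)))"

text \<open>The dynamic programming recursion on arbitrary pairs \<open>X\<close>, \<open>Y\<close> of row and column lengths,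
  whether or not they describe an ideal.\<close>

primrec path_count :: "nat \<Rightarrow> (nat \<Rightarrow> nat) \<Rightarrow> nat \<Rightarrow> (nat \<Rightarrow> nat) \<Rightarrow> (nat \<Rightarrow> nat) \<Rightarrow> nat" where
  "path_count K len 0 X Y = (if X = (\<lambda>_. 0) \<and> Y = (\<lambda>_. 0) then 1 else 0)"
| "path_count K len (Suc j) X Y = (\<Sum>i<K * K. if is_opt len X Y (box_at K i)
     then case_prod (path_count K len j) (shrink X Y (box_at K i)) else 0)"

text \<open>Lengths of lines beyond \<open>R\<close> are dropped, so an ideal is described by
  \<open>2 * R\<close> numbers, however large the diagram is.\<close>

definition rows :: "nat \<Rightarrow> box set \<Rightarrow> nat \<Rightarrow> nat" where
  "rows R E r = (if 1 \<le> r \<and> r \<le> R then card {c. (r, c) \<in> E} else 0)"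

definition cols :: "nat \<Rightarrow> box set \<Rightarrow> nat \<Rightarrow> nat" where
  "cols R E c = (if 1 \<le> c \<and> c \<le> R then card {r. (r, c) \<in> E} else 0)"

lemma young_row: "young E \<Longrightarrow> {c. (r, c) \<in> E} = {1..card {c. (r, c) \<in> E}}"
proof -
  assume E: "young E"
  let ?S = "{c. (r, c) \<in> E}"
  have fin: "finite ?S" using finite_row[of E r "\<lambda>_. True"] E by (simp add: young_def)
  show "?S = {1..card ?S}"
  proof (cases "?S = {}")
    case False
    then have M: "(r, Max ?S) \<in> E" using Max_in[OF fin] by blast
    have "?S = {1..Max ?S}"
    proof (intro equalityI subsetI)
      fix x assume x: "x \<in> ?S"
      then have "1 \<le> x" "x \<le> Max ?S" using youngD(2)[OF E] Max_ge[OF fin] by blast+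
      then show "x \<in> {1..Max ?S}" by simp
    next
      fix x assume "x \<in> {1..Max ?S}"
      then show "x \<in> ?S" using youngD(3)[OF E M, of r x] youngD(2)[OF E M] by auto
    qed
    moreover from this have "card ?S = Max ?S" by (metis card_atLeastAtMost diff_Suc_1)
    ultimately show ?thesis by simp
  qed simp
qed

lemma young_swap: "young E \<Longrightarrow> young (prod.swap ` E)"
proof -
  assume E: "young E"
  have "(c', r') \<in> prod.swap ` E" if "(c, r) \<in> prod.swap ` E" "1 \<le> c'" "c' \<le> c" "1 \<le> r'" "r' \<le> r" for c r c' r'
    using youngD(3)[OF E, of r c r' c'] that by auto
  then show ?thesis
    using E unfolding young_def by auto
qed

lemma young_col:
  assumes "young E"
  shows "{r. (r, c) \<in> E} = {1..card {r. (r, c) \<in> E}}"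
proof -
  have "{r. (r, c) \<in> E} = {r. (c, r) \<in> prod.swap ` E}" by simp
  then show ?thesis using young_row[OF young_swap[OF assms], of c] by simp
qed

lemma young_subset_square:
  assumes "young E" "card E \<le> k"
  shows "E \<subseteq> {1..k} \<times> {1..k}"
proof
  fix b assume "b \<in> E"
  then obtain r c where b: "b = (r, c)" "(r, c) \<in> E" by (cases b) auto
  have fin: "finite E" using assms(1) by (simp add: young_def)
  have "(\<lambda>i. (i, c)) ` {1..r} \<subseteq> E" "Pair r ` {1..c} \<subseteq> E"
    using youngD(2,3)[OF assms(1) b(2)] by auto
  from card_mono[OF fin this(1)] card_mono[OF fin this(2)] show "b \<in> {1..k} \<times> {1..k}"
    using assms(2) youngD(2)[OF assms(1) b(2)] by (simp add: b(1) card_image inj_on_def)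
qed

section \<open>Ranks of completions\<close>

definition weight :: "box set \<Rightarrow> nat \<Rightarrow> nat \<Rightarrow> box set \<Rightarrow> nat \<Rightarrow> nat" where
  "weight D k M E i = (if box_at (Suc k) i \<in> opts D E then cnt D M (E - {box_at (Suc k) i}) else 0)"

text \<open>Options for a value are ordered by their position in the square. The rank
  \<open>u\<close> counts the completions under all earlier options and adds the rank
  \<open>u'\<close> under the chosen one.\<close>

primrec unrank :: "box set \<Rightarrow> nat \<Rightarrow> nat \<Rightarrow> tableau \<Rightarrow> nat \<Rightarrow> tableau \<Rightarrow> bool" where
  "unrank D k 0 T u T' \<longleftrightarrow> T' = T \<and> empt D T = {} \<and> u = 0"
| "unrank D k (Suc M) T u T' \<longleftrightarrow> (\<exists>i<Suc k * Suc k. \<exists>u'. box_at (Suc k) i \<in> opts D (empt D T) \<and>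
     u' < weight D k M (empt D T) i \<and> u = (\<Sum>i'<i. weight D k M (empt D T) i') + u' \<and>
     unrank D k M (add_value (Suc M) (box_at (Suc k) i) T) u' T')"

context
  fixes D :: "box set" and R k :: nat and len :: "nat \<Rightarrow> nat"
  assumes D: "young D" and R: "\<And>r c. (r, c) \<in> D \<Longrightarrow> r \<le> R \<or> c \<le> R"
    and len: "\<And>r c. 1 \<le> r \<Longrightarrow> 1 \<le> c \<Longrightarrow> (r, c) \<in> D \<longleftrightarrow> c \<le> len r"
begin

text \<open>Every box of \<open>D\<close> lies in one of the first \<open>R\<close> rows or columns,
  so at least one of the truncated arrays records it.\<close>

lemma in_shape_rows:
  assumes "young E" "E \<subseteq> D"
  shows "in_shape (rows R E) (cols R E) r c \<longleftrightarrow> (r, c) \<in> E \<or> r = 0 \<or> c = 0"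
proof -
  define a b where "a = card {c. (r, c) \<in> E}" and "b = card {r. (r, c) \<in> E}"
  have a: "(r, c) \<in> E \<longleftrightarrow> 1 \<le> c \<and> c \<le> a"
    using arg_cong[OF young_row[OF assms(1), of r], of "\<lambda>S. c \<in> S"]
    by (simp only: a_def mem_Collect_eq atLeastAtMost_iff)
  have b: "(r, c) \<in> E \<longleftrightarrow> 1 \<le> r \<and> r \<le> b"
    using arg_cong[OF young_col[OF assms(1), of c], of "\<lambda>S. r \<in> S"]
    by (simp only: b_def mem_Collect_eq atLeastAtMost_iff)
  have "rows R E r = (if 1 \<le> r \<and> r \<le> R then a else 0)" "cols R E c = (if 1 \<le> c \<and> c \<le> R then b else 0)"
    by (simp_all add: rows_def cols_def a_def b_def)
  moreover have "(r, c) \<in> E \<Longrightarrow> r \<le> R \<or> c \<le> R" using R assms(2) by blast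
  ultimately show ?thesis
    using a b youngD(2)[OF assms(1), of r c] unfolding in_shape_def
    by (cases "r = 0"; cases "c = 0"; cases "(r, c) \<in> E") auto
qed

lemma maxs_young_iff:
  assumes "young E"
  shows "(r, c) \<in> maxs E \<longleftrightarrow> (r, c) \<in> E \<and> (r + 1, c) \<notin> E \<and> (r, c + 1) \<notin> E"
proof
  assume m: "(r, c) \<in> maxs E"
  have "b' = (r, c)" if "b' \<in> E" "(r, c) \<le> b'" for b' using m that by (auto simp: maxs_def)
  from this[of "(r + 1, c)"] this[of "(r, c + 1)"] m
  show "(r, c) \<in> E \<and> (r + 1, c) \<notin> E \<and> (r, c + 1) \<notin> E" by (auto simp: maxs_def)
next
  assume a: "(r, c) \<in> E \<and> (r + 1, c) \<notin> E \<and> (r, c + 1) \<notin> E"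
  have "(r', c') = (r, c)" if b: "(r', c') \<in> E" "r \<le> r'" "c \<le> c'" for r' c'
  proof (rule ccontr)
    assume "(r', c') \<noteq> (r, c)"
    then have "r + 1 \<le> r' \<or> c + 1 \<le> c'" using b by auto
    then show False
      using youngD(3)[OF assms b(1), of "r + 1" c] youngD(3)[OF assms b(1), of r "c + 1"] b a youngD(2)[OF assms, of r c]
      by auto
  qed
  then show "(r, c) \<in> maxs E" using a by (auto simp: maxs_def)
qed

lemma mins_young_iff:
  assumes "young E"
  shows "(r, c) \<in> mins (D - E) \<longleftrightarrow>
    (r, c) \<in> D \<and> (r, c) \<notin> E \<and> (r = 1 \<or> (r - 1, c) \<in> E) \<and> (c = 1 \<or> (r, c - 1) \<in> E)"
proof
  assume m: "(r, c) \<in> mins (D - E)"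
  then have rc: "(r, c) \<in> D" "(r, c) \<notin> E" by (auto simp: mins_def)
  note pos = youngD(2)[OF D rc(1)]
  have *: "b' = (r, c)" if "b' \<in> D" "b' \<notin> E" "b' \<le> (r, c)" for b' using m that by (auto simp: mins_def)
  have "r = 1 \<or> (r - 1, c) \<in> E"
    using *[of "(r - 1, c)"] youngD(3)[OF D rc(1), of "r - 1" c] pos by fastforce
  moreover have "c = 1 \<or> (r, c - 1) \<in> E"
    using *[of "(r, c - 1)"] youngD(3)[OF D rc(1), of r "c - 1"] pos by fastforce
  ultimately show "(r, c) \<in> D \<and> (r, c) \<notin> E \<and> (r = 1 \<or> (r - 1, c) \<in> E) \<and> (c = 1 \<or> (r, c - 1) \<in> E)"
    using rc by simp
next
  assume a: "(r, c) \<in> D \<and> (r, c) \<notin> E \<and> (r = 1 \<or> (r - 1, c) \<in> E) \<and> (c = 1 \<or> (r, c - 1) \<in> E)"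
  have "(r', c') = (r, c)" if b: "(r', c') \<in> D" "(r', c') \<notin> E" "r' \<le> r" "c' \<le> c" for r' c'
  proof (rule ccontr)
    assume "(r', c') \<noteq> (r, c)"
    then consider "r' \<le> r - 1" "r' < r" | "c' \<le> c - 1" "c' < c" using b by fastforce
    then show False
    proof cases
      case 1
      then have "(r - 1, c) \<in> E" using a youngD(2)[OF D b(1)] by auto
      then show False using youngD(3)[OF assms, of "r - 1" c r' c'] b youngD(2)[OF D b(1)] 1 by auto
    next
      case 2
      then have "(r, c - 1) \<in> E" using a youngD(2)[OF D b(1)] by auto
      then show False using youngD(3)[OF assms, of r "c - 1" r' c'] b youngD(2)[OF D b(1)] 2 by auto
    qed
  qed
  then show "(r, c) \<in> mins (D - E)" using a by (auto simp: mins_def)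
qed

lemma is_opt_rows:
  assumes "young E" "E \<subseteq> D" "1 \<le> r" "1 \<le> c"
  shows "is_opt len (rows R E) (cols R E) (r, c) \<longleftrightarrow> (r, c) \<in> opts D E"
  unfolding is_opt_def prod.case in_shape_rows[OF assms(1,2)] opts_def Un_iff
    maxs_young_iff[OF assms(1)] mins_young_iff[OF assms(1)]
  using len[OF assms(3,4)] assms(3,4) by auto

lemma shrink_rows:
  assumes E: "young E" "E \<subseteq> D" and b: "b \<in> opts D E"
  shows "shrink (rows R E) (cols R E) b = (rows R (E - {b}), cols R (E - {b}))"
proof -
  obtain r c where rc: "b = (r, c)" by fastforce
  have "(r, c) \<in> D" using opts_subset[OF E(2)] b rc by blast
  then have pos: "r \<noteq> 0" "c \<noteq> 0" using youngD(2)[OF D, of r c] by auto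
  have fin: "finite {q. (i, q) \<in> E}" "finite {p. (p, i) \<in> E}" for i
    using finite_row[of E i "\<lambda>_. True"] finite_col[of E i "\<lambda>_. True"] E(1) by (simp_all add: young_def)
  have row: "{q. (i, q) \<in> E - {b}} = {q. (i, q) \<in> E} - (if i = r then {c} else {})"
    and col: "{p. (p, i) \<in> E - {b}} = {p. (p, i) \<in> E} - (if i = c then {r} else {})" for i
    by (auto simp: rc)
  have "rows R (E - {b}) = (rows R E)(r := rows R E r - (if (r, c) \<in> E then 1 else 0))"
    unfolding rows_def row using fin by (auto simp: fun_eq_iff card_Diff_singleton_if)
  moreover have "cols R (E - {b}) = (cols R E)(c := cols R E c - (if (r, c) \<in> E then 1 else 0))"
    unfolding cols_def col using fin by (auto simp: fun_eq_iff card_Diff_singleton_if)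
  ultimately show ?thesis
    using in_shape_rows[OF E, of r c] pos by (simp add: shrink_def rc Let_def)
qed

text \<open>An ideal with at most \<open>k\<close> boxes lies in the square of side
  \<open>k\<close>, and insertions only touch its corners or its neighbours. This allows the loops
  to scan \<open>Suc k * Suc k\<close> boxes, independently of the size of \<open>D\<close>.\<close>

lemma opts_bound:
  assumes "young E" "E \<subseteq> D" "card E \<le> k"
  shows "opts D E \<subseteq> {1..Suc k} \<times> {1..Suc k}"
proof -
  have le: "r \<le> k \<and> c \<le> k" if "(r, c) \<in> E" for r c
    using young_subset_square[OF assms(1,3)] that by auto
  have "1 \<le> r \<and> r \<le> Suc k \<and> 1 \<le> c \<and> c \<le> Suc k" if "(r, c) \<in> opts D E" for r c
  proof -
    have "(r, c) \<in> D" using opts_subset[OF assms(2)] that by blast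
    then have pos: "1 \<le> r" "1 \<le> c" using youngD(2)[OF D] by auto
    from that consider "(r, c) \<in> E" | "(r, c) \<in> mins (D - E)" by (auto simp: opts_def maxs_def)
    then show ?thesis
    proof cases
      case 1
      then show ?thesis using le[OF 1] pos by simp
    next
      case 2
      then show ?thesis
        unfolding mins_young_iff[OF assms(1)] using le[of "r - 1" c] le[of r "c - 1"] pos by auto
    qed
  qed
  then show ?thesis by auto
qed

lemma young_remove_opt: "young E \<Longrightarrow> b \<in> opts D E \<Longrightarrow> young (E - {b})"
  using young_remove_max[of E b] by (auto simp: opts_def mins_def)

lemma path_count_rows:
  assumes "young E" "E \<subseteq> D" "card E \<le> k"
  shows "path_count (Suc k) len j (rows R E) (cols R E) = cnt D j E"
  using assms
proof (induction j arbitrary: E)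
  case 0
  have "E = {}" if "rows R E = (\<lambda>_. 0)" "cols R E = (\<lambda>_. 0)"
  proof -
    have "(r, c) \<notin> E" for r c
      using in_shape_rows[OF 0(1,2), of r c] youngD(2)[OF 0(1), of r c] that by (auto simp: in_shape_def)
    then show ?thesis by auto
  qed
  moreover have "rows R {} = (\<lambda>_. 0)" "cols R {} = (\<lambda>_. 0)" by (auto simp: rows_def cols_def)
  ultimately show ?case by auto
next
  case (Suc j)
  have "path_count (Suc k) len (Suc j) (rows R E) (cols R E)
      = (\<Sum>i<Suc k * Suc k. if box_at (Suc k) i \<in> opts D E then cnt D j (E - {box_at (Suc k) i}) else 0)"
    unfolding path_count.simps
  proof (rule sum.cong[OF refl])
    fix i
    let ?b = "box_at (Suc k) i"
    have "1 \<le> fst ?b" "1 \<le> snd ?b" by (auto simp: box_at_def)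
    then have opt: "is_opt len (rows R E) (cols R E) ?b \<longleftrightarrow> ?b \<in> opts D E"
      using is_opt_rows[OF Suc.prems(1,2), of "fst ?b" "snd ?b"] by simp
    show "(if is_opt len (rows R E) (cols R E) ?b then case_prod (path_count (Suc k) len j) (shrink (rows R E) (cols R E) ?b) else 0)
      = (if ?b \<in> opts D E then cnt D j (E - {?b}) else 0)"
    proof (cases "?b \<in> opts D E")
      case True
      have "card (E - {?b}) \<le> k" using Suc.prems(1,3) card_mono[of E "E - {?b}"] by (auto simp: young_def)
      then show ?thesis
        using True Suc.IH[OF young_remove_opt[OF Suc.prems(1) True]] Suc.prems(2)
        unfolding opt shrink_rows[OF Suc.prems(1,2) True] by auto
    qed (simp add: opt)
  qed
  also have "\<dots> = cnt D (Suc j) E"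
    using sum_box_at[OF opts_bound[OF Suc.prems], of "\<lambda>b. cnt D j (E - {b})"] by simp
  finally show ?case .
qed

lemma unrank_completion:
  assumes "unrank D k M T u T'" "ptab D N M T" "M \<le> N"
  shows "T' \<in> completions D N M T"
  using assms
proof (induction M arbitrary: T u)
  case 0
  then show ?case by (simp add: completions_0)
next
  case (Suc M)
  from Suc.prems(1)[unfolded unrank.simps] obtain b u' where
    b: "b \<in> opts D (empt D T)" "unrank D k M (add_value (Suc M) b T) u' T'"
    by blast
  have "b \<in> D" using opts_subset[OF empt_subset] b(1) by blast
  then have "ptab D N M (add_value (Suc M) b T)"
    using ptab_add_value_iff[OF Suc.prems(2) _ Suc.prems(3)] b(1) by blast
  then show ?case
    using Suc.IH[OF b(2)] Suc.prems(3) b(1) completions_Suc[OF Suc.prems(2,3)] by auto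
qed

text \<open>Different boxes for \<open>Suc M\<close> have disjoint sets of completions, so the
  tableau fixes the option and then, recursively, the remainder.\<close>

lemma unrank_inj:
  assumes "unrank D k M T u T'" "unrank D k M T v T'" "ptab D N M T" "M \<le> N"
  shows "u = v"
  using assms
proof (induction M arbitrary: T u v)
  case 0
  then show ?case by simp
next
  case (Suc M)
  let ?w = "weight D k M (empt D T)"
  from Suc.prems(1,2)[unfolded unrank.simps] obtain i u' j v' where
    i: "i < Suc k * Suc k" "box_at (Suc k) i \<in> opts D (empt D T)" "u = (\<Sum>i'<i. ?w i') + u'"
      "unrank D k M (add_value (Suc M) (box_at (Suc k) i) T) u' T'" and
    j: "j < Suc k * Suc k" "box_at (Suc k) j \<in> opts D (empt D T)" "v = (\<Sum>i'<j. ?w i') + v'"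
      "unrank D k M (add_value (Suc M) (box_at (Suc k) j) T) v' T'"
    by blast
  have pt: "ptab D N M (add_value (Suc M) b T)" if "b \<in> opts D (empt D T)" for b
    using ptab_add_value_iff[OF Suc.prems(3) _ Suc.prems(4)] opts_subset[OF empt_subset] that by blast
  have "Suc M \<notin> T b" for b using ptabD(2)[OF Suc.prems(3), of b] by auto
  then have "box_at (Suc k) i = box_at (Suc k) j"
    using completions_disjoint unrank_completion[OF i(4) pt[OF i(2)]] unrank_completion[OF j(4) pt[OF j(2)]]
      Suc.prems(4) by (meson Suc_leD)
  then have "i = j"
    using box_at_bij[of "Suc k"] i(1) j(1) by (auto simp: bij_betw_def inj_on_def)
  moreover from this have "u' = v'" using Suc.IH[OF i(4) _ pt[OF i(2)]] j(4) Suc.prems(4) by simp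
  ultimately show ?case using i j by simp
qed

text \<open>Ranks are unique, so \<open>out\<close> is injective; as there are exactly
  \<open>cnt D M (empt D T)\<close> completions, it is also onto.\<close>

lemma unrank_bij:
  assumes T: "ptab D N M T" "M \<le> N" and out: "\<And>u. u < cnt D M (empt D T) \<Longrightarrow> unrank D k M T u (out u)"
  shows "bij_betw out {..<cnt D M (empt D T)} (completions D N M T)"
proof -
  have finD: "finite D" using D by (simp add: young_def)
  have "inj_on out {..<cnt D M (empt D T)}"
  proof (rule inj_onI)
    fix u v assume uv: "u \<in> {..<cnt D M (empt D T)}" "v \<in> {..<cnt D M (empt D T)}" "out u = out v"
    then have "unrank D k M T u (out u)" "unrank D k M T v (out u)" using out[of u] out[of v] by auto
    then show "u = v" using unrank_inj T by blast
  qed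
  moreover have "out ` {..<cnt D M (empt D T)} \<subseteq> completions D N M T"
    using out unrank_completion[OF _ T] by auto
  ultimately show ?thesis
    unfolding bij_betw_def using card_completions[OF finD T]
    by (metis card_image card_lessThan card_subset_eq)
qed

lemma sum_weight:
  assumes "young E" "E \<subseteq> D" "card E \<le> k"
  shows "(\<Sum>i<Suc k * Suc k. weight D k M E i) = cnt D (Suc M) E"
  using sum_box_at[OF opts_bound[OF assms], of "\<lambda>b. cnt D M (E - {b})"] by (simp add: weight_def)

end

section \<open>The sampling program\<close>

text \<open>Working cells: 20 holds the level whose table entries are read, 21 and 22 the zero-based
  row and column, 23 and 24 saved lengths, 25 a number of completions, 26 the remaining rank, 27 a
  flag that the current value is placed, 28 the amount of shrinking, 29 the counter of the unranking
  loop.\<close>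

abbreviation "k_exp \<equiv> Cell 0 [Num 1]"
abbreviation "side_exp \<equiv> Add k_exp (Num 1)"
abbreviation "level_exp \<equiv> Cell 20 []"
abbreviation "row_exp \<equiv> Add (Cell 21 []) (Num 1)"
abbreviation "col_exp \<equiv> Add (Cell 22 []) (Num 1)"
abbreviation "weight_exp \<equiv> Cell 25 []"
abbreviation "rank_exp \<equiv> Cell 26 []"
abbreviation "done_exp \<equiv> Cell 27 []"

definition neg :: "aexp \<Rightarrow> aexp" where
  "neg e = Sub (Num 1) e"

definition conj :: "aexp \<Rightarrow> aexp \<Rightarrow> aexp" where
  "conj e1 e2 = neg (Add (neg e1) (neg e2))"

lemma aval_neg [simp]: "aval m (neg e) = (if aval m e = 0 then 1 else 0)"
  by (simp add: neg_def)

lemma aval_conj [simp]: "aval m (conj e1 e2) = (if aval m e1 \<noteq> 0 \<and> aval m e2 \<noteq> 0 then 1 else 0)"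
  by (simp add: conj_def)

text \<open>The arrays 10 and 11 hold the row and column lengths of the current ideal, and the array 12,
  indexed by level and ideal, the numbers of completions.\<close>

definition in_exp :: "aexp \<Rightarrow> aexp \<Rightarrow> aexp" where
  "in_exp r c = Add (Sub (Add (Cell 10 [r]) (Num 1)) c) (Sub (Add (Cell 11 [c]) (Num 1)) r)"

definition opt_exp :: aexp where
  "opt_exp = Add
     (conj (in_exp row_exp col_exp)
       (conj (neg (in_exp (Add row_exp (Num 1)) col_exp)) (neg (in_exp row_exp (Add col_exp (Num 1))))))
     (conj (conj (Sub (Add (Cell 1 [row_exp]) (Num 1)) col_exp) (neg (in_exp row_exp col_exp)))
       (conj (in_exp (Cell 21 []) col_exp) (in_exp row_exp (Cell 22 []))))"

definition cells :: "nat \<Rightarrow> (nat \<times> nat) list" where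
  "cells R = map (Pair 10) [1..<Suc R] @ map (Pair 11) [1..<Suc R]"

definition table_exp :: "nat \<Rightarrow> aexp list" where
  "table_exp R = map (\<lambda>(x, i). Cell x [Num i]) (cells R)"

text \<open>The table is addressed through the length cells, so the ideal is changed in place to
  read the entry of its successor; 23 and 24 keep what \<open>restore\<close> needs. The double
  negation reduces the membership test to 0 or 1.\<close>

definition peek :: "nat \<Rightarrow> com" where
  "peek R = Seq (Assign 23 [] (Cell 10 [row_exp])) (Seq (Assign 24 [] (Cell 11 [col_exp]))
     (Seq (Assign 28 [] (neg (neg (in_exp row_exp col_exp))))
     (Seq (Assign 10 [row_exp] (Sub (Cell 23 []) (Cell 28 []))) (Seq (Assign 11 [col_exp] (Sub (Cell 24 []) (Cell 28 [])))
     (Assign 25 [] (Cell 12 (level_exp # table_exp R)))))))"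

definition restore :: com where
  "restore = Seq (Assign 10 [row_exp] (Cell 23 [])) (Assign 11 [col_exp] (Cell 24 []))"

definition dp_body :: "nat \<Rightarrow> com" where
  "dp_body R = Cond opt_exp (Seq (peek R) (Seq restore
     (Assign 12 (Add level_exp (Num 1) # table_exp R)
       (Add (Cell 12 (Add level_exp (Num 1) # table_exp R)) weight_exp)))) Skip"

definition append_value :: com where
  "append_value = Seq (Assign 3 [row_exp, col_exp, Cell 2 [row_exp, col_exp]] (Add level_exp (Num 1)))
     (Seq (Assign 2 [row_exp, col_exp] (Add (Cell 2 [row_exp, col_exp]) (Num 1))) (Assign 27 [] (Num 1)))"

definition unrank_body :: "nat \<Rightarrow> com" where
  "unrank_body R = Cond (conj opt_exp (neg done_exp))
     (Seq (peek R) (Cond (Sub weight_exp rank_exp) append_value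
       (Seq restore (Assign 26 [] (Sub rank_exp weight_exp))))) Skip"

definition init_body :: "nat \<Rightarrow> com" where
  "init_body R = Cond (conj (Sub (Add (Cell 1 [row_exp]) (Num 1)) col_exp) (neg (Cell 2 [row_exp, col_exp])))
     (Seq (Cond (Sub (Num (Suc R)) row_exp) (Assign 10 [row_exp] (Add (Cell 10 [row_exp]) (Num 1))) Skip)
          (Cond (Sub (Num (Suc R)) col_exp) (Assign 11 [col_exp] (Add (Cell 11 [col_exp]) (Num 1))) Skip)) Skip"

section \<open>Loop nests over boxes and over length vectors\<close>

definition scan :: "com \<Rightarrow> com" where
  "scan c = for_loop 21 [] side_exp (for_loop 22 [] side_exp c)"

text \<open>The counters are the length cells themselves: the nest runs through all vectors with
  entries up to \<open>k\<close>, whether they describe an ideal or not. Its depth is fixed by the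
  program and not by the input.\<close>

primrec for_cells :: "(nat \<times> nat) list \<Rightarrow> com \<Rightarrow> com" where
  "for_cells [] c = c"
| "for_cells (x # xs) c = for_loop (fst x) [snd x] side_exp (for_cells xs c)"

lemma triple_scan:
  assumes body: "\<And>r c. r < K \<Longrightarrow> c < K \<Longrightarrow> triple (\<lambda>m. I (r * K + c) m \<and> m (21, []) = r \<and> m (22, []) = c) b t
      (\<lambda>m. I (Suc (r * K + c)) m \<and> m (21, []) = r \<and> m (22, []) = c)"
    and frame: "\<And>j m v. I j (m((21, []) := v)) \<longleftrightarrow> I j m" "\<And>j m v. I j (m((22, []) := v)) \<longleftrightarrow> I j m"
    and bound: "\<And>j m. I j m \<Longrightarrow> m (0, [1]) + 1 = K"
  shows "triple (I 0) (scan b) (K * (K * (t + 4) + 8) + 4) (I (K * K))"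
proof -
  have inner: "triple (\<lambda>m. I (r * K) m \<and> m (21, []) = r) (for_loop 22 [] side_exp b) (K * (t + 4) + 4)
      (\<lambda>m. I (Suc r * K) m \<and> m (21, []) = r)" if "r < K" for r
  proof -
    have "triple (\<lambda>m. I (r * K + 0) m \<and> m (21, []) = r) (for_loop 22 [] side_exp b) (K * (t + 4) + 4)
        (\<lambda>m. I (r * K + K) m \<and> m (21, []) = r)"
    proof (rule triple_for_loop)
      fix c assume "c < K"
      from body[OF that this]
      show "triple (\<lambda>m. (I (r * K + c) m \<and> m (21, []) = r) \<and> m (22, []) = c) b t
          (\<lambda>m. (I (r * K + Suc c) m \<and> m (21, []) = r) \<and> m (22, []) = c)"
        by (rule triple_mono) auto
    next
      fix c m v
      show "(I (r * K + c) (m((22, []) := v)) \<and> (m((22, []) := v)) (21, []) = r) \<longleftrightarrow> (I (r * K + c) m \<and> m (21, []) = r)"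
        unfolding frame(2) by simp
    qed (use bound in auto)
    then show ?thesis by (simp add: add.commute)
  qed
  have "triple (I (0 * K)) (scan b) (K * (K * (t + 4) + 4 + 4) + 4) (I (K * K))"
    unfolding scan_def
    by (rule triple_for_loop[of K "\<lambda>r. I (r * K)" 21 "[]" _ "K * (t + 4) + 4" side_exp])
       (use inner frame(1) bound in auto)
  then show ?thesis by (simp add: add.commute)
qed

text \<open>The invariant is indexed by the set \<open>V\<close> of vectors already visited;
  \<open>w\<close> holds the values of the outer counters \<open>ps\<close>. The summand 8 per
  counter covers the loop control.\<close>

lemma triple_for_cells:
  assumes body: "\<And>u V. length u = length (ps @ xs) \<Longrightarrow> set u \<subseteq> {..<K} \<Longrightarrow> u \<notin> V \<Longrightarrow>
      triple (\<lambda>m. A V m \<and> map (\<lambda>(x, i). m (x, [i])) (ps @ xs) = u) b t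
        (\<lambda>m. A (insert u V) m \<and> map (\<lambda>(x, i). m (x, [i])) (ps @ xs) = u)"
    and frame: "\<And>V m x i v. (x, i) \<in> set xs \<Longrightarrow> A V (m((x, [i]) := v)) \<longleftrightarrow> A V m"
    and bound: "\<And>V m. A V m \<Longrightarrow> m (0, [1]) + 1 = K"
    and K: "0 < K" and "distinct (ps @ xs)" "length w = length ps" "set w \<subseteq> {..<K}" "\<And>z. length z = length xs \<Longrightarrow> w @ z \<notin> V"
  shows "triple (\<lambda>m. A V m \<and> map (\<lambda>(x, i). m (x, [i])) ps = w) (for_cells xs b) (K ^ length xs * (t + 8 * length xs))
    (\<lambda>m. A (V \<union> {w @ z | z. length z = length xs \<and> set z \<subseteq> {..<K}}) m \<and> map (\<lambda>(x, i). m (x, [i])) ps = w)"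
  using assms(1-3,5-)
proof (induction xs arbitrary: ps w V)
  case Nil
  then show ?case using Nil(1)[of w V] by simp
next
  case (Cons a xs)
  obtain x i where a: "a = (x, i)" by fastforce
  let ?L = "\<lambda>n. {w @ y # z | y z. y < n \<and> length z = length xs \<and> set z \<subseteq> {..<K}}"
  let ?t = "K ^ length xs * (t + 8 * length xs)"
  have IH: "triple (\<lambda>m. A V' m \<and> map (\<lambda>(x, i). m (x, [i])) (ps @ [a]) = w @ [j]) (for_cells xs b) ?t
      (\<lambda>m. A (V' \<union> {(w @ [j]) @ z | z. length z = length xs \<and> set z \<subseteq> {..<K}}) m
        \<and> map (\<lambda>(x, i). m (x, [i])) (ps @ [a]) = w @ [j])"
    if "j < K" "\<And>z. length z = length xs \<Longrightarrow> (w @ [j]) @ z \<notin> V'" for j V'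
    using Cons.prems(4-6) that
    by (intro Cons.IH Cons.prems(3)) (use Cons.prems(1,2) in auto)
  have loop: "triple (\<lambda>m. A (V \<union> ?L 0) m \<and> map (\<lambda>(x, i). m (x, [i])) ps = w) (for_loop x [i] side_exp (for_cells xs b))
    (K * (?t + 4) + 4) (\<lambda>m. A (V \<union> ?L K) m \<and> map (\<lambda>(x, i). m (x, [i])) ps = w)"
  proof (rule triple_for_loop)
    fix j assume j: "j < K"
    have S: "V \<union> ?L (Suc j) = (V \<union> ?L j) \<union> {(w @ [j]) @ z | z. length z = length xs \<and> set z \<subseteq> {..<K}}"
      by (auto simp: less_Suc_eq)
    have "(w @ [j]) @ z \<notin> V \<union> ?L j" if "length z = length xs" for z
      using Cons.prems(7)[of "j # z"] that by auto
    from IH[OF j this]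
    show "triple (\<lambda>m. (A (V \<union> ?L j) m \<and> map (\<lambda>(x, i). m (x, [i])) ps = w) \<and> m (x, [i]) = j) (for_cells xs b) ?t
        (\<lambda>m. (A (V \<union> ?L (Suc j)) m \<and> map (\<lambda>(x, i). m (x, [i])) ps = w) \<and> m (x, [i]) = j)"
      unfolding S by (rule triple_mono) (auto simp: a)
  next
    fix j and m :: mem and v
    have "(\<lambda>(x', i'). (m((x, [i]) := v)) (x', [i'])) c = (\<lambda>(x, i). m (x, [i])) c" if "c \<in> set ps" for c
      using Cons.prems(4) that by (cases c) (auto simp: a)
    then have "map (\<lambda>(x', i'). (m((x, [i]) := v)) (x', [i'])) ps = map (\<lambda>(x, i). m (x, [i])) ps"
      by (intro map_cong) auto
    moreover have "A (V \<union> ?L j) (m((x, [i]) := v)) \<longleftrightarrow> A (V \<union> ?L j) m"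
      by (rule Cons.prems(2)) (simp add: a)
    ultimately show "(A (V \<union> ?L j) (m((x, [i]) := v)) \<and> map (\<lambda>(x', i'). (m((x, [i]) := v)) (x', [i'])) ps = w)
        \<longleftrightarrow> (A (V \<union> ?L j) m \<and> map (\<lambda>(x, i). m (x, [i])) ps = w)"
      by (simp only:)
  next
    fix j m assume "A (V \<union> ?L j) m \<and> map (\<lambda>(x, i). m (x, [i])) ps = w"
    then show "aval m side_exp = K" using Cons.prems(3)[of "V \<union> ?L j" m] by simp
  qed
  have set_eq: "{w @ z | z. length z = length (a # xs) \<and> set z \<subseteq> {..<K}} = ?L K"
  proof (intro equalityI subsetI)
    fix v assume "v \<in> {w @ z | z. length z = length (a # xs) \<and> set z \<subseteq> {..<K}}"
    then obtain z where z: "v = w @ z" "length z = Suc (length xs)" "set z \<subseteq> {..<K}" by auto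
    then show "v \<in> ?L K" by (cases z) auto
  qed auto
  have time: "K * (?t + 4) + 4 \<le> K ^ length (a # xs) * (t + 8 * length (a # xs))"
  proof -
    have "1 \<le> K ^ length xs" "1 \<le> K" using K by simp_all
    then have "K \<le> K * K ^ length xs" "1 \<le> K * K ^ length xs"
      by simp_all
    then have "4 + K * 4 \<le> 8 * (K * K ^ length xs)"
      by linarith
    then show ?thesis by (simp add: algebra_simps)
  qed
  have fc: "for_cells (a # xs) b = for_loop x [i] side_exp (for_cells xs b)"
    by (simp add: a)
  show ?case
    unfolding set_eq fc by (rule triple_mono[OF loop _ _ time]) simp_all
qed

section \<open>Addresses in the table and the effect of single expressions\<close>

definition key :: "nat \<Rightarrow> (nat \<Rightarrow> nat) \<Rightarrow> (nat \<Rightarrow> nat) \<Rightarrow> nat list" where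
  "key R X Y = map X [1..<Suc R] @ map Y [1..<Suc R]"

lemma map_cells: "map (\<lambda>(x, i). m (x, [i])) (cells R) = key R (\<lambda>i. m (10, [i])) (\<lambda>i. m (11, [i]))"
  by (simp add: cells_def key_def comp_def del: upt_Suc)

lemma aval_table_exp: "map (aval m) (table_exp R) = key R (\<lambda>i. m (10, [i])) (\<lambda>i. m (11, [i]))"
  by (simp add: table_exp_def cells_def key_def comp_def del: upt_Suc)

lemma aval_in_exp [simp]:
  "aval m (in_exp r c) = 0 \<longleftrightarrow> \<not> in_shape (\<lambda>i. m (10, [i])) (\<lambda>i. m (11, [i])) (aval m r) (aval m c)"
  by (auto simp: in_exp_def in_shape_def)

lemma aval_opt_exp:
  "aval m opt_exp = 0 \<longleftrightarrow>
    \<not> is_opt (\<lambda>r. m (1, [r])) (\<lambda>i. m (10, [i])) (\<lambda>i. m (11, [i])) (Suc (m (21, [])), Suc (m (22, [])))"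
  by (simp add: opt_exp_def is_opt_def)

lemma exec_peek:
  fixes m :: mem and R :: nat
  defines "r \<equiv> Suc (m (21, []))" and "c \<equiv> Suc (m (22, []))"
    and "X \<equiv> (\<lambda>i. m (10, [i]))" and "Y \<equiv> (\<lambda>i. m (11, [i]))"
  defines "d \<equiv> (if in_shape X Y r c then 1 else 0)"
  shows "exec (peek R) m = m((23, []) := X r, (24, []) := Y c, (28, []) := d, (10, [r]) := X r - d,
    (11, [c]) := Y c - d, (25, []) := m (12, m (20, []) # case_prod (key R) (shrink X Y (r, c))))"
proof (cases "in_shape X Y r c")
  case True
  then show ?thesis
    unfolding peek_def d_def X_def Y_def r_def c_def
    by (simp add: aval_table_exp shrink_def Let_def fun_upd_def cong: if_cong)
next
  case False
  then show ?thesis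
    unfolding peek_def d_def X_def Y_def r_def c_def
    by (simp add: aval_table_exp shrink_def Let_def fun_upd_def cong: if_cong)
qed

section \<open>Correctness of the table\<close>

lemma exec_restore_peek:
  fixes m :: mem and R :: nat
  defines "r \<equiv> Suc (m (21, []))" and "c \<equiv> Suc (m (22, []))"
    and "X \<equiv> (\<lambda>i. m (10, [i]))" and "Y \<equiv> (\<lambda>i. m (11, [i]))"
  shows "exec restore (exec (peek R) m) = m((23, []) := X r, (24, []) := Y c,
    (28, []) := (if in_shape X Y r c then 1 else 0),
    (25, []) := m (12, m (20, []) # case_prod (key R) (shrink X Y (r, c))))"
  unfolding exec_peek restore_def r_def c_def X_def Y_def
  by (rule ext) simp

lemma exec_dp_body:
  fixes m :: mem and R :: nat
  defines "b \<equiv> (Suc (m (21, [])), Suc (m (22, [])))"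
    and "X \<equiv> (\<lambda>i. m (10, [i]))" and "Y \<equiv> (\<lambda>i. m (11, [i]))"
  defines "m' \<equiv> exec (dp_body R) m"
  shows "x \<notin> {12, 23, 24, 25, 28} \<Longrightarrow> m' (x, ix) = m (x, ix)"
    and "v \<noteq> Suc (m (20, [])) # key R X Y \<Longrightarrow> m' (12, v) = m (12, v)"
    and "m' (12, Suc (m (20, [])) # key R X Y) = m (12, Suc (m (20, [])) # key R X Y) +
      (if is_opt (\<lambda>r. m (1, [r])) X Y b then m (12, m (20, []) # case_prod (key R) (shrink X Y b)) else 0)"
proof -
  define w where "w = m (12, m (20, []) # case_prod (key R) (shrink X Y b))"
  let ?m = "m((23, []) := X (fst b), (24, []) := Y (snd b),
    (28, []) := (if in_shape X Y (fst b) (snd b) then 1 else 0), (25, []) := w)"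
  have "exec restore (exec (peek R) m) = ?m"
    using exec_restore_peek[of R m] by (simp add: w_def X_def Y_def b_def)
  moreover have "map (aval ?m) (table_exp R) = key R X Y"
    by (simp add: aval_table_exp X_def Y_def)
  ultimately have *: "m' = (if is_opt (\<lambda>r. m (1, [r])) X Y b
      then ?m((12, Suc (m (20, [])) # key R X Y) := m (12, Suc (m (20, [])) # key R X Y) + w) else m)"
    unfolding m'_def dp_body_def by (simp add: aval_opt_exp X_def[symmetric] Y_def[symmetric] b_def[symmetric])
  show "x \<notin> {12, 23, 24, 25, 28} \<Longrightarrow> m' (x, ix) = m (x, ix)"
    "v \<noteq> Suc (m (20, [])) # key R X Y \<Longrightarrow> m' (12, v) = m (12, v)"
    "m' (12, Suc (m (20, [])) # key R X Y) = m (12, Suc (m (20, [])) # key R X Y) +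
      (if is_opt (\<lambda>r. m (1, [r])) X Y b then m (12, m (20, []) # case_prod (key R) (shrink X Y b)) else 0)"
    unfolding * by (auto simp: w_def)
qed

lemma loop_free_dp_body: "loop_free (dp_body R)" "cost (dp_body R) = 18"
  by (simp_all add: dp_body_def peek_def restore_def)

lemma box_at_loop: "c < K \<Longrightarrow> box_at K (r * K + c) = (Suc r, Suc c)"
  by (simp add: box_at_def)

context
  fixes R k :: nat and len :: "nat \<Rightarrow> nat" and m0 :: mem
begin

definition inputs :: "mem \<Rightarrow> bool" where
  "inputs m \<longleftrightarrow> m (0, [1]) = k \<and> (\<forall>r. m (1, [r]) = len r)"

definition arrays :: "mem \<Rightarrow> bool" where
  "arrays m \<longleftrightarrow> (\<forall>ix. m (2, ix) = m0 (2, ix) \<and> m (3, ix) = m0 (3, ix))"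

text \<open>Cells outside the range \<open>1..R\<close> must read 0, as \<open>rows\<close> and
  \<open>cols\<close> do there.\<close>

definition supported :: "mem \<Rightarrow> bool" where
  "supported m \<longleftrightarrow> (\<forall>i. \<not> (1 \<le> i \<and> i \<le> R) \<longrightarrow> m (10, [i]) = 0 \<and> m (11, [i]) = 0)"

text \<open>The vectors visited by the loop nest. They are closed under \<open>shrink\<close>, so
  the recursion stays within the table.\<close>

definition fits :: "(nat \<Rightarrow> nat) \<Rightarrow> (nat \<Rightarrow> nat) \<Rightarrow> bool" where
  "fits X Y \<longleftrightarrow> (\<forall>i. X i \<le> k \<and> Y i \<le> k) \<and> (\<forall>i. \<not> (1 \<le> i \<and> i \<le> R) \<longrightarrow> X i = 0 \<and> Y i = 0)"

definition level_ok :: "nat \<Rightarrow> mem \<Rightarrow> bool" where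
  "level_ok j m \<longleftrightarrow> (\<forall>X Y. fits X Y \<longrightarrow> m (12, j # key R X Y) = path_count (Suc k) len j X Y)"

lemma fits_shrink: "fits X Y \<Longrightarrow> shrink X Y b = (X', Y') \<Longrightarrow> fits X' Y'"
  unfolding fits_def shrink_def by (cases b) (auto simp: Let_def, (meson diff_le_self le_trans)+)

lemma key_inj:
  assumes "fits X Y" "fits X' Y'" "key R X Y = key R X' Y'"
  shows "X = X' \<and> Y = Y'"
proof -
  have *: "map X [1..<Suc R] = map X' [1..<Suc R]" "map Y [1..<Suc R] = map Y' [1..<Suc R]"
    using assms(3) by (simp_all add: key_def del: upt_Suc)
  have "X i = X' i \<and> Y i = Y' i" for i
  proof (cases "1 \<le> i \<and> i \<le> R")
    case True
    then have "i \<in> set [1..<Suc R]" by (simp add: less_Suc_eq_le del: upt_Suc)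
    then show ?thesis using * unfolding map_eq_conv by blast
  qed (use assms in \<open>auto simp: fits_def\<close>)
  then show ?thesis by auto
qed

text \<open>\<open>dp_body\<close> adds to its target entry, so entries that have not been visited
  must be known to be 0: those of level \<open>Suc j\<close> outside \<open>V\<close>, and those of
  all higher levels.\<close>

definition dp_level_inv :: "nat \<Rightarrow> nat list set \<Rightarrow> mem \<Rightarrow> bool" where
  "dp_level_inv j V m \<longleftrightarrow> inputs m \<and> arrays m \<and> supported m \<and> m (20, []) = j \<and> (\<forall>j'\<le>j. level_ok j' m) \<and>
     (\<forall>j'>Suc j. \<forall>v. m (12, j' # v) = 0) \<and> (\<forall>v. v \<notin> V \<longrightarrow> m (12, Suc j # v) = 0) \<and>
     (\<forall>X Y. fits X Y \<longrightarrow> key R X Y \<in> V \<longrightarrow> m (12, Suc j # key R X Y) = path_count (Suc k) len (Suc j) X Y)"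

text \<open>During the scan the entry of the fixed vector \<open>u\<close> runs through the partial
  sums of the recursion for \<open>path_count\<close>, while the lower levels stay
  untouched.\<close>

lemma triple_dp_scan:
  assumes u: "length u = length (cells R)" "set u \<subseteq> {..<Suc k}" "u \<notin> V"
  shows "triple (\<lambda>m. dp_level_inv j V m \<and> map (\<lambda>(x, i). m (x, [i])) (cells R) = u) (scan (dp_body R))
    (Suc k * (Suc k * (18 + 4) + 8) + 4)
    (\<lambda>m. dp_level_inv j (insert u V) m \<and> map (\<lambda>(x, i). m (x, [i])) (cells R) = u)"
proof -
  define X where "X i = (if 1 \<le> i \<and> i \<le> R then u ! (i - 1) else 0)" for i
  define Y where "Y i = (if 1 \<le> i \<and> i \<le> R then u ! (R + (i - 1)) else 0)" for i
  have lenu: "length u = R + R" using u(1) by (simp add: cells_def)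
  have key: "key R X Y = u"
  proof (rule nth_equalityI)
    show "length (key R X Y) = length u" by (simp add: key_def lenu del: upt_Suc)
    fix i assume "i < length (key R X Y)"
    then have "i < R + R" by (simp add: key_def del: upt_Suc)
    then show "key R X Y ! i = u ! i"
      by (auto simp: key_def nth_append X_def Y_def simp del: upt_Suc)
  qed
  have "u ! i \<le> k" if "i < R + R" for i
    using u(2) nth_mem[of i u] that lenu by fastforce
  then have fits: "fits X Y" by (auto simp: fits_def X_def Y_def)
  define summand where "summand i = (if is_opt len X Y (box_at (Suc k) i)
    then case_prod (path_count (Suc k) len j) (shrink X Y (box_at (Suc k) i)) else 0)" for i
  define I where "I n m \<longleftrightarrow> inputs m \<and> arrays m \<and> (\<forall>i. m (10, [i]) = X i) \<and> (\<forall>i. m (11, [i]) = Y i) \<and>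
     m (20, []) = j \<and> (\<forall>j'\<le>j. level_ok j' m) \<and>
     (\<forall>j'>Suc j. \<forall>v. m (12, j' # v) = 0) \<and> (\<forall>v. v \<notin> insert u V \<longrightarrow> m (12, Suc j # v) = 0) \<and>
     (\<forall>X Y. fits X Y \<longrightarrow> key R X Y \<in> V \<longrightarrow> m (12, Suc j # key R X Y) = path_count (Suc k) len (Suc j) X Y) \<and>
     m (12, Suc j # u) = sum summand {..<n}" for n m
  have scan: "triple (I 0) (scan (dp_body R)) (Suc k * (Suc k * (18 + 4) + 8) + 4) (I (Suc k * Suc k))"
  proof (rule triple_scan)
    fix r c assume rc: "r < Suc k" "c < Suc k"
    let ?n = "r * Suc k + c"
    have "I (Suc ?n) (exec (dp_body R) m) \<and> exec (dp_body R) m (21, []) = r \<and> exec (dp_body R) m (22, []) = c"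
      if m: "I ?n m \<and> m (21, []) = r \<and> m (22, []) = c" for m
    proof -
      let ?m = "exec (dp_body R) m"
      have XY: "(\<lambda>i. m (10, [i])) = X" "(\<lambda>i. m (11, [i])) = Y" "(\<lambda>r. m (1, [r])) = len"
        using m by (auto simp: I_def inputs_def)
      have b: "(Suc (m (21, [])), Suc (m (22, []))) = box_at (Suc k) ?n"
        using m box_at_loop[OF rc(2), of r] by simp
      have mj: "m (20, []) = j" using m by (simp add: I_def)
      note ex = exec_dp_body[where m = m and R = R, unfolded XY b mj key]
      have "level_ok j m" using m by (simp add: I_def)
      then have "(if is_opt len X Y (box_at (Suc k) ?n) then m (12, j # case_prod (key R) (shrink X Y (box_at (Suc k) ?n))) else 0) = summand ?n"
        using fits_shrink[OF fits, of "box_at (Suc k) ?n"]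
        by (cases "shrink X Y (box_at (Suc k) ?n)") (simp add: summand_def level_ok_def)
      then have acc: "?m (12, Suc j # u) = sum summand {..<Suc ?n}"
        using ex(3) m by (simp add: I_def)
      have lev: "level_ok j' ?m" if "j' \<le> j" for j'
        using m that ex(2) by (simp add: I_def level_ok_def)
      show ?thesis
        unfolding I_def
      proof (intro conjI allI impI)
        show "inputs ?m" "arrays ?m"
          using m ex(1) by (simp_all add: I_def inputs_def arrays_def)
        fix X' Y' assume a: "fits X' Y'" "key R X' Y' \<in> V"
        then have "key R X' Y' \<noteq> u" using u(3) by blast
        then have "?m (12, Suc j # key R X' Y') = m (12, Suc j # key R X' Y')"
          by (intro ex(2)) simp
        then show "?m (12, Suc j # key R X' Y') = path_count (Suc k) len (Suc j) X' Y'"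
          using m a by (simp add: I_def del: path_count.simps)
      qed (use m ex(1,2) acc lev in \<open>auto simp: I_def\<close>)
    qed
    then show "triple (\<lambda>m. I ?n m \<and> m (21, []) = r \<and> m (22, []) = c) (dp_body R) 18
        (\<lambda>m. I (Suc ?n) m \<and> m (21, []) = r \<and> m (22, []) = c)"
      unfolding loop_free_dp_body(2)[of R, symmetric] by (intro triple_loop_free loop_free_dp_body(1))
  qed (auto simp: I_def inputs_def arrays_def level_ok_def)
  show ?thesis
  proof (rule triple_mono[OF scan])
    fix m assume m: "dp_level_inv j V m \<and> map (\<lambda>(x, i). m (x, [i])) (cells R) = u"
    then have "key R (\<lambda>i. m (10, [i])) (\<lambda>i. m (11, [i])) = key R X Y"
      unfolding map_cells key by blast
    then have *: "map (\<lambda>i. m (10, [i])) [1..<Suc R] = map X [1..<Suc R]" "map (\<lambda>i. m (11, [i])) [1..<Suc R] = map Y [1..<Suc R]"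
      by (simp_all add: key_def del: upt_Suc)
    have "m (10, [i]) = X i \<and> m (11, [i]) = Y i" for i
    proof (cases "1 \<le> i \<and> i \<le> R")
      case True
      then have "i \<in> set [1..<Suc R]" by (simp add: less_Suc_eq_le del: upt_Suc)
      then show ?thesis using * unfolding map_eq_conv by blast
    next
      case False
      then have "X i = 0" "Y i = 0" unfolding X_def Y_def by auto
      then show ?thesis using m False unfolding dp_level_inv_def supported_def by metis
    qed
    then show "I 0 m"
      using m u(3) by (auto simp: I_def dp_level_inv_def)
  next
    fix m assume m: "I (Suc k * Suc k) m"
    have "sum summand {..<Suc k * Suc k} = path_count (Suc k) len (Suc j) X Y"
      by (simp add: summand_def)
    then have *: "m (12, Suc j # key R X Y) = path_count (Suc k) len (Suc j) X Y"
      using m key by (simp add: I_def)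
    have "m (12, Suc j # key R X' Y') = path_count (Suc k) len (Suc j) X' Y'"
      if "fits X' Y'" "key R X' Y' \<in> insert u V" for X' Y'
    proof (cases "key R X' Y' = u")
      case True
      then show ?thesis using key_inj[OF fits that(1)] * key by simp
    next
      case False
      then show ?thesis using m that by (simp add: I_def del: path_count.simps)
    qed
    moreover have "map (\<lambda>(x, i). m (x, [i])) (cells R) = u"
      using m unfolding map_cells key[symmetric] by (simp add: I_def)
    moreover have "supported m"
      using m by (auto simp: supported_def I_def X_def Y_def)
    ultimately show "dp_level_inv j (insert u V) m \<and> map (\<lambda>(x, i). m (x, [i])) (cells R) = u"
      using m by (simp add: I_def dp_level_inv_def del: path_count.simps)
  qed simp
qed

definition dp_time :: nat where
  "dp_time = k * (Suc k ^ (2 * R) * ((Suc k * (Suc k * (18 + 4) + 8) + 4) + 8 * (2 * R)) + 4) + 4"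

definition table_inv :: "nat \<Rightarrow> mem \<Rightarrow> bool" where
  "table_inv j m \<longleftrightarrow> inputs m \<and> arrays m \<and> supported m \<and> (\<forall>j'\<le>j. level_ok j' m) \<and> (\<forall>j'>j. \<forall>v. m (12, j' # v) = 0)"

lemma triple_dp:
  "triple (table_inv 0) (for_loop 20 [] k_exp (for_cells (cells R) (scan (dp_body R)))) dp_time (table_inv k)"
  unfolding dp_time_def
proof (rule triple_for_loop)
  fix j assume "j < k"
  let ?t = "Suc k * (Suc k * (18 + 4) + 8) + 4"
  let ?V = "{[] @ z | z. length z = length (cells R) \<and> set z \<subseteq> {..<Suc k}}"
  have cells: "length (cells R) = 2 * R" "distinct (cells R)" "(x, i) \<in> set (cells R) \<Longrightarrow> (x = 10 \<or> x = 11) \<and> 1 \<le> i \<and> i \<le> R" for x i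
    by (auto simp: cells_def distinct_map inj_on_def)
  have "triple (\<lambda>m. dp_level_inv j {} m \<and> map (\<lambda>(x, i). m (x, [i])) [] = []) (for_cells (cells R) (scan (dp_body R)))
    (Suc k ^ length (cells R) * (?t + 8 * length (cells R)))
    (\<lambda>m. dp_level_inv j ({} \<union> ?V) m \<and> map (\<lambda>(x, i). m (x, [i])) [] = [])"
  proof (rule triple_for_cells)
    show "dp_level_inv j V (m((x, [i]) := v)) \<longleftrightarrow> dp_level_inv j V m" if "(x, i) \<in> set (cells R)" for V m x i v
      using cells(3)[OF that]
      by (auto simp: dp_level_inv_def inputs_def arrays_def supported_def level_ok_def simp del: path_count.simps)
  next
    show "m (0, [1]) + 1 = Suc k" if "dp_level_inv j V m" for V m
      using that by (simp add: dp_level_inv_def inputs_def)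
  qed (use triple_dp_scan cells(2) in auto)
  then have t: "triple (dp_level_inv j {}) (for_cells (cells R) (scan (dp_body R))) (Suc k ^ (2 * R) * (?t + 8 * (2 * R)))
    (dp_level_inv j ?V)"
    unfolding cells(1) by simp
  show "triple (\<lambda>m. table_inv j m \<and> m (20, []) = j) (for_cells (cells R) (scan (dp_body R)))
      (Suc k ^ (2 * R) * (?t + 8 * (2 * R))) (\<lambda>m. table_inv (Suc j) m \<and> m (20, []) = j)"
  proof (rule triple_mono[OF t])
    fix m assume "table_inv j m \<and> m (20, []) = j"
    then show "dp_level_inv j {} m" by (simp add: table_inv_def dp_level_inv_def)
  next
    fix m assume m: "dp_level_inv j ?V m"
    have "key R X Y \<in> ?V" if "fits X Y" for X Y
      using that by (auto simp: key_def cells_def fits_def less_Suc_eq_le simp del: upt_Suc)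
    then have "level_ok (Suc j) m"
      using m by (simp add: dp_level_inv_def level_ok_def del: path_count.simps)
    then show "table_inv (Suc j) m \<and> m (20, []) = j"
      using m by (auto simp: table_inv_def dp_level_inv_def le_Suc_eq)
  qed simp
qed (auto simp: table_inv_def inputs_def arrays_def supported_def level_ok_def)

end

section \<open>Correctness of the unranking\<close>

lemma output_tableau_cong:
  "(\<And>ix. m (2, ix) = m' (2, ix)) \<Longrightarrow> (\<And>ix. m (3, ix) = m' (3, ix)) \<Longrightarrow> output_tableau m = output_tableau m'"
  by (simp add: output_tableau_def)

text \<open>\<open>output_tableau\<close> reads a box as a set, so smaller values can be appended
  behind the increasing list given in the input.\<close>

lemma output_tableau_append:
  assumes "m' (2, [r, c]) = Suc (m (2, [r, c]))" "m' (3, [r, c, m (2, [r, c])]) = v"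
    and "\<And>ix. ix \<noteq> [r, c] \<Longrightarrow> m' (2, ix) = m (2, ix)"
    and "\<And>ix. ix \<noteq> [r, c, m (2, [r, c])] \<Longrightarrow> m' (3, ix) = m (3, ix)"
  shows "output_tableau m' = add_value v (r, c) (output_tableau m)"
proof
  fix b :: box
  obtain p q where b: "b = (p, q)" by fastforce
  show "output_tableau m' b = add_value v (r, c) (output_tableau m) b"
  proof (cases "(p, q) = (r, c)")
    case True
    have "(\<lambda>i. m' (3, [r, c, i])) ` {..<m (2, [r, c])} = (\<lambda>i. m (3, [r, c, i])) ` {..<m (2, [r, c])}"
      using assms(4) by (intro image_cong) auto
    then show ?thesis
      using True assms(1,2) by (simp add: b output_tableau_def add_value_def lessThan_Suc)
  next
    case False
    then show ?thesis
      using assms(3)[of "[p, q]"] assms(4) by (auto simp: b output_tableau_def add_value_def)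
  qed
qed

lemma exec_unrank_body:
  fixes m :: mem and R :: nat
  defines "r \<equiv> Suc (m (21, []))" and "c \<equiv> Suc (m (22, []))"
    and "X \<equiv> (\<lambda>i. m (10, [i]))" and "Y \<equiv> (\<lambda>i. m (11, [i]))"
  defines "w \<equiv> m (12, m (20, []) # case_prod (key R) (shrink X Y (r, c)))"
    and "d \<equiv> (if in_shape X Y r c then 1 else 0)"
  shows "exec (unrank_body R) m =
    (if is_opt (\<lambda>r. m (1, [r])) X Y (r, c) \<and> m (27, []) = 0 then
       if m (26, []) < w
       then m((23, []) := X r, (24, []) := Y c, (28, []) := d, (10, [r]) := X r - d, (11, [c]) := Y c - d, (25, []) := w,
         (3, [r, c, m (2, [r, c])]) := Suc (m (20, [])), (2, [r, c]) := Suc (m (2, [r, c])), (27, []) := 1)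
       else m((23, []) := X r, (24, []) := Y c, (28, []) := d, (25, []) := w, (26, []) := m (26, []) - w)
     else m)"
proof -
  have 1: "exec (peek R) m = m((23, []) := X r, (24, []) := Y c, (28, []) := d, (10, [r]) := X r - d,
    (11, [c]) := Y c - d, (25, []) := w)"
    using exec_peek[of R m] by (simp only: w_def d_def X_def Y_def r_def c_def)
  have 2: "exec restore (m((23, []) := X r, (24, []) := Y c, (28, []) := d, (10, [r]) := X r - d,
    (11, [c]) := Y c - d, (25, []) := w)) = m((23, []) := X r, (24, []) := Y c, (28, []) := d, (25, []) := w)"
    using exec_restore_peek[of R m] unfolding 1 by (simp only: w_def d_def X_def Y_def r_def c_def)
  have r: "Suc (m (21, [])) = r" and c: "Suc (m (22, [])) = c" by (simp_all add: r_def c_def)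
  show ?thesis
    unfolding unrank_body_def append_value_def
    by (simp add: aval_opt_exp r c X_def[symmetric] Y_def[symmetric] 1 2 del: fun_upd_apply)
       (simp add: r c)
qed

lemma loop_free_unrank_body: "loop_free (unrank_body R)" "cost (unrank_body R) = 19"
  by (simp_all add: unrank_body_def peek_def restore_def append_value_def)

lemma loop_free_init_body: "loop_free (init_body R)" "cost (init_body R) = 6"
  by (simp_all add: init_body_def)

section \<open>Initialisation of the ideal and unranking\<close>

definition init_com :: "nat \<Rightarrow> com" where
  "init_com R = Seq (for_loop 21 [] (Num R) (Seq (Assign 10 [row_exp] (Num 0)) (Assign 11 [row_exp] (Num 0))))
     (scan (init_body R))"

definition unrank_com :: "nat \<Rightarrow> com" where
  "unrank_com R = for_loop 29 [] k_exp
     (Seq (Seq (Assign 20 [] (Sub (Sub k_exp (Num 1)) (Cell 29 []))) (Assign 27 [] (Num 0))) (scan (unrank_body R)))"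

definition ready :: "nat \<Rightarrow> nat \<Rightarrow> (nat \<Rightarrow> nat) \<Rightarrow> mem \<Rightarrow> bool" where
  "ready R k len m \<longleftrightarrow> inputs k len m \<and> (\<forall>j\<le>k. level_ok R k len j m)"

definition holds_shape :: "nat \<Rightarrow> box set \<Rightarrow> mem \<Rightarrow> bool" where
  "holds_shape R E m \<longleftrightarrow> (\<forall>i. m (10, [i]) = rows R E i) \<and> (\<forall>i. m (11, [i]) = cols R E i)"

lemma shape_ready_output_cong:
  assumes "\<And>x ix. x \<in> {0, 1, 2, 3, 10, 11, 12} \<Longrightarrow> m' (x, ix) = m (x, ix)"
  shows "holds_shape R E m' = holds_shape R E m" "ready R k len m' = ready R k len m" "output_tableau m' = output_tableau m"
  using assms by (simp_all add: holds_shape_def ready_def inputs_def level_ok_def output_tableau_def)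

context
  fixes D :: "box set" and R k N :: nat and len :: "nat \<Rightarrow> nat" and S :: tableau and m0 :: mem
  assumes D: "young D" and R: "\<And>r c. (r, c) \<in> D \<Longrightarrow> r \<le> R \<or> c \<le> R"
    and len: "\<And>r c. 1 \<le> r \<Longrightarrow> 1 \<le> c \<Longrightarrow> (r, c) \<in> D \<longleftrightarrow> c \<le> len r"
    and S: "ptab D N k S" "k \<le> N" "card (empt D S) \<le> k"
    and m0: "\<And>r c. m0 (2, [r, c]) = card (S (r, c))" "output_tableau m0 = S"
begin

lemma fits_rows:
  assumes "young E" "card E \<le> k"
  shows "fits R k (rows R E) (cols R E)"
proof -
  have E: "finite E" "E \<subseteq> {1..k} \<times> {1..k}"
    using young_subset_square[OF assms] assms(1) by (auto simp: young_def)
  have "card {c. (i, c) \<in> E} \<le> card {1..k}" "card {r. (r, i) \<in> E} \<le> card {1..k}" for i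
    using E(2) by (intro card_mono; auto)+
  then show ?thesis by (auto simp: fits_def rows_def cols_def)
qed

text \<open>The table phase leaves counter values in the arrays 10 and 11, so these are cleared
  first. The scan then counts the empty boxes of \<open>S\<close> in every line up to
  \<open>R\<close>; all of them lie in the square.\<close>

lemma triple_init:
  "triple (table_inv R k len m0 k) (init_com R) ((R * (3 + 4) + 4) + 1 + (Suc k * (Suc k * (6 + 4) + 8) + 4))
    (\<lambda>m. ready R k len m \<and> arrays m0 m \<and> holds_shape R (empt D S) m)"
proof -
  define E where "E = empt D S"
  have E: "young E" "E \<subseteq> D" using young_empt[OF D S(1)] empt_subset by (auto simp: E_def)
  have sq: "E \<subseteq> {1..Suc k} \<times> {1..Suc k}"
    using young_subset_square[OF E(1)] S(3) by (fastforce simp: E_def)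
  have finS: "finite (S b)" for b using ptabD(2)[OF S(1), of b] finite_subset by blast
  define Z where "Z n m \<longleftrightarrow> ready R k len m \<and> arrays m0 m \<and> supported R m \<and> (\<forall>i. 1 \<le> i \<and> i \<le> n \<longrightarrow> m (10, [i]) = 0 \<and> m (11, [i]) = 0)" for n m
  let ?b = "box_at (Suc k)"
  define J where "J n m \<longleftrightarrow> ready R k len m \<and> arrays m0 m \<and>
    (\<forall>i. m (10, [i]) = (if 1 \<le> i \<and> i \<le> R then \<Sum>n'<n. if ?b n' \<in> {b \<in> E. fst b = i} then 1 else 0 else 0)) \<and>
    (\<forall>i. m (11, [i]) = (if 1 \<le> i \<and> i \<le> R then \<Sum>n'<n. if ?b n' \<in> {b \<in> E. snd b = i} then 1 else 0 else 0))" for n m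
  have "triple (Z 0) (for_loop 21 [] (Num R) (Seq (Assign 10 [row_exp] (Num 0)) (Assign 11 [row_exp] (Num 0)))) (R * (3 + 4) + 4) (Z R)"
  proof (rule triple_for_loop)
    fix j assume j: "j < R"
    have "triple (\<lambda>m. Z j m \<and> m (21, []) = j) (Seq (Assign 10 [row_exp] (Num 0)) (Assign 11 [row_exp] (Num 0)))
        (cost (Seq (Assign 10 [row_exp] (Num 0)) (Assign 11 [row_exp] (Num 0)))) (\<lambda>m. Z (Suc j) m \<and> m (21, []) = j)"
      using j by (intro triple_loop_free)
        (auto simp: Z_def ready_def inputs_def arrays_def supported_def level_ok_def le_Suc_eq simp del: path_count.simps)
    then show "triple (\<lambda>m. Z j m \<and> m (21, []) = j) (Seq (Assign 10 [row_exp] (Num 0)) (Assign 11 [row_exp] (Num 0))) 3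
        (\<lambda>m. Z (Suc j) m \<and> m (21, []) = j)" by (simp add: numeral_3_eq_3)
  qed (auto simp: Z_def ready_def inputs_def arrays_def supported_def level_ok_def simp del: path_count.simps)
  then have zero: "triple (table_inv R k len m0 k)
      (for_loop 21 [] (Num R) (Seq (Assign 10 [row_exp] (Num 0)) (Assign 11 [row_exp] (Num 0)))) (R * (3 + 4) + 4) (J 0)"
  proof (rule triple_mono)
    show "Z 0 m" if "table_inv R k len m0 k m" for m
      using that by (simp add: Z_def table_inv_def ready_def)
    show "J 0 m" if "Z R m" for m
    proof -
      have "m (10, [i]) = 0 \<and> m (11, [i]) = 0" for i
        using that unfolding Z_def supported_def by (cases "1 \<le> i \<and> i \<le> R") blast+
      then show ?thesis using that by (simp add: J_def Z_def)
    qed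
  qed simp
  have "triple (J 0) (scan (init_body R)) (Suc k * (Suc k * (6 + 4) + 8) + 4) (J (Suc k * Suc k))"
  proof (rule triple_scan)
    fix r c assume rc: "r < Suc k" "c < Suc k"
    let ?n = "r * Suc k + c"
    have "J (Suc ?n) (exec (init_body R) m) \<and> exec (init_body R) m (21, []) = r \<and> exec (init_body R) m (22, []) = c"
      if m: "J ?n m \<and> m (21, []) = r \<and> m (22, []) = c" for m
    proof -
      have mrc: "m (21, []) = r" "m (22, []) = c" "J ?n m" using m by auto
      have b: "?b ?n = (Suc r, Suc c)" by (rule box_at_loop[OF rc(2)])
      have in_E: "(Suc r, Suc c) \<in> E \<longleftrightarrow> Suc c \<le> len (Suc r) \<and> m (2, [Suc r, Suc c]) = 0"
        using len[of "Suc r" "Suc c"] mrc(3) m0(1)[of "Suc r" "Suc c"] finS[of "(Suc r, Suc c)"]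
        by (auto simp: E_def empt_def J_def arrays_def)
      have cond: "aval m (conj (Sub (Add (Cell 1 [row_exp]) (Num 1)) col_exp) (neg (Cell 2 [row_exp, col_exp]))) \<noteq> 0
          \<longleftrightarrow> (Suc r, Suc c) \<in> E"
        using mrc by (auto simp: in_E J_def ready_def inputs_def)
      have ex: "exec (init_body R) m = (if (Suc r, Suc c) \<in> E then
          (let m1 = (if Suc r \<le> R then m((10, [Suc r]) := Suc (m (10, [Suc r]))) else m)
           in (if Suc c \<le> R then m1((11, [Suc c]) := Suc (m1 (11, [Suc c]))) else m1)) else m)"
        unfolding init_body_def exec.simps cond using mrc(1,2) by (simp add: Let_def)
      show ?thesis
        using mrc unfolding ex J_def sum.lessThan_Suc b
        by (auto simp: Let_def ready_def inputs_def arrays_def level_ok_def simp del: path_count.simps)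
    qed
    then show "triple (\<lambda>m. J ?n m \<and> m (21, []) = r \<and> m (22, []) = c) (init_body R) 6
        (\<lambda>m. J (Suc ?n) m \<and> m (21, []) = r \<and> m (22, []) = c)"
      unfolding loop_free_init_body(2)[of R, symmetric] by (intro triple_loop_free loop_free_init_body(1))
  qed (auto simp: J_def ready_def inputs_def arrays_def level_ok_def simp del: path_count.simps)
  from triple_Seq[OF zero this] show ?thesis
    unfolding init_com_def
  proof (rule triple_mono)
    fix m assume m: "J (Suc k * Suc k) m"
    have "(\<Sum>n'<Suc k * Suc k. if ?b n' \<in> {b \<in> E. fst b = i} then 1 else 0) = card {c. (i, c) \<in> E}" for i
    proof -
      have "{b \<in> E. fst b = i} = Pair i ` {c. (i, c) \<in> E}" by force
      then have "card {b \<in> E. fst b = i} = card {c. (i, c) \<in> E}" by (simp add: card_image inj_on_def)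
      then show ?thesis
        using sum_box_at[of "{b \<in> E. fst b = i}" "Suc k" "\<lambda>_. 1::nat"] sq by (simp add: subset_iff)
    qed
    moreover have "(\<Sum>n'<Suc k * Suc k. if ?b n' \<in> {b \<in> E. snd b = i} then 1 else 0) = card {r. (r, i) \<in> E}" for i
    proof -
      have "{b \<in> E. snd b = i} = (\<lambda>r. (r, i)) ` {r. (r, i) \<in> E}" by force
      then have "card {b \<in> E. snd b = i} = card {r. (r, i) \<in> E}" by (simp add: card_image inj_on_def)
      then show ?thesis
        using sum_box_at[of "{b \<in> E. snd b = i}" "Suc k" "\<lambda>_. 1::nat"] sq by (simp add: subset_iff)
    qed
    ultimately show "ready R k len m \<and> arrays m0 m \<and> holds_shape R (empt D S) m"
      using m unfolding J_def holds_shape_def rows_def cols_def E_def[symmetric] by simp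
  qed simp_all
qed

text \<open>Until a box is chosen, the weights passed and the remaining rank add up to
  \<open>u\<close>; afterwards the remaining rank is below the weight of the chosen box. As
  \<open>u\<close> is below the total weight, a box is chosen by the end of the scan.\<close>

lemma triple_unrank_scan:
  assumes T: "ptab D N (Suc M) T" and M: "Suc M \<le> k" and cE: "card (empt D T) \<le> k"
    and u: "u < cnt D (Suc M) (empt D T)"
  shows "triple (\<lambda>m. ready R k len m \<and> m (20, []) = M \<and> m (29, []) = l \<and> m (27, []) = 0 \<and> output_tableau m = T
      \<and> holds_shape R (empt D T) m \<and> m (26, []) = u)
    (scan (unrank_body R)) (Suc k * (Suc k * (19 + 4) + 8) + 4)
    (\<lambda>m. ready R k len m \<and> m (29, []) = l \<and> (\<exists>T1. ptab D N M T1 \<and> output_tableau m = T1 \<and> holds_shape R (empt D T1) m \<and>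
      m (26, []) < cnt D M (empt D T1) \<and> (\<forall>T'. unrank D k M T1 (m (26, [])) T' \<longrightarrow> unrank D k (Suc M) T u T')))"
proof -
  define E where "E = empt D T"
  let ?b = "box_at (Suc k)" and ?w = "weight D k M E"
  have E: "young E" "E \<subseteq> D" "card E \<le> k"
    using young_empt[OF D T] empt_subset cE by (auto simp: E_def)
  define P where "P i m \<longleftrightarrow> ?b i \<in> opts D E \<and> m (26, []) < ?w i \<and> u = sum ?w {..<i} + m (26, []) \<and>
    output_tableau m = add_value (Suc M) (?b i) T \<and> holds_shape R (E - {?b i}) m" for i m
  define I where "I n m \<longleftrightarrow> ready R k len m \<and> m (20, []) = M \<and> m (29, []) = l \<and>
    (m (27, []) = 0 \<and> output_tableau m = T \<and> holds_shape R E m \<and> sum ?w {..<n} + m (26, []) = u \<or>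
     m (27, []) = 1 \<and> (\<exists>i<Suc k * Suc k. P i m))" for n m
  have "triple (I 0) (scan (unrank_body R)) (Suc k * (Suc k * (19 + 4) + 8) + 4) (I (Suc k * Suc k))"
  proof (rule triple_scan)
    fix r c assume rc: "r < Suc k" "c < Suc k"
    let ?n = "r * Suc k + c" and ?B = "(Suc r, Suc c)"
    have "?n < Suc k * Suc k"
    proof -
      have "?n < r * Suc k + Suc k" using rc by simp
      also have "\<dots> = Suc r * Suc k" by simp
      also have "\<dots> \<le> Suc k * Suc k" using rc by (intro mult_right_mono) auto
      finally show ?thesis .
    qed
    note n = this
    have b: "?b ?n = ?B" by (rule box_at_loop[OF rc(2)])
    have "I (Suc ?n) (exec (unrank_body R) m) \<and> exec (unrank_body R) m (21, []) = r \<and> exec (unrank_body R) m (22, []) = c"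
      if m: "I ?n m \<and> m (21, []) = r \<and> m (22, []) = c" for m
    proof -
      let ?m = "exec (unrank_body R) m"
      have mI: "I ?n m" "m (21, []) = r" "m (22, []) = c" using m by auto
      show ?thesis
      proof (cases "m (27, []) = 0")
        case False
        then have "?m = m" unfolding exec_unrank_body by simp
        then show ?thesis using m False by (simp add: I_def)
      next
        case True
        then have 0: "ready R k len m" "m (20, []) = M" "m (29, []) = l" "output_tableau m = T" "holds_shape R E m"
          "sum ?w {..<?n} + m (26, []) = u"
          using mI(1) by (auto simp: I_def)
        have XY: "(\<lambda>i. m (10, [i])) = rows R E" "(\<lambda>i. m (11, [i])) = cols R E" "(\<lambda>r. m (1, [r])) = len"
          using 0(1,5) by (auto simp: holds_shape_def ready_def inputs_def)
        have opt: "is_opt len (rows R E) (cols R E) ?B \<longleftrightarrow> ?B \<in> opts D E"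
          by (rule is_opt_rows[OF D R len E(1,2)]) auto
        show ?thesis
        proof (cases "?B \<in> opts D E")
          case False
          then have "?m = m" using opt unfolding exec_unrank_body mI(2,3) XY by simp
          moreover have "?w ?n = 0" using False unfolding weight_def b by simp
          ultimately show ?thesis using m 0 True by (simp add: I_def)
        next
          case opt': True
          have sh: "shrink (rows R E) (cols R E) ?B = (rows R (E - {?B}), cols R (E - {?B}))"
            by (rule shrink_rows[OF D R len E(1,2) opt'])
          have E'1: "young (E - {?B})" by (rule young_remove_opt[OF D R len E(1) opt'])
          have E'2: "card (E - {?B}) \<le> k" using card_Diff1_le[of E ?B] E(3) by (rule le_trans)
          have E'3: "E - {?B} \<subseteq> D" using E(2) by blast
          note E' = E'1 E'2 E'3
          have "level_ok R k len M m" using 0(1) M by (simp add: ready_def)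
          then have "m (12, M # key R (rows R (E - {?B})) (cols R (E - {?B})))
              = path_count (Suc k) len M (rows R (E - {?B})) (cols R (E - {?B}))"
            using fits_rows[OF E'(1,2)] unfolding level_ok_def by blast
          also have "\<dots> = cnt D M (E - {?B})"
            by (rule path_count_rows[OF D R len E'(1,3,2)])
          finally have w: "m (12, M # case_prod (key R) (shrink (rows R E) (cols R E) ?B)) = ?w ?n"
            using opt' unfolding sh weight_def b by simp
          define d where "d = (if in_shape (rows R E) (cols R E) (Suc r) (Suc c) then 1 else 0 :: nat)"
          have new: "rows R (E - {?B}) = (rows R E)(Suc r := rows R E (Suc r) - d)"
            "cols R (E - {?B}) = (cols R E)(Suc c := cols R E (Suc c) - d)"
            using sh unfolding shrink_def Let_def prod.case d_def by simp_all
          have XY1: "m (10, [Suc r]) = rows R E (Suc r)" "m (11, [Suc c]) = cols R E (Suc c)"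
            using 0(5) by (simp_all add: holds_shape_def)
          have ex: "?m = (if m (26, []) < ?w ?n
           then m((23, []) := rows R E (Suc r), (24, []) := cols R E (Suc c), (28, []) := d, (10, [Suc r]) := rows R E (Suc r) - d,
             (11, [Suc c]) := cols R E (Suc c) - d, (25, []) := ?w ?n,
             (3, [Suc r, Suc c, m (2, [Suc r, Suc c])]) := Suc M, (2, [Suc r, Suc c]) := Suc (m (2, [Suc r, Suc c])), (27, []) := 1)
           else m((23, []) := rows R E (Suc r), (24, []) := cols R E (Suc c), (28, []) := d, (25, []) := ?w ?n,
             (26, []) := m (26, []) - ?w ?n))"
            unfolding exec_unrank_body mI(2,3) XY XY1 0(2) w d_def using opt opt' True
            by (simp only: simp_thms if_True)
          show ?thesis
          proof (cases "m (26, []) < ?w ?n")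
            case less: True
            have "output_tableau ?m = add_value (Suc M) ?B (output_tableau m)"
              unfolding ex using less by (intro output_tableau_append) auto
            moreover have "holds_shape R (E - {?B}) ?m"
              unfolding ex holds_shape_def new using less 0(5) by (auto simp: holds_shape_def)
            moreover have "ready R k len ?m"
              unfolding ex using less 0(1) by (auto simp: ready_def inputs_def level_ok_def)
            ultimately have "P ?n ?m \<and> ready R k len ?m"
              using 0 opt' less unfolding P_def b by (simp add: ex)
            then show ?thesis using n mI(2,3) 0(2,3) less unfolding I_def by (auto simp: ex)
          next
            case False
            have "?m (x, ix) = m (x, ix)" if "x \<in> {0, 1, 2, 3, 10, 11, 12}" for x ix
              unfolding ex using False that by auto
            then have "holds_shape R E ?m" "ready R k len ?m" "output_tableau ?m = T"
              using shape_ready_output_cong[of ?m m] 0(1,4,5) by blast+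
            then show ?thesis
              using 0 True mI(2,3) False unfolding I_def by (simp add: ex)
          qed
        qed
      qed
    qed
    then show "triple (\<lambda>m. I ?n m \<and> m (21, []) = r \<and> m (22, []) = c) (unrank_body R) 19
        (\<lambda>m. I (Suc ?n) m \<and> m (21, []) = r \<and> m (22, []) = c)"
      unfolding loop_free_unrank_body(2)[of R, symmetric] by (intro triple_loop_free loop_free_unrank_body(1))
  next
    fix j and m :: mem and v
    show "I j (m((21, []) := v)) \<longleftrightarrow> I j m" "I j (m((22, []) := v)) \<longleftrightarrow> I j m"
    proof -
      have c: "ready R k len (m((x, []) := v)) = ready R k len m" "output_tableau (m((x, []) := v)) = output_tableau m"
        "holds_shape R A (m((x, []) := v)) = holds_shape R A m" if "x \<in> {21, 22}" for x A
        by (rule shape_ready_output_cong; use that in auto)+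
      show "I j (m((21, []) := v)) \<longleftrightarrow> I j m" "I j (m((22, []) := v)) \<longleftrightarrow> I j m"
        unfolding I_def P_def by (simp_all add: c)
    qed
  next
    show "m (0, [1]) + 1 = Suc k" if "I j m" for j m
      using that by (simp add: I_def ready_def inputs_def)
  qed
  then show ?thesis
  proof (rule triple_mono)
    fix m assume "I (Suc k * Suc k) m"
    moreover have "sum ?w {..<Suc k * Suc k} > u"
      using sum_weight[OF D R len E, of M] u by (simp add: E_def)
    ultimately obtain i where i: "i < Suc k * Suc k" "P i m" and m: "ready R k len m" "m (29, []) = l"
      by (auto simp: I_def simp del: mult_Suc mult_Suc_right)
    let ?T = "add_value (Suc M) (?b i) T"
    have b: "?b i \<in> opts D E" using i(2) by (simp add: P_def)
    have "ptab D N M ?T"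
      using ptab_add_value_iff[OF T, of "?b i"] opts_subset[OF E(2)] b M S(2) by (auto simp: E_def)
    moreover have "empt D ?T = E - {?b i}" by (simp add: empt_add_value E_def)
    moreover have "unrank D k (Suc M) T u T'" if "unrank D k M ?T (m (26, [])) T'" for T'
      unfolding unrank.simps using i that b unfolding P_def E_def by blast
    ultimately show "ready R k len m \<and> m (29, []) = l \<and> (\<exists>T1. ptab D N M T1 \<and> output_tableau m = T1 \<and> holds_shape R (empt D T1) m \<and>
      m (26, []) < cnt D M (empt D T1) \<and> (\<forall>T'. unrank D k M T1 (m (26, [])) T' \<longrightarrow> unrank D k (Suc M) T u T'))"
      using i(2) m b by (intro conjI exI[of _ ?T]) (auto simp: P_def weight_def)
  qed (auto simp: I_def E_def)
qed

text \<open>The invariant passes ranks upwards: whatever has the remaining rank among the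
  completions of the current tableau has rank \<open>u\<close> among those of
  \<open>S\<close>.\<close>

lemma triple_unrank:
  assumes u: "u < cnt D k (empt D S)"
  shows "triple (\<lambda>m. ready R k len m \<and> output_tableau m = S \<and> holds_shape R (empt D S) m \<and> m (26, []) = u) (unrank_com R)
    (k * (3 + 1 + (Suc k * (Suc k * (19 + 4) + 8) + 4) + 4) + 4) (\<lambda>m. unrank D k k S u (output_tableau m))"
proof -
  define I where "I i m \<longleftrightarrow> ready R k len m \<and> (\<exists>T. ptab D N (k - i) T \<and> output_tableau m = T \<and> holds_shape R (empt D T) m \<and>
     m (26, []) < cnt D (k - i) (empt D T) \<and> (\<forall>T'. unrank D k (k - i) T (m (26, [])) T' \<longrightarrow> unrank D k k S u T'))" for i m
  have finD: "finite D" using D by (simp add: young_def)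
  let ?init = "Seq (Assign 20 [] (Sub (Sub k_exp (Num 1)) (Cell 29 []))) (Assign 27 [] (Num 0))"
  have "triple (I 0) (unrank_com R) (k * (3 + 1 + (Suc k * (Suc k * (19 + 4) + 8) + 4) + 4) + 4) (I k)"
    unfolding unrank_com_def
  proof (rule triple_for_loop)
    fix i assume i: "i < k"
    show "triple (\<lambda>m. I i m \<and> m (29, []) = i) (Seq ?init (scan (unrank_body R))) (3 + 1 + (Suc k * (Suc k * (19 + 4) + 8) + 4))
      (\<lambda>m. I (Suc i) m \<and> m (29, []) = i)"
    proof (rule tripleI)
      fix m assume m: "I i m \<and> m (29, []) = i"
      then obtain T where T: "ptab D N (k - i) T" "output_tableau m = T" "holds_shape R (empt D T) m"
        "m (26, []) < cnt D (k - i) (empt D T)" "\<And>T'. unrank D k (k - i) T (m (26, [])) T' \<Longrightarrow> unrank D k k S u T'"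
        and r: "ready R k len m" by (auto simp: I_def)
      define M where "M = k - Suc i"
      have M: "k - i = Suc M" "Suc M \<le> k" "k - 1 - i = M" using i by (auto simp: M_def)
      have "card (empt D T) \<le> k"
      proof (rule ccontr)
        assume "\<not> ?thesis"
        then have "cnt D (k - i) (empt D T) = 0"
          using finD finite_subset[OF empt_subset] by (intro cnt_eq_0) auto
        then show False using T(4) by simp
      qed
      note scan = triple_unrank_scan[OF T(1)[unfolded M(1)] M(2) this T(4)[unfolded M(1)], of i]
      let ?m = "m((20, []) := M, (27, []) := 0)"
      have k: "m (0, [1]) = k" using r by (simp add: ready_def inputs_def)
      have "triple (\<lambda>x. x = m) ?init (cost ?init) (\<lambda>x. x = ?m)"
        using m k M(3) by (intro triple_loop_free) auto
      then have "triple (\<lambda>x. x = m) ?init 3 (\<lambda>m'. ready R k len m' \<and> m' (20, []) = M \<and> m' (29, []) = i \<and> m' (27, []) = 0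
          \<and> output_tableau m' = T \<and> holds_shape R (empt D T) m' \<and> m' (26, []) = m (26, []))"
      proof (rule triple_mono)
        have c: "ready R k len ?m = ready R k len m" "output_tableau ?m = output_tableau m"
          "holds_shape R A ?m = holds_shape R A m" for A
          by (rule shape_ready_output_cong; auto)+
        show "ready R k len m' \<and> m' (20, []) = M \<and> m' (29, []) = i \<and> m' (27, []) = 0
            \<and> output_tableau m' = T \<and> holds_shape R (empt D T) m' \<and> m' (26, []) = m (26, [])"
          if "m' = ?m" for m'
          using m r T(2,3) c unfolding that by simp
      qed simp_all
      from triple_Seq[OF this scan]
      have "triple (\<lambda>x. x = m) (Seq ?init (scan (unrank_body R))) (3 + 1 + (Suc k * (Suc k * (19 + 4) + 8) + 4))
        (\<lambda>m. I (Suc i) m \<and> m (29, []) = i)"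
        by (rule triple_mono) (use T(5) in \<open>auto simp: I_def M M_def[symmetric]\<close>)
      then show "\<exists>m'. run (3 + 1 + (Suc k * (Suc k * (19 + 4) + 8) + 4)) (Seq ?init (scan (unrank_body R)), m) = return_pmf (Skip, m')
          \<and> I (Suc i) m' \<and> m' (29, []) = i"
        unfolding triple_def by blast
    qed
  next
    fix j and m :: mem and v
    show "I j (m((29, []) := v)) \<longleftrightarrow> I j m"
    proof -
      have c: "ready R k len (m((29, []) := v)) = ready R k len m" "output_tableau (m((29, []) := v)) = output_tableau m"
        "holds_shape R A (m((29, []) := v)) = holds_shape R A m" for A
        by (rule shape_ready_output_cong; auto)+
      show ?thesis unfolding I_def c by simp
    qed
  qed (auto simp: I_def ready_def inputs_def)
  then show ?thesis
  proof (rule triple_mono)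
    fix m assume "I k m"
    then obtain T where T: "output_tableau m = T" "m (26, []) < cnt D 0 (empt D T)"
      "\<And>T'. unrank D k 0 T (m (26, [])) T' \<Longrightarrow> unrank D k k S u T'" by (auto simp: I_def)
    have "unrank D k 0 T (m (26, [])) T"
      using T(2) by (simp add: unrank.simps split: if_splits)
    then show "unrank D k k S u (output_tableau m)" using T by simp
  qed (use S u in \<open>auto simp: I_def\<close>)
qed

end

section \<open>The sampler\<close>

text \<open>The first assignment sets the only nonzero entry at level 0, that of the empty ideal.
  \<open>Choose\<close> reads the number of all completions at level \<open>k\<close>.\<close>

definition sampler :: "nat \<Rightarrow> com" where
  "sampler R =
     Seq (Seq (Assign 12 (Num 0 # map Num (replicate (2 * R) 0)) (Num 1))
           (Seq (for_loop 20 [] k_exp (for_cells (cells R) (scan (dp_body R)))) (init_com R)))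
         (Seq (Choose 26 [] (Cell 12 (k_exp # table_exp R))) (unrank_com R))"

lemma output_input_mem:
  assumes "\<And>b. finite (S b)"
  shows "output_tableau (input_mem lam N k S num den) = S"
proof
  fix b :: box
  obtain r c where b: "b = (r, c)" by fastforce
  let ?l = "sorted_list_of_set (S b)"
  have "output_tableau (input_mem lam N k S num den) b = (\<lambda>i. ?l ! i) ` {..<card (S b)}"
    by (auto simp: output_tableau_def input_mem_def b intro!: image_cong)
  also have "\<dots> = set ?l"
    by (simp add: set_conv_nth image_def lessThan_def) blast
  finally show "output_tableau (input_mem lam N k S num den) b = S b"
    using assms by simp
qed

lemma tv_dist_refl: "finite X \<Longrightarrow> tv_dist X \<mu> \<mu> = 0"
  by (simp add: tv_dist_def image_constant_conv Pow_not_empty)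

definition sampler_pre_time :: "nat \<Rightarrow> nat \<Rightarrow> nat" where
  "sampler_pre_time R k = 1 + 1 + (dp_time R k + 1 + ((R * (3 + 4) + 4) + 1 + (Suc k * (Suc k * (6 + 4) + 8) + 4)))"

definition sampler_post_time :: "nat \<Rightarrow> nat" where
  "sampler_post_time k = k * (3 + 1 + (Suc k * (Suc k * (19 + 4) + 8) + 4) + 4) + 4"

text \<open>\<open>k\<close> levels, \<open>Suc k ^ (2 * R)\<close> vectors and the two nested loops
  of a scan give the exponent \<open>2 * R + 3\<close>.\<close>

lemma sampler_time_le:
  "sampler_pre_time R k + 1 + (1 + 1 + sampler_post_time k) \<le> (200 + 30 * R) * Suc k ^ (2 * R + 3)"
proof -
  define K where "K = Suc k"
  have K: "1 \<le> K" "k \<le> K" by (simp_all add: K_def)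
  have pw: "K ^ a \<le> K ^ (2 * R + 3)" if "a \<le> 2 * R + 3" for a
    using K that by (intro power_increasing) auto
  define P where "P = K ^ (2 * R + 3)"
  have P: "1 \<le> P" "K \<le> P" "K * K \<le> P" "K * K * K \<le> P"
    using pw[of 0] pw[of 1] pw[of 2] pw[of 3] by (simp_all add: P_def power2_eq_square power3_eq_cube mult.assoc)
  have KK: "K \<le> K * K" "1 \<le> K * K" using K by simp_all
  have "K * (K * (18 + 4) + 8) + 4 = 22 * (K * K) + 8 * K + 4" by (simp add: algebra_simps)
  also have "\<dots> \<le> 34 * (K * K)" using KK by linarith
  finally have "(K * (K * (18 + 4) + 8) + 4) + 8 * (2 * R) \<le> 34 * (K * K) + 16 * R * (K * K)"
    using KK(2) mult_le_mono2[OF KK(2), of "16 * R"] by linarith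
  then have "K ^ (2 * R) * ((K * (K * (18 + 4) + 8) + 4) + 8 * (2 * R)) \<le> K ^ (2 * R) * ((34 + 16 * R) * (K * K))"
    by (intro mult_left_mono) (simp_all add: algebra_simps)
  then have "k * (K ^ (2 * R) * ((K * (K * (18 + 4) + 8) + 4) + 8 * (2 * R)) + 4) \<le> K * (K ^ (2 * R) * ((34 + 16 * R) * (K * K)) + 4)"
    using K by (intro mult_mono) auto
  also have "\<dots> = (34 + 16 * R) * P + 4 * K"
    by (simp add: P_def power_add power3_eq_cube algebra_simps)
  finally have dp: "dp_time R k \<le> (34 + 16 * R) * P + 4 * K + 4"
    unfolding dp_time_def K_def[symmetric] by linarith
  have "R * (3 + 4) \<le> 7 * R * P" using mult_le_mono2[OF P(1), of "7 * R"] by simp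
  moreover have "K * (K * (6 + 4) + 8) = 10 * (K * K) + 8 * K" by (simp add: algebra_simps)
  ultimately have pre: "sampler_pre_time R k \<le> (34 + 16 * R) * P + 7 * R * P + 40 * P"
    unfolding sampler_pre_time_def K_def[symmetric] using dp P by linarith
  have "sampler_post_time k \<le> K * (3 + 1 + (K * (K * (19 + 4) + 8) + 4) + 4) + 4"
    unfolding sampler_post_time_def K_def[symmetric] using K(2) by (intro add_mono mult_right_mono) auto
  also have "\<dots> = 23 * (K * K * K) + 8 * (K * K) + 12 * K + 4" by (simp add: algebra_simps)
  also have "\<dots> \<le> 47 * P" using P by linarith
  finally have "sampler_pre_time R k + 1 + (1 + 1 + sampler_post_time k) \<le> (34 + 16 * R) * P + 7 * R * P + 40 * P + 47 * P + 3 * P"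
    using pre P(1) by linarith
  also have "\<dots> \<le> (200 + 30 * R) * P" by (simp add: algebra_simps)
  finally show ?thesis by (simp add: P_def K_def)
qed

text \<open>After the only random choice the run is deterministic, with one time bound for all
  ranks, so the output law is the image of the uniform distribution on the ranks under a
  bijection.\<close>

lemma sampler_correct:
  assumes lam: "young (diagram lam)" and R: "\<And>r c. (r, c) \<in> diagram lam \<Longrightarrow> r \<le> R \<or> c \<le> R"
    and k: "pretableau lam N k S" and ne: "SVT_ext lam N S \<noteq> {}"
  defines "t \<equiv> sampler_pre_time R k + 1 + (1 + 1 + sampler_post_time k)"
    and "X \<equiv> SVT_ext lam N S"
  shows "\<exists>fin. run t (sampler R, input_mem lam N k S num den) = map_pmf (Pair Skip \<circ> fin) (pmf_of_set {..<card X})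
    \<and> bij_betw (output_tableau \<circ> fin) {..<card X} X"
proof -
  let ?D = "diagram lam" and ?m0 = "input_mem lam N k S num den"
  define E where "E = empt ?D S"
  define len where "len r = ?m0 (1, [r])" for r
  have finD: "finite ?D" using lam by (simp add: young_def)
  have X: "X = completions ?D N k S" unfolding X_def using SVT_ext_eq[OF lam k] .
  have kN: "k \<le> N" using k by (simp add: pretableau_def)
  obtain T0 where T0: "T0 \<in> completions ?D N k S" using ne X by (auto simp: X_def)
  have pt: "ptab ?D N k S" using ptab_of_completions[OF T0] .
  have cE: "card (empt ?D S) \<le> k" using card_empt_le[OF finD T0 kN] .
  have cX: "finite X" "card X = cnt ?D k E"
    using card_completions[OF finD pt kN] by (auto simp: X E_def)
  have cX0: "0 < card X" using cX(1) ne by (simp add: card_gt_0_iff X_def)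
  have len: "(r, c) \<in> ?D \<longleftrightarrow> c \<le> len r" if "1 \<le> r" "1 \<le> c" for r c
    using that by (auto simp: len_def input_mem_def diagram_def)
  have finS: "finite (S b)" for b using ptabD(2)[OF pt, of b] finite_subset by blast
  have m0: "?m0 (2, [r, c]) = card (S (r, c))" for r c by (simp add: input_mem_def)
  have out0: "output_tableau ?m0 = S" using output_input_mem[OF finS] .
  note ctx = lam R len pt kN cE m0 out0
  let ?ready = "ready R k len" and ?holds = "holds_shape R E"
  have "triple (\<lambda>m. m = ?m0) (Assign 12 (Num 0 # map Num (replicate (2 * R) 0)) (Num 1))
    (cost (Assign 12 (Num 0 # map Num (replicate (2 * R) 0)) (Num 1))) (table_inv R k len ?m0 0)"
  proof (rule triple_loop_free)
    fix m assume m: "m = ?m0"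
    let ?out = "exec (Assign 12 (Num 0 # map Num (replicate (2 * R) 0)) (Num 1)) m"
    have e: "?out = ?m0((12, 0 # replicate (2 * R) 0) := 1)"
      by (simp add: m)
    have z: "?m0 (x, ix) = 0" if "x \<ge> 10" for x ix using that by (simp add: input_mem_def)
    have "level_ok R k len 0 ?out"
      unfolding level_ok_def e
    proof (intro allI impI)
      fix X Y assume f: "fits R k X Y"
      have z': "fits R k (\<lambda>_. 0) (\<lambda>_. 0)" by (simp add: fits_def)
      have "key R (\<lambda>_. 0) (\<lambda>_. 0) = replicate (2 * R) 0"
        by (simp add: key_def map_replicate_const mult_2 replicate_add del: upt_Suc)
      then have "key R X Y = replicate (2 * R) 0 \<longleftrightarrow> X = (\<lambda>_. 0) \<and> Y = (\<lambda>_. 0)"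
        using key_inj[OF f z'] by metis
      then show "(?m0((12, 0 # replicate (2 * R) 0) := 1)) (12, 0 # key R X Y) = path_count (Suc k) len 0 X Y"
        using z by simp
    qed
    moreover have "inputs k len ?out" unfolding e by (simp add: inputs_def len_def input_mem_def)
    ultimately show "table_inv R k len ?m0 0 ?out"
      using z unfolding table_inv_def by (simp add: e m arrays_def supported_def)
  qed simp
  from triple_Seq[OF this triple_Seq[OF triple_dp triple_init[OF ctx]]]
  have "triple (\<lambda>m. m = ?m0) (Seq (Assign 12 (Num 0 # map Num (replicate (2 * R) 0)) (Num 1))
           (Seq (for_loop 20 [] k_exp (for_cells (cells R) (scan (dp_body R)))) (init_com R)))
     (sampler_pre_time R k) (\<lambda>m. ?ready m \<and> arrays ?m0 m \<and> ?holds m)"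
    unfolding sampler_pre_time_def E_def by simp
  then obtain m1 where m1: "run (sampler_pre_time R k) (Seq (Assign 12 (Num 0 # map Num (replicate (2 * R) 0)) (Num 1))
           (Seq (for_loop 20 [] k_exp (for_cells (cells R) (scan (dp_body R)))) (init_com R)), ?m0) = return_pmf (Skip, m1)"
      "?ready m1" "arrays ?m0 m1" "?holds m1"
    by (rule tripleE) auto
  let ?u = "\<lambda>u. m1((26, []) := u)"
  have E: "young E" "E \<subseteq> ?D" using young_empt[OF lam pt] empt_subset by (auto simp: E_def)
  have "output_tableau m1 = S"
    using output_tableau_cong[of m1 ?m0] m1(3) out0 by (simp add: arrays_def)
  then have outu: "output_tableau (?u u) = S" for u
    using output_tableau_cong[of "?u u" m1] by simp
  have "\<exists>m2. run (sampler_post_time k) (unrank_com R, ?u u) = return_pmf (Skip, m2)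
      \<and> unrank ?D k k S u (output_tableau m2)" if "u < card X" for u
  proof -
    have "?ready (?u u)" "holds_shape R (empt ?D S) (?u u)"
      using m1(2,4) by (simp_all add: ready_def holds_shape_def inputs_def level_ok_def E_def)
    then have "ready R k len (?u u) \<and> output_tableau (?u u) = S \<and> holds_shape R (empt ?D S) (?u u) \<and> (?u u) (26, []) = u"
      using outu by simp
    from tripleE[OF triple_unrank[OF ctx that[unfolded cX(2) E_def]] this] show ?thesis
      unfolding sampler_post_time_def by blast
  qed
  then obtain fin where fin: "\<And>u. u < card X \<Longrightarrow> run (sampler_post_time k) (unrank_com R, ?u u) = return_pmf (Skip, fin u)"
    "\<And>u. u < card X \<Longrightarrow> unrank ?D k k S u (output_tableau (fin u))"
    by metis
  have bij: "bij_betw (output_tableau \<circ> fin) {..<card X} X"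
    unfolding cX(2) E_def unfolding X
    by (rule unrank_bij[OF lam R len pt kN]) (use fin(2)[unfolded cX(2) E_def] in simp_all)
  have "m1 (12, k # key R (rows R E) (cols R E)) = card X"
    using m1(2) fits_rows[OF ctx E(1)] cE path_count_rows[OF lam R len E, of k k]
    by (simp add: ready_def level_ok_def cX(2) E_def)
  moreover have "(\<lambda>i. m1 (10, [i])) = rows R E" "(\<lambda>i. m1 (11, [i])) = cols R E" "m1 (0, [1]) = k"
    using m1(2,4) by (auto simp: ready_def holds_shape_def inputs_def)
  ultimately have cell: "aval m1 (Cell 12 (k_exp # table_exp R)) = card X"
    by (simp add: aval_table_exp)
  have choose: "run 1 (Choose 26 [] (Cell 12 (k_exp # table_exp R)), m1) = map_pmf (\<lambda>u. (Skip, ?u u)) (pmf_of_set {..<card X})"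
  proof -
    have "run 0 = return_pmf" by (rule ext) simp
    then have "run 1 s = step (fst s) (snd s)" for s by (simp add: bind_return_pmf')
    moreover have "max 1 (aval m1 (Cell 12 (k_exp # table_exp R))) = card X"
      unfolding cell using cX0 by simp
    ultimately show ?thesis by (simp only: fst_conv snd_conv step.simps list.map)
  qed
  have pos: "{..<card X} \<noteq> {}" using cX0 by auto
  have "run (1 + 1 + sampler_post_time k) (Seq (Choose 26 [] (Cell 12 (k_exp # table_exp R))) (unrank_com R), m1)
      = bind_pmf (run 1 (Choose 26 [] (Cell 12 (k_exp # table_exp R)), m1)) (\<lambda>s. run (sampler_post_time k) (unrank_com R, snd s))"
  proof (rule run_Seq)
    show "halted (run 1 (Choose 26 [] (Cell 12 (k_exp # table_exp R)), m1))"
      unfolding choose by (auto simp: halted_def)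
    fix m' assume "(Skip, m') \<in> set_pmf (run 1 (Choose 26 [] (Cell 12 (k_exp # table_exp R)), m1))"
    then obtain u where "u < card X" "m' = ?u u"
      unfolding choose using pos by (auto simp: set_pmf_of_set)
    then show "halted (run (sampler_post_time k) (unrank_com R, m'))"
      using fin(1) by (simp add: halted_def)
  qed
  also have "\<dots> = bind_pmf (pmf_of_set {..<card X}) (\<lambda>u. run (sampler_post_time k) (unrank_com R, ?u u))"
    unfolding choose by (simp add: bind_map_pmf)
  also have "\<dots> = bind_pmf (pmf_of_set {..<card X}) (\<lambda>u. return_pmf (Skip, fin u))"
    using fin(1) pos by (intro bind_pmf_cong) (auto simp: set_pmf_of_set)
  also have "\<dots> = map_pmf (Pair Skip \<circ> fin) (pmf_of_set {..<card X})"
    by (simp add: map_pmf_def comp_def)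
  finally have post: "run (1 + 1 + sampler_post_time k) (Seq (Choose 26 [] (Cell 12 (k_exp # table_exp R))) (unrank_com R), m1)
      = map_pmf (Pair Skip \<circ> fin) (pmf_of_set {..<card X})" .
  let ?pre = "Seq (Assign 12 (Num 0 # map Num (replicate (2 * R) 0)) (Num 1))
      (Seq (for_loop 20 [] k_exp (for_cells (cells R) (scan (dp_body R)))) (init_com R))"
    and ?post = "Seq (Choose 26 [] (Cell 12 (k_exp # table_exp R))) (unrank_com R)"
  have "run t (sampler R, ?m0) = bind_pmf (run (sampler_pre_time R k) (?pre, ?m0))
      (\<lambda>s. run (1 + 1 + sampler_post_time k) (?post, snd s))"
    unfolding t_def sampler_def
  proof (rule run_Seq)
    show "halted (run (sampler_pre_time R k) (?pre, ?m0))"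
      unfolding m1(1) by (simp add: halted_def)
    fix m' assume "(Skip, m') \<in> set_pmf (run (sampler_pre_time R k) (?pre, ?m0))"
    then have "m' = m1" unfolding m1(1) by simp
    moreover have "halted (run (1 + 1 + sampler_post_time k) (?post, m1))"
      unfolding post by (auto simp: halted_def)
    ultimately show "halted (run (1 + 1 + sampler_post_time k) (?post, m'))" by (simp only:)
  qed
  also have "\<dots> = map_pmf (Pair Skip \<circ> fin) (pmf_of_set {..<card X})"
    unfolding m1(1) bind_return_pmf snd_conv by (rule post)
  finally show ?thesis using bij by blast
qed

text \<open>A box outside the first two rows and columns lies in the rectangle, so every box has a
  coordinate of at most \<open>max 2 (max p q)\<close>. The output is exactly uniform, hence at
  distance 0.\<close>

lemma is_FPAUS_sampler: "is_FPAUS (sampler (max 2 (max p q))) (rect_family p q)"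
proof -
  define R where "R = max 2 (max p q)"
  define d where "d = 2 * R + 3"
  show ?thesis
    unfolding is_FPAUS_def R_def[symmetric]
  proof (intro exI[of _ d] exI[of _ "\<lambda>i j l. real (200 + 30 * R) * real (d choose i) * real (d choose j) * real (d choose l)"]
      ballI, clarify)
    fix lam N S k and num den :: nat
    assume fam: "(lam, N, S) \<in> rect_family p q" and k: "pretableau lam N k S"
      and ne: "SVT_ext lam N S \<noteq> {}" and nd: "0 < num" "num \<le> den"
    let ?X = "SVT_ext lam N S" and ?m0 = "input_mem lam N k S num den"
    let ?t = "sampler_pre_time R k + 1 + (1 + 1 + sampler_post_time k)"
    have "r \<le> R \<or> c \<le> R" if "(r, c) \<in> diagram lam" for r c
      using rect_family_shape(2)[OF fam that] by (auto simp: R_def)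
    from sampler_correct[OF rect_family_shape(1)[OF fam] this k ne, of num den]
    obtain fin where fin: "run ?t (sampler R, ?m0) = map_pmf (Pair Skip \<circ> fin) (pmf_of_set {..<card ?X})"
      "bij_betw (output_tableau \<circ> fin) {..<card ?X} ?X" by blast
    have X: "finite ?X" using fin(2) bij_betw_finite by blast
    have pos: "{..<card ?X} \<noteq> {}" using X ne by (auto simp: lessThan_empty_iff)
    have "map_pmf (output_tableau \<circ> snd) (run ?t (sampler R, ?m0)) = map_pmf (output_tableau \<circ> fin) (pmf_of_set {..<card ?X})"
      unfolding fin(1) by (simp add: pmf.map_comp comp_def)
    also have "\<dots> = pmf_of_set ?X"
      by (rule map_pmf_of_set_bij_betw[OF fin(2) pos]) simp
    finally have Gam: "map_pmf (output_tableau \<circ> snd) (run ?t (sampler R, ?m0)) = pmf_of_set ?X" .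
    have ln: "0 \<le> ln (1 / (real num / real den))" using nd by simp
    have "real ?t \<le> real ((200 + 30 * R) * Suc k ^ d)"
      unfolding d_def by (rule of_nat_mono[OF sampler_time_le])
    also have "\<dots> = real (200 + 30 * R) * (1 + real k) ^ d * 1 * 1" by simp
    also have "\<dots> \<le> real (200 + 30 * R) * (1 + real k) ^ d * (1 + real (card (empty_boxes lam S))) ^ d
        * (1 + ln (1 / (real num / real den))) ^ d"
      using ln by (intro mult_mono) (auto simp: one_le_power)
    finally have time: "real ?t \<le> \<dots>" .
    have halt: "\<forall>s\<in>set_pmf (run ?t (sampler R, ?m0)). fst s = Skip"
      unfolding fin(1) by auto
    have sub: "set_pmf (map_pmf (output_tableau \<circ> snd) (run ?t (sampler R, ?m0))) \<subseteq> ?X"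
      unfolding Gam using X ne by (simp add: set_pmf_of_set)
    have tv: "tv_dist ?X (pmf (map_pmf (output_tableau \<circ> snd) (run ?t (sampler R, ?m0)))) (pmf (pmf_of_set ?X))
        \<le> real num / real den"
      unfolding Gam tv_dist_refl[OF X] by simp
    show "\<exists>n. real n \<le> poly3 d (\<lambda>i j l. real (200 + 30 * R) * real (d choose i) * real (d choose j) * real (d choose l))
          (real k) (real (card (empty_boxes lam S))) (ln (1 / (real num / real den))) \<and>
        (let out = run n (sampler R, ?m0); Gam = map_pmf (output_tableau \<circ> snd) out
         in (\<forall>s\<in>set_pmf out. fst s = Skip) \<and> set_pmf Gam \<subseteq> ?X \<and>
           tv_dist ?X (pmf Gam) (pmf (pmf_of_set ?X)) \<le> real num / real den)"
      unfolding poly3_binomial Let_def using time halt sub tv by blast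
  qed
qed

theorem theorem5p4:
  fixes p q :: nat
  assumes "0 < p" and "0 < q"
  shows "rapidly_mixing (rect_family p q) \<and> (\<exists>prog. is_FPAUS prog (rect_family p q))"
  using rapidly_mixing_rect_family is_FPAUS_sampler by blast

end
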